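(* Let $\varepsilon\in[0,1]$ and suppose $\mathbf w\in C([0,T];W^{1,\infty}_0(\Omega)^2)$. Then for any $h>0$ and any $\Delta t\in(0,1/2)$ satisfying $\Delta t\,|\mathbf w|_{C(W^{1,\infty})}\le 1/4$, there exists a solution $(\mathbf u_h,p_h,\mathbf C_h)=\{(\mathbf u_h^n,p_h^n,\mathbf C_h^n)\}_{n=1}^{N_T}\subset V_h\times Q_h\times W_h$ of the scheme (S) given in the context.
   Context: **Setting.** $\Omega\subset\mathbb R^2$ is a bounded polygonal domain, $T>0$, $\nu>0$, $\varepsilon\in[0,1]$, and $\delta_0>0$ is a fixed constant. $(\cdot,\cdot)$ is the $L^2(\Omega)$ inner product (scalar-, vector- or matrix-valued functions). $V=H^1_0(\Omega)^2$, $Q=L^2_0(\Omega)$ ($L^2$ functions with zero mean), $W=H^1_{sym}(\Omega)=\{\mathbf D\in H^1(\Omega)^{2\times2}:\mathbf D=\mathbf D^T\}$. $(\nabla\mathbf u)_{ij}=\partial u_i/\partial x_j$, $\mathrm D(\mathbf u)=\frac12(\nabla\mathbf u+(\nabla\mathbf u)^T)$, $\mathbf I$ is the identity matrix. $\mathbf w:\Omega\times(0,T)\to\mathbb R^2$ is a given velocity; $|\mathbf w|_{C(W^{1,\infty})}=\max_{t\in[0,T]}|\mathbf w(t)|_{1,\infty}$, where $|\cdot|_{1,\infty}$ is the $W^{1,\infty}(\Omega)$ seminorm. **Forms.** $a_u(\mathbf u,\mathbf v)=2(\mathrm D(\mathbf u),\mathrm D(\mathbf v))$, $b(\mathbf u,q)=-(\operatorname{div}\mathbf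 u,q)$, $a_c(\mathbf C,\mathbf D)=(\nabla\mathbf C,\nabla\mathbf D)$. **Discretization.** $\Delta t>0$ is the time increment, $N_T=\lfloor T/\Delta t\rfloor$, $t^n=n\Delta t$, $\mathbf w^n=\mathbf w(\cdot,t^n)$, $X_1^n(x)=x-\mathbf w^n(x)\Delta t$, and $\circ$ is composition of functions. $\{\mathcal T_h\}_{h\downarrow0}$ is a regular family of triangulations of $\bar\Omega$, $h_K$ is the diameter of $K\in\mathcal T_h$, $h=\max_Kh_K$, and there is $\alpha_0>0$ independent of $h$ with $h/h_K\le\alpha_0$ for all $K\in\mathcal T_h$ and all $h$. $M_h$ is the space of continuous functions on $\bar\Omega$ that are affine on each $K$; $V_h=M_h^2\cap V$, $Q_h=M_h\cap Q$, and $W_h$ is the space of symmetric $2\times2$ matrix functions with entries in $M_h$. $\mathcal S_h(p,q)=\delta_0\sum_Kh_K^2(\nabla p,\nabla q)_K$ with $(\cdot,\cdot)_K$ the $L^2(K)^2$ inner product, and $\mathcal A_h((\mathbf u,p),(\mathbf v,q))=\nu a_u(\mathbf u,\mathbf v)+b(\mathbf u,q)+b(\mathbf v,p)-\mathcal S_h(p,q)$. For symmetric $\mathbf D\in\mathbb R^{2\times2}$, $\mathbf D^{\#}=\begin{pmatrix}D_{22}&-D_{12}\\-D_{12}&D_{11}\end{pmatrix}$. **Scheme (S).** Let $(\mathbf u_h^0,\mathbf C_h^0)\in V_h\times W_h$ and $\mathbf f_h=\{\mathbf f_h^n\}_{n=1}^{N_T}\subset L^2(\Omega)^2$, $\mathbf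 F_h=\{\mathbf F_h^n\}_{n=1}^{N_T}\subset L^2(\Omega)^{2\times2}$ be given. Find $\{(\mathbf u_h^n,p_h^n,\mathbf C_h^n)\}_{n=1}^{N_T}\subset V_h\times Q_h\times W_h$ such that for $n=1,\dots,N_T$ and all $(\mathbf v_h,q_h,\mathbf D_h)\in V_h\times Q_h\times W_h$ $$\Bigl(\tfrac{\mathbf u_h^n-\mathbf u_h^{n-1}\circ X_1^n}{\Delta t},\mathbf v_h\Bigr)+\mathcal A_h((\mathbf u_h^n,p_h^n),(\mathbf v_h,q_h))=-((\operatorname{tr}\mathbf C_h^n)\mathbf C_h^n,\nabla\mathbf v_h)+(\mathbf f_h^n,\mathbf v_h),$$ $$\Bigl(\tfrac{\mathbf C_h^n-\mathbf C_h^{n-1}\circ X_1^n}{\Delta t},\mathbf D_h\Bigr)+\varepsilon a_c(\mathbf C_h^n,\mathbf D_h)=2((\nabla\mathbf u_h^n)\mathbf C_h^n,\mathbf D_h)+((\operatorname{div}\mathbf u_h^n)(\mathbf C_h^n)^{\#},\mathbf D_h)-((\operatorname{tr}\mathbf C_h^n)^2\mathbf C_h^n,\mathbf D_h)+((\operatorname{tr}\mathbf C_h^n)\mathbf I,\mathbf D_h)+(\mathbf F_h^n,\mathbf D_h).$$ *)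

theory Defs
  imports "HOL-Analysis.Analysis" "HOL-Probability.Essential_Supremum"
begin

type_synonym R2 = "real^2"
type_synonym M2 = "real^2^2"

text \<open>Elements of function spaces on \<open>\<Omega>\<close> are represented by total functions on the plane;
  only their values on \<open>\<Omega>\<close> (on \<open>closure \<Omega>\<close> for finite element functions) matter.\<close>

section \<open>Sobolev spaces\<close>

definition partial :: "2 \<Rightarrow> (R2 \<Rightarrow> real) \<Rightarrow> R2 \<Rightarrow> real" where
  "partial j \<phi> x = frechet_derivative \<phi> (at x) (axis j 1)"

primrec Ck :: "nat \<Rightarrow> (R2 \<Rightarrow> real) \<Rightarrow> bool" where
  "Ck 0 \<phi> \<longleftrightarrow> continuous_on UNIV \<phi>"
| "Ck (Suc k) \<phi> \<longleftrightarrow> (\<forall>x. \<phi> differentiable (at x)) \<and> (\<forall>j. Ck k (partial j \<phi>))"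

definition Cc_infty :: "R2 set \<Rightarrow> (R2 \<Rightarrow> real) set" where
  "Cc_infty \<Omega> = {\<phi>. (\<forall>k. Ck k \<phi>) \<and> compact (closure {x. \<phi> x \<noteq> 0}) \<and> closure {x. \<phi> x \<noteq> 0} \<subseteq> \<Omega>}"

definition L1_loc :: "R2 set \<Rightarrow> (R2 \<Rightarrow> real) set" where
  "L1_loc \<Omega> = {f. \<forall>K. compact K \<and> K \<subseteq> \<Omega> \<longrightarrow> f absolutely_integrable_on K}"

definition has_weak_partial :: "R2 set \<Rightarrow> 2 \<Rightarrow> (R2 \<Rightarrow> real) \<Rightarrow> (R2 \<Rightarrow> real) \<Rightarrow> bool" where
  "has_weak_partial \<Omega> j f g \<longleftrightarrow> f \<in> L1_loc \<Omega> \<and> g \<in> L1_loc \<Omega> \<and>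
     (\<forall>\<phi>\<in>Cc_infty \<Omega>.
        (LINT x|lebesgue_on \<Omega>. f x * partial j \<phi> x) = - (LINT x|lebesgue_on \<Omega>. g x * \<phi> x))"

text \<open>The weak derivative is unique up to null sets, so the choice is immaterial under integrals
  and essential suprema.\<close>

definition weak_partial :: "R2 set \<Rightarrow> 2 \<Rightarrow> (R2 \<Rightarrow> real) \<Rightarrow> R2 \<Rightarrow> real" where
  "weak_partial \<Omega> j f = (SOME g. has_weak_partial \<Omega> j f g)"

definition L2 :: "R2 set \<Rightarrow> (R2 \<Rightarrow> 'a::euclidean_space) set" where
  "L2 \<Omega> = {f. f \<in> borel_measurable (lebesgue_on \<Omega>) \<and> integrable (lebesgue_on \<Omega>) (\<lambda>x. (norm (f x))\<^sup>2)}"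

text \<open>On matrices the inner product of type \<open>real^2^2\<close> is the Frobenius product.\<close>

definition ip :: "R2 set \<Rightarrow> (R2 \<Rightarrow> 'a::euclidean_space) \<Rightarrow> (R2 \<Rightarrow> 'a) \<Rightarrow> real" where
  "ip \<Omega> f g = (LINT x|lebesgue_on \<Omega>. f x \<bullet> g x)"

definition L2_0 :: "R2 set \<Rightarrow> (R2 \<Rightarrow> real) set" where
  "L2_0 \<Omega> = {q \<in> L2 \<Omega>. (LINT x|lebesgue_on \<Omega>. q x) = 0}"

definition H1 :: "R2 set \<Rightarrow> (R2 \<Rightarrow> real) set" where
  "H1 \<Omega> = {f \<in> L2 \<Omega>. \<forall>j. \<exists>g \<in> L2 \<Omega>. has_weak_partial \<Omega> j f g}"

definition H1_norm :: "R2 set \<Rightarrow> (R2 \<Rightarrow> real) \<Rightarrow> real" where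
  "H1_norm \<Omega> f = sqrt (ip \<Omega> f f + (\<Sum>j\<in>UNIV. ip \<Omega> (weak_partial \<Omega> j f) (weak_partial \<Omega> j f)))"

definition H1_0 :: "R2 set \<Rightarrow> (R2 \<Rightarrow> real) set" where
  "H1_0 \<Omega> = {f \<in> H1 \<Omega>. \<exists>\<phi>. (\<forall>n::nat. \<phi> n \<in> Cc_infty \<Omega>) \<and>
                          (\<lambda>n. H1_norm \<Omega> (\<lambda>x. f x - \<phi> n x)) \<longlonglongrightarrow> 0}"

definition Linf_norm :: "R2 set \<Rightarrow> (R2 \<Rightarrow> real) \<Rightarrow> ereal" where
  "Linf_norm \<Omega> f = esssup (lebesgue_on \<Omega>) (\<lambda>x. ereal \<bar>f x\<bar>)"

definition Linf :: "R2 set \<Rightarrow> (R2 \<Rightarrow> real) set" where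
  "Linf \<Omega> = {f. f \<in> borel_measurable (lebesgue_on \<Omega>) \<and> Linf_norm \<Omega> f < \<infinity>}"

definition W1inf :: "R2 set \<Rightarrow> (R2 \<Rightarrow> real) set" where
  "W1inf \<Omega> = {f \<in> Linf \<Omega>. \<forall>j. \<exists>g \<in> Linf \<Omega>. has_weak_partial \<Omega> j f g}"

text \<open>Zero boundary values are imposed in the trace sense. The closure of the test functions in the
  \<open>W\<^sup>1\<^sup>,\<^sup>\<infinity>\<close> norm would be a strictly smaller space.\<close>

definition W1inf_0 :: "R2 set \<Rightarrow> (R2 \<Rightarrow> real) set" where
  "W1inf_0 \<Omega> = W1inf \<Omega> \<inter> H1_0 \<Omega>"

text \<open>Norm and seminorm of a vector field: maximum over components and derivatives.\<close>

definition W1inf_seminorm :: "R2 set \<Rightarrow> (R2 \<Rightarrow> R2) \<Rightarrow> ereal" where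
  "W1inf_seminorm \<Omega> v = (SUP i. SUP j. Linf_norm \<Omega> (weak_partial \<Omega> j (\<lambda>x. v x $ i)))"

definition W1inf_norm :: "R2 set \<Rightarrow> (R2 \<Rightarrow> R2) \<Rightarrow> ereal" where
  "W1inf_norm \<Omega> v = max (SUP i. Linf_norm \<Omega> (\<lambda>x. v x $ i)) (W1inf_seminorm \<Omega> v)"

definition C_W1inf_0 :: "real \<Rightarrow> R2 set \<Rightarrow> (real \<Rightarrow> R2 \<Rightarrow> R2) set" where
  "C_W1inf_0 Tf \<Omega> = {w. \<forall>t\<in>{0..Tf}. (\<forall>i. (\<lambda>x. w t x $ i) \<in> W1inf_0 \<Omega>) \<and>
       ((\<lambda>s. W1inf_norm \<Omega> (\<lambda>x. w s x - w t x)) \<longlongrightarrow> 0) (at t within {0..Tf})}"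

definition C_W1inf_seminorm :: "real \<Rightarrow> R2 set \<Rightarrow> (real \<Rightarrow> R2 \<Rightarrow> R2) \<Rightarrow> ereal" where
  "C_W1inf_seminorm Tf \<Omega> w = (SUP t\<in>{0..Tf}. W1inf_seminorm \<Omega> (w t))"

section \<open>Differential operators and bilinear forms\<close>

definition grad :: "R2 set \<Rightarrow> (R2 \<Rightarrow> real) \<Rightarrow> R2 \<Rightarrow> R2" where
  "grad \<Omega> q x = (\<chi> j. weak_partial \<Omega> j q x)"

definition jac :: "R2 set \<Rightarrow> (R2 \<Rightarrow> R2) \<Rightarrow> R2 \<Rightarrow> M2" where
  "jac \<Omega> u x = (\<chi> i j. weak_partial \<Omega> j (\<lambda>y. u y $ i) x)"

definition symgrad :: "R2 set \<Rightarrow> (R2 \<Rightarrow> R2) \<Rightarrow> R2 \<Rightarrow> M2" where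
  "symgrad \<Omega> u x = (1/2) *\<^sub>R (jac \<Omega> u x + transpose (jac \<Omega> u x))"

definition dvg :: "R2 set \<Rightarrow> (R2 \<Rightarrow> R2) \<Rightarrow> R2 \<Rightarrow> real" where
  "dvg \<Omega> u x = (\<Sum>i\<in>UNIV. weak_partial \<Omega> i (\<lambda>y. u y $ i) x)"

definition a_u :: "R2 set \<Rightarrow> (R2 \<Rightarrow> R2) \<Rightarrow> (R2 \<Rightarrow> R2) \<Rightarrow> real" where
  "a_u \<Omega> u v = 2 * ip \<Omega> (symgrad \<Omega> u) (symgrad \<Omega> v)"

definition b_form :: "R2 set \<Rightarrow> (R2 \<Rightarrow> R2) \<Rightarrow> (R2 \<Rightarrow> real) \<Rightarrow> real" where
  "b_form \<Omega> u q = - ip \<Omega> (dvg \<Omega> u) q"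

definition a_c :: "R2 set \<Rightarrow> (R2 \<Rightarrow> M2) \<Rightarrow> (R2 \<Rightarrow> M2) \<Rightarrow> real" where
  "a_c \<Omega> C D = (\<Sum>i\<in>UNIV. \<Sum>j\<in>UNIV. ip \<Omega> (grad \<Omega> (\<lambda>x. C x $ i $ j)) (grad \<Omega> (\<lambda>x. D x $ i $ j)))"

definition sharp :: "M2 \<Rightarrow> M2" where
  "sharp D = vector [vector [D$2$2, - (D$1$2)], vector [- (D$1$2), D$1$1]]"

section \<open>Triangulations and finite element spaces\<close>

text \<open>The condition \<open>interior (closure \<Omega>) = \<Omega>\<close> excludes slits and punctures.\<close>

definition polygonal_domain :: "R2 set \<Rightarrow> bool" where
  "polygonal_domain \<Omega> \<longleftrightarrow> open \<Omega> \<and> connected \<Omega> \<and> \<Omega> \<noteq> {} \<and> interior (closure \<Omega>) = \<Omega> \<and>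
     (\<exists>S. finite S \<and> frontier \<Omega> = (\<Union>(a, b)\<in>S. closed_segment a b))"

definition triangulation_of :: "R2 set \<Rightarrow> R2 set set \<Rightarrow> bool" where
  "triangulation_of \<Omega> \<T> \<longleftrightarrow> triangulation \<T> \<and> (\<forall>K\<in>\<T>. 2 simplex K) \<and> \<Union>\<T> = closure \<Omega>"

definition mesh_size :: "R2 set set \<Rightarrow> real" where
  "mesh_size \<T> = Max (diameter ` \<T>)"

definition inball_diameter :: "R2 set \<Rightarrow> real" where
  "inball_diameter K = Sup {2 * r | r c. 0 < r \<and> cball c r \<subseteq> K}"

text \<open>A family indexed by its mesh sizes, which form a set \<open>H\<close> of positive numbers accumulating
  at \<open>0\<close>.\<close>

definition regular_family :: "R2 set \<Rightarrow> real set \<Rightarrow> (real \<Rightarrow> R2 set set) \<Rightarrow> bool" where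
  "regular_family \<Omega> H \<T> \<longleftrightarrow> H \<subseteq> {0<..} \<and> 0 islimpt H \<and>
     (\<forall>h\<in>H. triangulation_of \<Omega> (\<T> h) \<and> mesh_size (\<T> h) = h) \<and>
     (\<exists>\<sigma>>0. \<forall>h\<in>H. \<forall>K\<in>\<T> h. diameter K \<le> \<sigma> * inball_diameter K)"

definition M_h :: "R2 set \<Rightarrow> R2 set set \<Rightarrow> (R2 \<Rightarrow> real) set" where
  "M_h \<Omega> \<T> = {v. continuous_on (closure \<Omega>) v \<and> (\<forall>K\<in>\<T>. \<exists>a c. \<forall>x\<in>K. v x = a \<bullet> x + c)}"

definition V_h :: "R2 set \<Rightarrow> R2 set set \<Rightarrow> (R2 \<Rightarrow> R2) set" where
  "V_h \<Omega> \<T> = {v. \<forall>i. (\<lambda>x. v x $ i) \<in> M_h \<Omega> \<T> \<inter> H1_0 \<Omega>}"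

definition Q_h :: "R2 set \<Rightarrow> R2 set set \<Rightarrow> (R2 \<Rightarrow> real) set" where
  "Q_h \<Omega> \<T> = M_h \<Omega> \<T> \<inter> L2_0 \<Omega>"

definition W_h :: "R2 set \<Rightarrow> R2 set set \<Rightarrow> (R2 \<Rightarrow> M2) set" where
  "W_h \<Omega> \<T> = {D. (\<forall>x\<in>closure \<Omega>. transpose (D x) = D x) \<and> (\<forall>i j. (\<lambda>x. D x $ i $ j) \<in> M_h \<Omega> \<T>)}"

section \<open>The scheme\<close>

definition S_h :: "R2 set \<Rightarrow> R2 set set \<Rightarrow> real \<Rightarrow> (R2 \<Rightarrow> real) \<Rightarrow> (R2 \<Rightarrow> real) \<Rightarrow> real" where
  "S_h \<Omega> \<T> \<delta>\<^sub>0 p q = \<delta>\<^sub>0 * (\<Sum>K\<in>\<T>. (diameter K)\<^sup>2 * ip K (grad \<Omega> p) (grad \<Omega> q))"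

definition A_h :: "R2 set \<Rightarrow> R2 set set \<Rightarrow> real \<Rightarrow> real \<Rightarrow>
    (R2 \<Rightarrow> R2) \<times> (R2 \<Rightarrow> real) \<Rightarrow> (R2 \<Rightarrow> R2) \<times> (R2 \<Rightarrow> real) \<Rightarrow> real" where
  "A_h \<Omega> \<T> \<nu> \<delta>\<^sub>0 = (\<lambda>(u, p) (v, q).
     \<nu> * a_u \<Omega> u v + b_form \<Omega> u q + b_form \<Omega> v p - S_h \<Omega> \<T> \<delta>\<^sub>0 p q)"

definition X1 :: "(real \<Rightarrow> R2 \<Rightarrow> R2) \<Rightarrow> real \<Rightarrow> nat \<Rightarrow> R2 \<Rightarrow> R2" where
  "X1 w \<Delta>t n x = x - \<Delta>t *\<^sub>R w (real n * \<Delta>t) x"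

definition N_T :: "real \<Rightarrow> real \<Rightarrow> nat" where
  "N_T Tf \<Delta>t = nat \<lfloor>Tf / \<Delta>t\<rfloor>"

definition momentum_eq :: "R2 set \<Rightarrow> R2 set set \<Rightarrow> real \<Rightarrow> real \<Rightarrow> real \<Rightarrow> (real \<Rightarrow> R2 \<Rightarrow> R2) \<Rightarrow> (R2 \<Rightarrow> R2) \<Rightarrow> nat \<Rightarrow> 
    (R2 \<Rightarrow> R2) \<Rightarrow> (R2 \<Rightarrow> R2) \<Rightarrow> (R2 \<Rightarrow> real) \<Rightarrow> (R2 \<Rightarrow> M2) \<Rightarrow> bool" where
  "momentum_eq \<Omega> \<T> \<nu> \<delta>\<^sub>0 \<Delta>t w f n u u_old p C \<longleftrightarrow>
     (\<forall>v \<in> V_h \<Omega> \<T>. \<forall>q \<in> Q_h \<Omega> \<T>.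
        ip \<Omega> (\<lambda>x. (1/\<Delta>t) *\<^sub>R (u x - (u_old \<circ> X1 w \<Delta>t n) x)) v + A_h \<Omega> \<T> \<nu> \<delta>\<^sub>0 (u, p) (v, q)
        = - ip \<Omega> (\<lambda>x. trace (C x) *\<^sub>R C x) (jac \<Omega> v) + ip \<Omega> f v)"

definition conformation_eq :: "R2 set \<Rightarrow> R2 set set \<Rightarrow> real \<Rightarrow> real \<Rightarrow> (real \<Rightarrow> R2 \<Rightarrow> R2) \<Rightarrow> (R2 \<Rightarrow> M2) \<Rightarrow> nat \<Rightarrow> (R2 \<Rightarrow> R2) \<Rightarrow> 
    (R2 \<Rightarrow> M2) \<Rightarrow> (R2 \<Rightarrow> M2) \<Rightarrow> bool" where
  "conformation_eq \<Omega> \<T> \<epsilon> \<Delta>t w F n u C C_old \<longleftrightarrow>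
     (\<forall>D \<in> W_h \<Omega> \<T>.
        ip \<Omega> (\<lambda>x. (1/\<Delta>t) *\<^sub>R (C x - (C_old \<circ> X1 w \<Delta>t n) x)) D + \<epsilon> * a_c \<Omega> C D
        = 2 * ip \<Omega> (\<lambda>x. jac \<Omega> u x ** C x) D
          + ip \<Omega> (\<lambda>x. dvg \<Omega> u x *\<^sub>R sharp (C x)) D
          - ip \<Omega> (\<lambda>x. (trace (C x))\<^sup>2 *\<^sub>R C x) D
          + ip \<Omega> (\<lambda>x. trace (C x) *\<^sub>R mat 1) D
          + ip \<Omega> F D)"

definition scheme_solution :: "R2 set \<Rightarrow> R2 set set \<Rightarrow> real \<Rightarrow> real \<Rightarrow> real \<Rightarrow> real \<Rightarrow> real \<Rightarrow> (real \<Rightarrow> R2 \<Rightarrow> R2) \<Rightarrow> 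
    (R2 \<Rightarrow> R2) \<Rightarrow> (R2 \<Rightarrow> M2) \<Rightarrow> (nat \<Rightarrow> R2 \<Rightarrow> R2) \<Rightarrow> (nat \<Rightarrow> R2 \<Rightarrow> M2) \<Rightarrow> (nat \<Rightarrow> R2 \<Rightarrow> R2) \<Rightarrow> (nat \<Rightarrow> R2 \<Rightarrow> real) \<Rightarrow> (nat \<Rightarrow> R2 \<Rightarrow> M2) \<Rightarrow> bool" where
  "scheme_solution \<Omega> \<T> Tf \<nu> \<epsilon> \<delta>\<^sub>0 \<Delta>t w u0 C0 f F u p C \<longleftrightarrow>
     u 0 = u0 \<and> C 0 = C0 \<and>
     (\<forall>n\<in>{1..N_T Tf \<Delta>t}.
        u n \<in> V_h \<Omega> \<T> \<and> p n \<in> Q_h \<Omega> \<T> \<and> C n \<in> W_h \<Omega> \<T> \<and>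
        momentum_eq \<Omega> \<T> \<nu> \<delta>\<^sub>0 \<Delta>t w (f n) n (u n) (u (n - 1)) (p n) (C n) \<and>
        conformation_eq \<Omega> \<T> \<epsilon> \<Delta>t w (F n) n (u n) (C n) (C (n - 1)))"

end

theory Submission
  imports Defs
begin

text \<open>
  One time step is a nonlinear system for \<open>(u, p, C)\<close> in a finite-dimensional space, and it has a
  solution because it is coercive. Test the momentum equation with \<open>(u, -p)\<close> and the conformation
  equation with \<open>C/2\<close>. The velocity-pressure terms cancel, and so do the stress power and the
  stretching terms: a symmetric \<open>2 \<times> 2\<close> matrix satisfies \<open>C\<^sup>2 = (tr C) C - (det C) I\<close> and
  \<open>C\<^sup># \<bullet> C = 2 det C\<close> (\<open>stress_power_cancellation\<close>). The only unsigned term left is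
  \<open>(tr C)\<^sup>2/2 \<le> \<bar>C\<bar>\<^sup>2\<close>, which \<open>\<bar>C\<bar>\<^sup>2/(2 \<Delta>t)\<close> absorbs because \<open>\<Delta>t < 1/2\<close>. What remains,
  \<open>energy_form\<close>, is a quadratic form in \<open>u\<close>, \<open>C\<close> and the piecewise gradient of \<open>p\<close>. It is positive
  definite on the discrete space (\<open>energy_definite\<close>), so it dominates the data on a large sphere, and
  Brouwer's theorem in coordinates gives a solution (\<open>zero_of_coercive_map\<close>, \<open>step_exists\<close>).
  The dimension of the discrete space depends on the mesh and is therefore a number, not a type;
  Brouwer's theorem enters as the Poincare-Miranda theorem, derived from Kuhn's combinatorial lemma.

  Two analytic facts stand behind this algebra.

  First, all integrals have to be integrals of the classical piecewise derivatives. A finite element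
  function is Lipschitz along segments inside the closed domain, so the integral of a difference
  quotient of \<open>v \<phi>\<close>, which vanishes by translation invariance, passes to the limit and yields
  integration by parts (\<open>has_weak_partial_classical\<close>). Weak derivatives are unique almost everywhere
  (\<open>fundamental_lemma_calculus_of_variations\<close>), so the chosen weak derivative agrees almost
  everywhere with the piecewise one.

  Second, the upwind values \<open>u \<circ> X\<^sub>1\<close> and \<open>C \<circ> X\<^sub>1\<close> have to be square integrable, for which \<open>X\<^sub>1\<close> must
  map almost every point of \<open>\<Omega>\<close> into its closure (\<open>X1_in_closure\<close>). A component of the
  velocity has bounded derivatives and, extended by zero, is an \<open>H\<^sup>1\<close> limit of test functions. Its size
  is therefore almost everywhere at most the derivative bound times the \<open>\<ell>\<^sup>1\<close> distance to the exterior
  (\<open>W1inf_0_boundary_bound\<close>); since \<open>\<Delta>t\<close> times the derivative bound is at most \<open>1/4\<close>, no point can be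
  carried to the exterior.
\<close>

section \<open>Test functions\<close>

lemma partial_eqI: "(f has_derivative f') (at x) \<Longrightarrow> partial j f x = f' (axis j 1)"
  unfolding partial_def by (metis frechet_derivative_at)

lemma smooth_coinduct:
  assumes diff: "\<And>f x. f \<in> S \<Longrightarrow> f differentiable (at x)"
    and closed: "\<And>f j. f \<in> S \<Longrightarrow> partial j f \<in> S"
    and "f \<in> S"
  shows "Ck k f"
  using \<open>f \<in> S\<close>
proof (induction k arbitrary: f)
  case 0
  then show ?case
    using diff by (auto intro!: continuous_at_imp_continuous_on differentiable_imp_continuous_within)
next
  case (Suc k)
  then show ?case using diff closed by simp
qed

text \<open>The combinations of smooth functions form a set to which \<open>smooth_coinduct\<close> applies.\<close>

lemma smooth_lincomb:
  assumes "\<And>k. Ck k f" "\<And>k. Ck k g"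
  shows "Ck k (\<lambda>x. a * f x + g x)"
proof (rule smooth_coinduct)
  let ?S = "{\<lambda>x. a * f x + g x | f g. (\<forall>k. Ck k f) \<and> (\<forall>k. Ck k g)}"
  show "(\<lambda>x. a * f x + g x) \<in> ?S" using assms by blast
  fix h assume "h \<in> ?S"
  then obtain f g where h: "h = (\<lambda>x. a * f x + g x)" and f: "\<And>k. Ck k f" and g: "\<And>k. Ck k g"
    by blast
  have df: "f differentiable (at x)" "g differentiable (at x)" for x
    using f[of "Suc 0"] g[of "Suc 0"] by auto
  then show "h differentiable (at x)" for x
    unfolding h by (intro derivative_intros) auto
  have "partial j h = (\<lambda>x. a * partial j f x + partial j g x)" for j
  proof
    fix x
    have "(h has_derivative (\<lambda>v. a * frechet_derivative f (at x) v + frechet_derivative g (at x) v)) (at x)"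
      unfolding h using df[of x]
      by (auto intro!: derivative_eq_intros simp: frechet_derivative_works)
    then show "partial j h x = a * partial j f x + partial j g x"
      by (simp add: partial_eqI) (simp add: partial_def)
  qed
  moreover have "Ck k (partial j f)" "Ck k (partial j g)" for k j
    using f[of "Suc k"] g[of "Suc k"] by auto
  ultimately show "partial j h \<in> ?S" for j by blast
qed

lemma Cc_inftyD:
  assumes "\<phi> \<in> Cc_infty \<Omega>"
  shows "\<phi> differentiable (at x)" "continuous_on UNIV \<phi>" "continuous_on UNIV (partial j \<phi>)"
    "compact (closure {x. \<phi> x \<noteq> 0})" "closure {x. \<phi> x \<noteq> 0} \<subseteq> \<Omega>"
    "x \<notin> closure {x. \<phi> x \<noteq> 0} \<Longrightarrow> \<phi> x = 0"
    "x \<notin> closure {x. \<phi> x \<noteq> 0} \<Longrightarrow> partial j \<phi> x = 0"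
proof -
  have "Ck 0 \<phi>" "Ck (Suc 0) \<phi>" using assms unfolding Cc_infty_def by blast+
  then show "\<phi> differentiable (at x)" "continuous_on UNIV \<phi>" "continuous_on UNIV (partial j \<phi>)"
    by auto
  show "compact (closure {x. \<phi> x \<noteq> 0})" "closure {x. \<phi> x \<noteq> 0} \<subseteq> \<Omega>"
    using assms unfolding Cc_infty_def by auto
  show "\<phi> x = 0" if "x \<notin> closure {x. \<phi> x \<noteq> 0}"
    using that closure_subset[of "{x. \<phi> x \<noteq> 0}"] by auto
  have ev: "\<forall>\<^sub>F y in nhds x. \<phi> y = 0" if "x \<notin> closure {x. \<phi> x \<noteq> 0}"
  proof -
    have "open (- closure {x. \<phi> x \<noteq> 0})" by auto
    then have "\<forall>\<^sub>F y in nhds x. y \<in> - closure {x. \<phi> x \<noteq> 0}"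
      using that eventually_nhds by blast
    then show ?thesis
      by (rule eventually_mono) (use closure_subset[of "{x. \<phi> x \<noteq> 0}"] in auto)
  qed
  show "partial j \<phi> x = 0" if "x \<notin> closure {x. \<phi> x \<noteq> 0}"
  proof -
    have "(\<phi> has_derivative (\<lambda>v. 0)) (at x)"
      using ev[OF that]
      by (intro has_derivative_transform_eventually[OF has_derivative_const[of 0]])
        (auto simp: eventually_nhds_conv_at elim: eventually_mono)
    then show ?thesis by (simp add: partial_eqI)
  qed
qed

lemma Cc_infty_lincomb:
  assumes f: "f \<in> Cc_infty \<Omega>" and g: "g \<in> Cc_infty \<Omega>"
  shows "(\<lambda>x. a * f x + g x) \<in> Cc_infty \<Omega>"
proof -
  let ?S = "{x. a * f x + g x \<noteq> 0}" and ?F = "closure {x. f x \<noteq> 0}" and ?G = "closure {x. g x \<noteq> 0}"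
  have FG: "?F \<union> ?G \<subseteq> \<Omega>" "compact (?F \<union> ?G)"
    using Cc_inftyD(4,5)[OF f] Cc_inftyD(4,5)[OF g] by auto
  have "?S \<subseteq> {x. f x \<noteq> 0} \<union> {x. g x \<noteq> 0}" by auto
  from closure_mono[OF this] have "closure ?S \<subseteq> ?F \<union> ?G"
    by (simp only: closure_Un)
  then have "closure ?S \<subseteq> \<Omega>" "compact (closure ?S)"
    using FG bounded_subset[of "?F \<union> ?G" "closure ?S"] by (auto simp: compact_eq_bounded_closed)
  then show ?thesis
    using f g smooth_lincomb[of f g _ a] unfolding Cc_infty_def by blast
qed

text \<open>The prefactor \<open>p(1/t)\<close> makes the family closed under differentiation: the derivative of
  \<open>p(1/t) exp(-1/t)\<close> is \<open>q(1/t) exp(-1/t)\<close> with \<open>q = X\<^sup>2 (p - p')\<close>.\<close>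

definition exp_bump :: "real poly \<Rightarrow> real \<Rightarrow> real" where
  "exp_bump p t = (if t > 0 then poly p (1/t) * exp (- (1/t)) else 0)"

lemma poly_times_exp_neg_tendsto_0:
  "((\<lambda>s::real. poly p s * exp (- s)) \<longlongrightarrow> 0) at_top"
proof -
  have "((\<lambda>s. \<Sum>i\<le>degree p. coeff p i * (s ^ i / exp s)) \<longlongrightarrow> (\<Sum>i\<le>degree p. coeff p i * 0)) at_top"
    by (intro tendsto_sum tendsto_mult tendsto_const tendsto_power_div_exp_0)
  then show ?thesis
    by (simp add: poly_altdef sum_distrib_right exp_minus divide_inverse mult.assoc)
qed

lemma exp_bump_tendsto_0: "(exp_bump p \<longlongrightarrow> 0) (at 0)"
proof -
  have "((\<lambda>t. poly p (inverse t) * exp (- inverse t)) \<longlongrightarrow> 0) (at_right 0)"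
    using filterlim_compose[OF poly_times_exp_neg_tendsto_0 filterlim_inverse_at_top_right] .
  moreover have "\<forall>\<^sub>F t in at_right 0. poly p (inverse t) * exp (- inverse t) = exp_bump p t"
    by (auto simp: eventually_at_filter exp_bump_def inverse_eq_divide)
  ultimately have "(exp_bump p \<longlongrightarrow> 0) (at_right 0)"
    by (rule Lim_transform_eventually)
  moreover have "(exp_bump p \<longlongrightarrow> 0) (at_left 0)"
    by (rule Lim_transform_eventually[OF tendsto_const])
      (auto simp: eventually_at_filter exp_bump_def)
  ultimately show ?thesis
    by (simp add: filterlim_at_split)
qed

lemma exp_bump_deriv:
  "(exp_bump p has_field_derivative exp_bump ([:0,0,1:] * (p - pderiv p)) t) (at t)"
proof -
  consider "t > 0" | "t < 0" | "t = 0" by linarith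
  then show ?thesis
  proof cases
    case 1
    have "((\<lambda>t. poly p (1/t) * exp (- (1/t))) has_field_derivative
        exp_bump ([:0,0,1:] * (p - pderiv p)) t) (at t)"
      using 1
      by (auto intro!: derivative_eq_intros DERIV_chain2[OF poly_DERIV]
          simp: exp_bump_def field_simps power2_eq_square)
    then show ?thesis
      using 1 by (rule_tac has_field_derivative_transform_within_open[where S="{0<..}"])
        (auto simp: exp_bump_def)
  next
    case 2
    have "((\<lambda>t. 0) has_field_derivative exp_bump ([:0,0,1:] * (p - pderiv p)) t) (at t)"
      using 2 by (auto intro!: derivative_eq_intros simp: exp_bump_def)
    then show ?thesis
      using 2 by (rule_tac has_field_derivative_transform_within_open[where S="{..<0}"])
        (auto simp: exp_bump_def)
  next
    case 3
    \<comment> \<open>At the origin the difference quotient is the member of the family with \<open>p\<close> replaced by \<open>X p\<close>.\<close>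
    have "((\<lambda>h. exp_bump (pCons 0 p) h) \<longlongrightarrow> 0) (at 0)"
      by (rule exp_bump_tendsto_0)
    moreover have "\<forall>\<^sub>F h in at 0. exp_bump (pCons 0 p) h = (exp_bump p (0 + h) - exp_bump p 0) / h"
      by (auto simp: eventually_at_filter exp_bump_def)
    ultimately have "((\<lambda>h. (exp_bump p (0 + h) - exp_bump p 0) / h) \<longlongrightarrow> 0) (at 0)"
      by (rule Lim_transform_eventually)
    then show ?thesis
      using 3 by (simp add: DERIV_def exp_bump_def)
  qed
qed

text \<open>The algebra generated by the functions \<^term>\<open>exp_bump p\<close> of affine functions of one
  coordinate is closed under partial derivatives, so its members are smooth.\<close>

inductive_set bump_algebra :: "(R2 \<Rightarrow> real) set" where
  base: "(\<lambda>x. exp_bump p (a * x $ j + b)) \<in> bump_algebra"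
| add: "f \<in> bump_algebra \<Longrightarrow> g \<in> bump_algebra \<Longrightarrow> (\<lambda>x. f x + g x) \<in> bump_algebra"
| mult: "f \<in> bump_algebra \<Longrightarrow> g \<in> bump_algebra \<Longrightarrow> (\<lambda>x. f x * g x) \<in> bump_algebra"
| scale: "f \<in> bump_algebra \<Longrightarrow> (\<lambda>x. c * f x) \<in> bump_algebra"

lemma bump_algebra_partial:
  assumes "f \<in> bump_algebra"
  shows "(\<forall>x. f differentiable (at x)) \<and> (\<forall>j. partial j f \<in> bump_algebra)"
  using assms
proof (induction rule: bump_algebra.induct)
  case (base p a j b)
  let ?q = "[:0,0,1:] * (p - pderiv p)"
  let ?f = "\<lambda>x::R2. exp_bump p (a * x $ j + b)"
  have D: "(?f has_derivative (\<lambda>v. exp_bump ?q (a * x $ j + b) * (a * v $ j))) (at x)" for x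
  proof -
    have "((\<lambda>x::R2. a * x $ j + b) has_derivative (\<lambda>v. a * v $ j)) (at x)"
      by (auto intro!: derivative_eq_intros bounded_linear.has_derivative[OF bounded_linear_vec_nth])
    from DERIV_compose_FDERIV[OF exp_bump_deriv this] show ?thesis
      by (simp only: mult.commute)
  qed
  have "partial i ?f = (\<lambda>x. (a * axis i 1 $ j) * exp_bump ?q (a * x $ j + b))" for i
    by (rule ext) (simp add: partial_eqI[OF D])
  then show ?case
    using D by (auto simp: differentiable_def intro: bump_algebra.intros)
next
  case (add f g)
  have D: "((\<lambda>x. f x + g x) has_derivative
      (\<lambda>v. frechet_derivative f (at x) v + frechet_derivative g (at x) v)) (at x)" for x
    using add by (auto intro!: derivative_eq_intros simp: frechet_derivative_works)
  have "partial i (\<lambda>x. f x + g x) = (\<lambda>x. partial i f x + partial i g x)" for i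
    by (rule ext) (simp add: partial_eqI[OF D], simp add: partial_def)
  then show ?case
    using D add by (auto simp: differentiable_def intro: bump_algebra.intros)
next
  case (mult f g)
  have D: "((\<lambda>x. f x * g x) has_derivative
      (\<lambda>v. f x * frechet_derivative g (at x) v + frechet_derivative f (at x) v * g x)) (at x)" for x
    using mult by (auto intro!: derivative_eq_intros simp: frechet_derivative_works)
  have "partial i (\<lambda>x. f x * g x) = (\<lambda>x. f x * partial i g x + partial i f x * g x)" for i
    by (rule ext) (simp add: partial_eqI[OF D], simp add: partial_def)
  then show ?case
    using D mult by (auto simp: differentiable_def intro!: bump_algebra.add intro: bump_algebra.mult[of f] bump_algebra.mult[of _ g])
next
  case (scale f c)
  have D: "((\<lambda>x. c * f x) has_derivative (\<lambda>v. c * frechet_derivative f (at x) v)) (at x)" for x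
    using scale by (auto intro!: derivative_eq_intros simp: frechet_derivative_works)
  have "partial i (\<lambda>x. c * f x) = (\<lambda>x. c * partial i f x)" for i
    by (rule ext) (simp add: partial_eqI[OF D], simp add: partial_def)
  then show ?case
    using D scale by (auto simp: differentiable_def intro: bump_algebra.intros)
qed

lemma bump_algebra_smooth: "f \<in> bump_algebra \<Longrightarrow> Ck k f"
  by (rule smooth_coinduct[of bump_algebra]) (auto simp: bump_algebra_partial)

text \<open>As \<open>n\<close> grows, \<open>exp(-1/(n s))\<close> tends to \<open>1\<close> for \<open>s > 0\<close>; a product of four such factors, one for each
  side of the box, tends to the indicator of the open box.\<close>

lemma box_indicator_limit_of_test_functions:
  fixes a b :: R2
  assumes "cbox a b \<subseteq> \<Omega>"
  obtains \<phi> :: "nat \<Rightarrow> R2 \<Rightarrow> real" where "\<And>n. \<phi> n \<in> Cc_infty \<Omega>" "\<And>n x. \<bar>\<phi> n x\<bar> \<le> 1"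
    "\<And>n x. x \<notin> box a b \<Longrightarrow> \<phi> n x = 0" "\<And>x. (\<lambda>n. \<phi> n x) \<longlonglongrightarrow> indicator (box a b) x"
proof -
  define \<beta> where "\<beta> n s = exp_bump 1 (real (Suc n) * s)" for n s
  have beta01: "0 \<le> \<beta> n s" "\<beta> n s \<le> 1" for n s
    by (auto simp: \<beta>_def exp_bump_def)
  have beta0: "\<beta> n s = 0" if "s \<le> 0" for n s
  proof -
    have "real (Suc n) * s \<le> 0"
      using that by (intro mult_nonneg_nonpos) auto
    then show ?thesis by (simp add: \<beta>_def exp_bump_def)
  qed
  have beta_lim: "(\<lambda>n. \<beta> n s) \<longlonglongrightarrow> 1" if "s > 0" for s
  proof -
    have "(\<lambda>n. exp (- ((1/s) * inverse (real (Suc n))))) \<longlonglongrightarrow> exp (- ((1/s) * 0))"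
      by (intro tendsto_intros LIMSEQ_inverse_real_of_nat)
    moreover have "\<beta> n s = exp (- ((1/s) * inverse (real (Suc n))))" for n
    proof -
      have "real (Suc n) * s > 0" using that by (intro mult_pos_pos) auto
      then show ?thesis using that by (simp add: \<beta>_def exp_bump_def divide_inverse mult.commute)
    qed
    ultimately show ?thesis by simp
  qed
  define \<phi> where "\<phi> n x = (\<beta> n (x $ 1 - a $ 1) * \<beta> n (b $ 1 - x $ 1)) *
      (\<beta> n (x $ 2 - a $ 2) * \<beta> n (b $ 2 - x $ 2))" for n and x :: R2
  have inbox: "x \<in> box a b \<longleftrightarrow> x$1 - a$1 > 0 \<and> b$1 - x$1 > 0 \<and> x$2 - a$2 > 0 \<and> b$2 - x$2 > 0" for x
    by (auto simp: mem_box_cart forall_2)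
  have out: "\<phi> n x = 0" if "x \<notin> box a b" for n x
    using that beta0 unfolding inbox \<phi>_def by (metis mult_zero_left mult_zero_right not_less)
  have "(\<lambda>x. \<beta> n (x $ j - c)) \<in> bump_algebra" "(\<lambda>x. \<beta> n (c - x $ j)) \<in> bump_algebra" for n j c
    using bump_algebra.base[of 1 "real (Suc n)" j "- (real (Suc n) * c)"]
      bump_algebra.base[of 1 "- real (Suc n)" j "(real (Suc n) * c)"]
    by (simp_all add: \<beta>_def algebra_simps del: of_nat_Suc)
  then have alg: "\<phi> n \<in> bump_algebra" for n
    unfolding \<phi>_def by (intro bump_algebra.mult)
  have "closure {x. \<phi> n x \<noteq> 0} \<subseteq> cbox a b" for n
    using out box_subset_cbox by (intro closure_minimal) (auto, blast)
  moreover from this have "compact (closure {x. \<phi> n x \<noteq> 0})" for n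
    by (meson bounded_cbox bounded_subset closed_closure compact_eq_bounded_closed)
  ultimately have "\<phi> n \<in> Cc_infty \<Omega>" for n
    using assms bump_algebra_smooth[OF alg] unfolding Cc_infty_def by blast
  moreover have "\<bar>\<phi> n x\<bar> \<le> 1" for n x
    unfolding \<phi>_def using beta01 by (auto simp: abs_mult intro!: mult_le_one)
  moreover have "(\<lambda>n. \<phi> n x) \<longlonglongrightarrow> indicator (box a b) x" for x
  proof (cases "x \<in> box a b")
    case True
    have "(\<lambda>n. \<phi> n x) \<longlonglongrightarrow> (1 * 1) * (1 * 1)"
      unfolding \<phi>_def using True[unfolded inbox] by (intro tendsto_mult beta_lim) auto
    then show ?thesis using True by simp
  qed (simp add: out)
  ultimately show thesis using out that by blast
qed

section \<open>Uniqueness of weak derivatives\<close>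

lemma AE_lebesgue_on_iff:
  "S \<in> sets lebesgue \<Longrightarrow> (AE x in lebesgue_on S. P x) \<longleftrightarrow> (AE x in lebesgue. x \<in> S \<longrightarrow> P x)"
  by (simp add: AE_restrict_space_iff)

lemma continuous_measurable_lebesgue:
  fixes \<phi> :: "R2 \<Rightarrow> 'b::topological_space"
  assumes "continuous_on UNIV \<phi>" shows "\<phi> \<in> borel_measurable lebesgue"
  using borel_measurable_continuous_onI[OF assms] by (simp add: measurable_completion)

lemma L1_locD:
  assumes "g \<in> L1_loc \<Omega>" "compact K" "K \<subseteq> \<Omega>"
  shows "integrable lebesgue (\<lambda>x. indicator K x *\<^sub>R g x)"
  using assms unfolding L1_loc_def set_integrable_def by simp

lemma integrable_L1_loc_times:
  assumes \<Omega>: "open \<Omega>" and g: "g \<in> L1_loc \<Omega>" and K: "compact K" "K \<subseteq> \<Omega>"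
    and \<phi>: "continuous_on UNIV \<phi>" "\<And>x. x \<notin> K \<Longrightarrow> \<phi> x = 0"
  shows "integrable (lebesgue_on \<Omega>) (\<lambda>x. g x * \<phi> x)"
proof -
  have gK: "integrable lebesgue (\<lambda>x. indicator K x *\<^sub>R g x)"
    by (rule L1_locD[OF g K])
  have "bounded (\<phi> ` K)"
    by (meson \<phi>(1) K(1) compact_continuous_image compact_imp_bounded continuous_on_subset subset_UNIV)
  then obtain B where B: "\<And>x. x \<in> K \<Longrightarrow> \<bar>\<phi> x\<bar> \<le> B" by (auto simp: bounded_iff)
  have "integrable lebesgue (\<lambda>x. (indicator K x *\<^sub>R g x) * \<phi> x)"
  proof (rule Bochner_Integration.integrable_bound)
    show "integrable lebesgue (\<lambda>x. B * (indicator K x *\<^sub>R g x))"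
      using gK by simp
    show "(\<lambda>x. (indicator K x *\<^sub>R g x) * \<phi> x) \<in> borel_measurable lebesgue"
      using borel_measurable_integrable[OF gK] continuous_measurable_lebesgue[OF \<phi>(1)]
      by (rule borel_measurable_times)
    show "AE x in lebesgue. norm ((indicator K x *\<^sub>R g x) * \<phi> x) \<le> norm (B * (indicator K x *\<^sub>R g x))"
    proof (rule AE_I2)
      fix x
      show "norm ((indicator K x *\<^sub>R g x) * \<phi> x) \<le> norm (B * (indicator K x *\<^sub>R g x))"
        using mult_right_mono[OF B[of x], of "\<bar>g x\<bar>"] B[of x]
        by (cases "x \<in> K") (auto simp: abs_mult mult.commute)
    qed
  qed
  also have "(\<lambda>x. (indicator K x *\<^sub>R g x) * \<phi> x) = (\<lambda>x. indicator \<Omega> x *\<^sub>R (g x * \<phi> x))"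
    using K \<phi>(2) by (auto simp: indicator_def fun_eq_iff)
  finally show ?thesis
    using \<Omega> by (subst integrable_restrict_space) auto
qed

lemma integrable_L1_loc_test:
  assumes \<Omega>: "open \<Omega>" and h: "h \<in> L1_loc \<Omega>" and \<phi>: "\<phi> \<in> Cc_infty \<Omega>"
  shows "integrable (lebesgue_on \<Omega>) (\<lambda>x. h x * \<phi> x)"
    and "integrable (lebesgue_on \<Omega>) (\<lambda>x. h x * partial j \<phi> x)"
proof -
  note K = Cc_inftyD(4,5)[OF \<phi>]
  show "integrable (lebesgue_on \<Omega>) (\<lambda>x. h x * \<phi> x)"
    by (rule integrable_L1_loc_times[OF \<Omega> h K Cc_inftyD(2)[OF \<phi>]]) (rule Cc_inftyD(6)[OF \<phi>])
  show "integrable (lebesgue_on \<Omega>) (\<lambda>x. h x * partial j \<phi> x)"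
    by (rule integrable_L1_loc_times[OF \<Omega> h K Cc_inftyD(3)[OF \<phi>]]) (rule Cc_inftyD(7)[OF \<phi>])
qed

text \<open>The indicator of a box inside \<open>\<Omega>\<close> is a bounded pointwise limit of test functions, so \<open>g\<close>
  integrates to zero over all such boxes, hence over all Borel subsets of a box by Dynkin's lemma.\<close>

lemma fundamental_lemma_calculus_of_variations:
  assumes \<Omega>: "open \<Omega>" and g: "g \<in> L1_loc \<Omega>"
    and orth: "\<And>\<phi>. \<phi> \<in> Cc_infty \<Omega> \<Longrightarrow> (LINT x|lebesgue_on \<Omega>. g x * \<phi> x) = 0"
  shows "AE x in lebesgue_on \<Omega>. g x = 0"
proof -
  have box_zero: "(LINT x|lebesgue. indicator (box e f) x * g x) = 0" if ef: "cbox e f \<subseteq> \<Omega>" for e f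
  proof -
    obtain \<phi> :: "nat \<Rightarrow> R2 \<Rightarrow> real" where \<phi>: "\<And>n. \<phi> n \<in> Cc_infty \<Omega>" "\<And>n x. \<bar>\<phi> n x\<bar> \<le> 1"
      "\<And>n x. x \<notin> box e f \<Longrightarrow> \<phi> n x = 0" "\<And>x. (\<lambda>n. \<phi> n x) \<longlonglongrightarrow> indicator (box e f) x"
      using box_indicator_limit_of_test_functions[OF ef] by metis
    have G: "integrable lebesgue (\<lambda>x. indicator (cbox e f) x *\<^sub>R g x)"
      by (rule L1_locD[OF g compact_cbox ef])
    have meas: "(\<lambda>x. \<phi> n x * (indicator (cbox e f) x *\<^sub>R g x)) \<in> borel_measurable lebesgue"
      "(\<lambda>x. indicator (box e f) x * (indicator (cbox e f) x *\<^sub>R g x)) \<in> borel_measurable lebesgue" for n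
      by (rule borel_measurable_times[OF continuous_measurable_lebesgue[OF Cc_inftyD(2)[OF \<phi>(1)]]
            borel_measurable_integrable[OF G]],
          rule borel_measurable_times[OF borel_measurable_indicator borel_measurable_integrable[OF G]], simp)
    have eq: "(LINT x|lebesgue. \<phi> n x * (indicator (cbox e f) x *\<^sub>R g x)) = 0" for n
    proof -
      have "(LINT x|lebesgue. \<phi> n x * (indicator (cbox e f) x *\<^sub>R g x))
          = (LINT x|lebesgue. indicator \<Omega> x *\<^sub>R (g x * \<phi> n x))"
        using ef \<phi>(3)[of _ n] box_subset_cbox[of e f]
        by (intro Bochner_Integration.integral_cong refl) (auto simp: indicator_def split: if_splits)
      also have "\<dots> = (LINT x|lebesgue_on \<Omega>. g x * \<phi> n x)"
        using \<Omega> by (subst integral_restrict_space) auto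
      also have "\<dots> = 0" by (rule orth[OF \<phi>(1)])
      finally show ?thesis .
    qed
    have "(\<lambda>n. LINT x|lebesgue. \<phi> n x * (indicator (cbox e f) x *\<^sub>R g x)) \<longlonglongrightarrow>
        (LINT x|lebesgue. indicator (box e f) x * (indicator (cbox e f) x *\<^sub>R g x))"
    proof (rule integral_dominated_convergence)
      show "integrable lebesgue (\<lambda>x. \<bar>indicator (cbox e f) x *\<^sub>R g x\<bar>)"
        using G by (rule integrable_abs)
      show "AE x in lebesgue. (\<lambda>n. \<phi> n x * (indicator (cbox e f) x *\<^sub>R g x)) \<longlonglongrightarrow>
          indicator (box e f) x * (indicator (cbox e f) x *\<^sub>R g x)"
        by (intro AE_I2 tendsto_intros \<phi>(4))
      show "AE x in lebesgue. norm (\<phi> n x * (indicator (cbox e f) x *\<^sub>R g x))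
          \<le> \<bar>indicator (cbox e f) x *\<^sub>R g x\<bar>" for n
        using \<phi>(2) by (intro AE_I2) (auto simp: abs_mult indicator_def mult_left_le_one_le)
    qed (rule meas)+
    then have "(LINT x|lebesgue. indicator (box e f) x * (indicator (cbox e f) x *\<^sub>R g x)) = 0"
      unfolding eq LIMSEQ_const_iff by simp
    moreover have "(\<lambda>x. indicator (box e f) x * (indicator (cbox e f) x *\<^sub>R g x)) =
        (\<lambda>x. indicator (box e f) x * g x)"
      using box_subset_cbox[of e f] by (auto simp: indicator_def fun_eq_iff)
    ultimately show ?thesis by simp
  qed
  have local: "AE x in lebesgue. x \<in> cbox a b \<longrightarrow> g x = 0" if ab: "cbox a b \<subseteq> \<Omega>" for a b
  proof -
    define G where "G x = indicator (cbox a b) x *\<^sub>R g x" for x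
    have Gint: "integrable lebesgue G"
      unfolding G_def by (rule L1_locD[OF g compact_cbox ab])
    \<comment> \<open>Dynkin's lemma needs Borel sets, so \<open>G\<close> is replaced by a Borel representative.\<close>
    obtain G' where G': "G' \<in> borel_measurable lborel" "AE x in lborel. G x = G' x"
      using completion_ex_borel_measurable_real[of G lborel] borel_measurable_integrable[OF Gint] by auto
    have ae: "AE x in lebesgue. G x = G' x" using AE_completion[OF G'(2)] .
    have "integrable lebesgue G'"
      using Gint ae G'(1) by (subst integrable_cong_AE[of _ _ G]) (auto intro: measurable_completion borel_measurable_integrable)
    then have G'int: "integrable lborel G'"
      using integrable_completion[OF G'(1)] by simp
    have aebox: "AE x in lebesgue. x \<in> cbox a b \<longrightarrow> x \<in> box a b"
    proof -
      have "cbox a b - box a b \<in> null_sets lebesgue"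
        using negligible_frontier_interval[of a b] by (simp add: negligible_iff_null_sets)
      from AE_not_in[OF this] show ?thesis by eventually_elim auto
    qed
    have boxes: "(LINT x:box c d|lborel. G' x) = 0" for c d
    proof -
      obtain e f where ef: "box e f = box a b \<inter> box c d" "cbox e f = cbox a b \<inter> cbox c d"
        using Int_interval[of a b c d] box_Int_box[of a b c d] by (rule that[OF sym sym, rotated])
      have inbox: "x \<in> box e f \<longleftrightarrow> x \<in> box a b \<and> x \<in> box c d"
        and incbox: "x \<in> box a b \<Longrightarrow> x \<in> cbox a b" for x
        using ef(1) box_subset_cbox[of a b] by (simp_all add: subset_iff)
      have "(LINT x:box c d|lborel. G' x) = (LINT x:box c d|lebesgue. G' x)"
        unfolding set_lebesgue_integral_def using G'(1) by (subst integral_completion) auto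
      also have "\<dots> = (LINT x|lebesgue. indicator (box e f) x * g x)"
        unfolding set_lebesgue_integral_def
      proof (rule integral_cong_AE)
        show "(\<lambda>x. indicator (box c d) x *\<^sub>R G' x) \<in> borel_measurable lebesgue"
          using G'(1) by (intro measurable_completion) auto
        have "(\<lambda>x. indicator (box e f) x * G x) \<in> borel_measurable lebesgue"
          by (rule borel_measurable_times[OF borel_measurable_indicator borel_measurable_integrable[OF Gint]]) simp
        moreover have "indicator (box e f) x * G x = indicator (box e f) x * g x" for x
          using inbox[of x] incbox[of x] by (simp add: G_def indicator_def)
        ultimately show "(\<lambda>x. indicator (box e f) x * g x) \<in> borel_measurable lebesgue" by simp
        show "AE x in lebesgue. indicator (box c d) x *\<^sub>R G' x = indicator (box e f) x * g x"
          using ae aebox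
        proof eventually_elim
          case (elim x)
          then show ?case
            using inbox[of x] incbox[of x] by (auto simp: G_def indicator_def split: if_splits)
        qed
      qed
      also have "\<dots> = 0" by (rule box_zero) (use ab in \<open>simp only: ef(2), blast\<close>)
      finally show ?thesis .
    qed
    have whole: "(LINT x|lborel. G' x) = 0"
    proof -
      have "(LINT x|lborel. G' x) = (LINT x|lebesgue. G' x)"
        using G'(1) by (subst integral_completion) auto
      also have "\<dots> = (LINT x:box a b|lebesgue. G' x)"
        unfolding set_lebesgue_integral_def
      proof (rule integral_cong_AE)
        show "AE x in lebesgue. G' x = indicator (box a b) x *\<^sub>R G' x"
          using ae aebox by eventually_elim (auto simp: G_def indicator_def split: if_splits)
      qed (use G'(1) in \<open>auto intro!: measurable_completion\<close>)
      also have "\<dots> = (LINT x:box a b|lborel. G' x)"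
        unfolding set_lebesgue_integral_def using G'(1) by (subst integral_completion) auto
      finally show ?thesis using boxes by simp
    qed
    have si: "set_integrable lborel A G'" if "A \<in> sets borel" for A
      using G'int that unfolding set_integrable_def by (intro integrable_mult_indicator) auto
    have borel: "(LINT x:A|lborel. G' x) = 0" if "A \<in> sets borel" for A
    proof -
      let ?B = "range (\<lambda>(c,d). box c d :: R2 set)"
      have sb: "sets (borel :: R2 measure) = sigma_sets UNIV ?B"
        by (simp add: borel_eq_box)
      have "Int_stable ?B"
      proof (rule Int_stableI)
        fix X Y assume "X \<in> ?B" "Y \<in> ?B"
        then obtain a b c d where "X = box a b" "Y = box c d" by auto
        then show "X \<inter> Y \<in> ?B" using box_Int_box[of a b c d] by auto
      qed
      moreover have "?B \<subseteq> Pow UNIV" by simp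
      moreover have "A \<in> sigma_sets UNIV ?B" using that by (simp only: sb)
      ultimately show ?thesis
      proof (induction rule: sigma_sets_induct_disjoint)
        case (basic A) then show ?case using boxes by auto
      next
        case empty show ?case by (simp add: set_lebesgue_integral_def)
      next
        case (compl A)
        then have A: "A \<in> sets borel" by (simp only: sb)
        have "(LINT x:UNIV|lborel. G' x) = (LINT x:(A \<union> (UNIV - A))|lborel. G' x)"
          by (simp only: Un_Diff_cancel Un_UNIV_right)
        also have "\<dots> = (LINT x:A|lborel. G' x) + (LINT x:(UNIV - A)|lborel. G' x)"
          using A by (intro set_integral_Un si) auto
        finally show ?case using compl whole by (simp add: set_lebesgue_integral_def)
      next
        case (union A)
        then have A: "A i \<in> sets borel" for i unfolding sb by (simp only: image_subset_iff UNIV_I)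
        have "(LINT x:(\<Union>i. A i)|lborel. G' x) = (\<Sum>i. LINT x:A i|lborel. G' x)"
          using union A by (intro lebesgue_integral_countable_add si) (auto simp: disjoint_family_on_def)
        then show ?case using union by simp
      qed
    qed
    have "AE x in lborel. G' x = 0"
      using density_unique_real[OF G'int, of "\<lambda>_. 0"] borel by (simp add: set_lebesgue_integral_def)
    then have "AE x in lebesgue. G' x = 0" by (rule AE_completion)
    with ae show ?thesis
      by eventually_elim (auto simp: G_def indicator_def)
  qed
  obtain D where D: "countable D" "\<And>X. X \<in> D \<Longrightarrow> X \<subseteq> \<Omega>" "\<And>X. X \<in> D \<Longrightarrow> \<exists>a b. X = cbox a b" "\<Union>D = \<Omega>"
    using open_countable_Union_open_cbox[OF \<Omega>] by (metis Pow_iff subset_iff)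
  have "AE x in lebesgue. \<forall>X\<in>D. x \<in> X \<longrightarrow> g x = 0"
    using D local by (subst AE_ball_countable) (auto, blast)
  then have "AE x in lebesgue. x \<in> \<Omega> \<longrightarrow> g x = 0"
    by eventually_elim (use D(4) in blast)
  then show ?thesis using \<Omega> by (simp add: AE_lebesgue_on_iff)
qed

lemma L1_loc_lincomb:
  assumes "f \<in> L1_loc \<Omega>" "g \<in> L1_loc \<Omega>"
  shows "(\<lambda>x. a * f x + g x) \<in> L1_loc \<Omega>"
  using assms unfolding L1_loc_def by auto

lemma has_weak_partial_lincomb:
  assumes \<Omega>: "open \<Omega>" and f: "has_weak_partial \<Omega> j f f'" and g: "has_weak_partial \<Omega> j g g'"
  shows "has_weak_partial \<Omega> j (\<lambda>x. a * f x + g x) (\<lambda>x. a * f' x + g' x)"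
  unfolding has_weak_partial_def
proof (intro conjI ballI)
  note F = f[unfolded has_weak_partial_def] and G = g[unfolded has_weak_partial_def]
  show "(\<lambda>x. a * f x + g x) \<in> L1_loc \<Omega>" "(\<lambda>x. a * f' x + g' x) \<in> L1_loc \<Omega>"
    using F G by (auto intro: L1_loc_lincomb)
  fix \<phi> assume \<phi>: "\<phi> \<in> Cc_infty \<Omega>"
  note I = integrable_L1_loc_test[OF \<Omega> _ \<phi>]
  have "(LINT x|lebesgue_on \<Omega>. (a * f x + g x) * partial j \<phi> x)
      = a * (LINT x|lebesgue_on \<Omega>. f x * partial j \<phi> x) + (LINT x|lebesgue_on \<Omega>. g x * partial j \<phi> x)"
    using I F G by (simp add: distrib_right mult.assoc)
  also have "\<dots> = - (a * (LINT x|lebesgue_on \<Omega>. f' x * \<phi> x) + (LINT x|lebesgue_on \<Omega>. g' x * \<phi> x))"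
    using F G \<phi> by simp
  also have "\<dots> = - (LINT x|lebesgue_on \<Omega>. (a * f' x + g' x) * \<phi> x)"
    using I F G by (simp add: distrib_right mult.assoc)
  finally show "(LINT x|lebesgue_on \<Omega>. (a * f x + g x) * partial j \<phi> x) =
    - (LINT x|lebesgue_on \<Omega>. (a * f' x + g' x) * \<phi> x)" .
qed

lemma weak_partial_AE_eq:
  assumes \<Omega>: "open \<Omega>" and g: "has_weak_partial \<Omega> j f g"
  shows "AE x in lebesgue_on \<Omega>. weak_partial \<Omega> j f x = g x"
proof -
  have "has_weak_partial \<Omega> j f (weak_partial \<Omega> j f)"
    unfolding weak_partial_def by (rule someI[of "has_weak_partial \<Omega> j f", OF g])
  from has_weak_partial_lincomb[OF \<Omega> g this, of "-1"]
  have *: "has_weak_partial \<Omega> j (\<lambda>x. 0) (\<lambda>x. weak_partial \<Omega> j f x - g x)" by simp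
  have "AE x in lebesgue_on \<Omega>. weak_partial \<Omega> j f x - g x = 0"
    using * unfolding has_weak_partial_def by (intro fundamental_lemma_calculus_of_variations[OF \<Omega>]) auto
  then show ?thesis by eventually_elim simp
qed

section \<open>Integration by parts\<close>

lemma has_derivative_along_axis:
  fixes f :: "R2 \<Rightarrow> real"
  assumes "(f has_derivative D) (at (x + s *\<^sub>R e))"
  shows "((\<lambda>s. f (x + s *\<^sub>R e)) has_field_derivative D e) (at s)"
proof -
  have "((\<lambda>s. x + s *\<^sub>R e) has_derivative (\<lambda>s. s *\<^sub>R e)) (at s)"
    by (auto intro!: derivative_eq_intros)
  from has_derivative_compose[OF this assms]
  have "((\<lambda>s. f (x + s *\<^sub>R e)) has_derivative (\<lambda>s. D (s *\<^sub>R e))) (at s)" .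
  moreover have "D (s *\<^sub>R e) = D e * s" for s
    using assms by (simp add: has_derivative_bounded_linear linear_simps)
  ultimately show ?thesis
    by (simp add: has_field_derivative_def)
qed

lemma difference_quotient_tendsto:
  fixes f :: "R2 \<Rightarrow> real"
  assumes "(f has_derivative D) (at x)" and "t \<longlonglongrightarrow> 0" and "\<And>n. t n \<noteq> 0"
  shows "(\<lambda>n. (f (x + t n *\<^sub>R e) - f x) / t n) \<longlonglongrightarrow> D e"
proof -
  have "((\<lambda>s. f (x + s *\<^sub>R e)) has_field_derivative D e) (at 0)"
    by (rule has_derivative_along_axis) (use assms(1) in simp)
  then have "((\<lambda>h. (f (x + h *\<^sub>R e) - f x) / h) \<longlongrightarrow> D e) (at 0)"
    by (simp add: DERIV_def)
  moreover have "filterlim t (at 0) sequentially"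
    using assms(2,3) by (intro filterlim_atI) auto
  ultimately show ?thesis by (rule filterlim_compose)
qed

lemma lebesgue_integral_translate:
  fixes F :: "R2 \<Rightarrow> real"
  assumes "F \<in> borel_measurable borel"
  shows "(LINT x|lebesgue. F (x + c)) = (LINT x|lebesgue. F x)"
proof -
  have Fc: "(\<lambda>x. F (x + c)) \<in> borel_measurable borel"
    by (rule measurable_compose[OF _ assms]) simp
  have "(LINT x|lborel. F x) = (LINT x|distr lborel borel ((+) c). F x)"
    by (simp add: lborel_distr_plus)
  also have "\<dots> = (LINT x|lborel. F (c + x))"
    using assms by (subst integral_distr) auto
  finally show ?thesis
    using assms Fc by (simp add: integral_completion add.commute)
qed

lemma bounded_measurable_L1_loc:
  assumes "f \<in> borel_measurable (lebesgue_on \<Omega>)" and "AE x in lebesgue_on \<Omega>. \<bar>f x\<bar> \<le> B"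
    and \<Omega>: "open \<Omega>"
  shows "f \<in> L1_loc \<Omega>"
  unfolding L1_loc_def
proof safe
  fix K assume K: "compact K" "K \<subseteq> \<Omega>"
  have m: "(\<lambda>x. indicator \<Omega> x *\<^sub>R f x) \<in> borel_measurable lebesgue"
    using assms(1) \<Omega> by (subst (asm) borel_measurable_restrict_space_iff) auto
  have Kl: "K \<in> lmeasurable" using K(1) by (rule lmeasurable_compact)
  have eq: "indicator K x *\<^sub>R f x = indicator K x *\<^sub>R (indicator \<Omega> x *\<^sub>R f x)" for x
    using K(2) by (auto simp: indicator_def)
  have ae: "AE x in lebesgue. x \<in> \<Omega> \<longrightarrow> \<bar>f x\<bar> \<le> B"
    using assms(2) \<Omega> by (simp add: AE_lebesgue_on_iff)
  have "integrable lebesgue (\<lambda>x. indicator K x *\<^sub>R f x)"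
  proof (rule Bochner_Integration.integrable_bound)
    show "integrable lebesgue (\<lambda>x. B * indicator K x)"
      using Kl by (intro integrable_mult_right integrable_real_indicator) (auto simp: fmeasurable_def)
    show "(\<lambda>x. indicator K x *\<^sub>R f x) \<in> borel_measurable lebesgue"
      unfolding eq using Kl by (intro borel_measurable_scaleR[OF borel_measurable_indicator m]) (simp add: fmeasurable_def)
    show "AE x in lebesgue. norm (indicator K x *\<^sub>R f x) \<le> norm (B * indicator K x)"
      using ae
    proof eventually_elim
      case (elim x)
      show ?case
      proof (cases "x \<in> K")
        case True
        then have "x \<in> \<Omega>" using K(2) by auto
        with elim have "\<bar>f x\<bar> \<le> B" by simp
        then show ?thesis using True by simp
      qed simp
    qed
  qed
  then show "f absolutely_integrable_on K"
    by (simp add: set_integrable_def)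
qed

lemma partial_bound:
  assumes \<Omega>: "open \<Omega>" "x \<in> \<Omega>" and v: "v differentiable (at x)"
    and lip: "\<And>x t. closed_segment x (x + t *\<^sub>R axis j 1) \<subseteq> \<Omega> \<Longrightarrow> \<bar>v (x + t *\<^sub>R axis j 1) - v x\<bar> \<le> L * \<bar>t\<bar>"
  shows "\<bar>partial j v x\<bar> \<le> L"
proof -
  obtain e where e: "e > 0" "ball x e \<subseteq> \<Omega>" using \<Omega> openE by blast
  define t where "t n = (e/2) * inverse (real (Suc n))" for n
  have t0: "t n \<noteq> 0" "0 < t n" for n using e by (auto simp: t_def)
  have "(\<lambda>n. t n) \<longlonglongrightarrow> (e/2) * 0"
    unfolding t_def by (intro tendsto_mult tendsto_const LIMSEQ_inverse_real_of_nat)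
  then have tl: "t \<longlonglongrightarrow> 0" by simp
  have te: "t n < e" for n
  proof -
    have "inverse (real (Suc n)) \<le> 1" by (rule inverse_le_1_iff[THEN iffD2]) simp
    then have "t n \<le> (e/2) * 1" unfolding t_def using e by (intro mult_left_mono) auto
    then show ?thesis using e by simp
  qed
  obtain D where D: "(v has_derivative D) (at x)" using v by (auto simp: differentiable_def)
  have "(\<lambda>n. \<bar>(v (x + t n *\<^sub>R axis j 1) - v x) / t n\<bar>) \<longlonglongrightarrow> \<bar>D (axis j 1)\<bar>"
    by (intro tendsto_rabs difference_quotient_tendsto[OF D tl t0(1)])
  moreover have "\<bar>(v (x + t n *\<^sub>R axis j 1) - v x) / t n\<bar> \<le> L" for n
  proof -
    have "closed_segment x (x + t n *\<^sub>R axis j 1) \<subseteq> ball x e"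
      using t0[of n] te[of n] e by (intro closed_segment_subset) (auto simp: dist_norm norm_axis_1)
    then have "\<bar>v (x + t n *\<^sub>R axis j 1) - v x\<bar> \<le> L * \<bar>t n\<bar>" using lip e(2) by blast
    then show ?thesis using t0[of n] by (simp add: abs_divide divide_le_eq)
  qed
  ultimately have "\<bar>D (axis j 1)\<bar> \<le> L" by (intro LIMSEQ_le_const2) auto
  then show ?thesis by (simp add: partial_eqI[OF D])
qed

text \<open>Almost everywhere the derivative is a limit of difference quotients of the extension by zero, and
  these are Borel functions.\<close>

lemma partial_measurable:
  assumes \<Omega>: "open \<Omega>" and cont: "continuous_on \<Omega> v"
    and diff: "AE x in lebesgue_on \<Omega>. v differentiable (at x)"
  shows "partial j v \<in> borel_measurable (lebesgue_on \<Omega>)"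
proof -
  define w where "w x = indicator \<Omega> x *\<^sub>R v x" for x
  have w: "w \<in> borel_measurable borel"
    unfolding w_def using cont \<Omega> by (intro borel_measurable_continuous_on_indicator) auto
  define t where "t n = inverse (real (Suc n))" for n
  have tl: "t \<longlonglongrightarrow> 0" unfolding t_def by (rule LIMSEQ_inverse_real_of_nat)
  have t0: "t n \<noteq> 0" for n by (simp add: t_def)
  define q where "q n x = (w (x + t n *\<^sub>R axis j 1) - w x) / t n" for n x
  have q: "q n \<in> borel_measurable borel" for n
    unfolding q_def
    by (intro borel_measurable_divide borel_measurable_diff w borel_measurable_const
        measurable_compose[OF _ w]) auto
  have "(\<lambda>x. indicator \<Omega> x *\<^sub>R lim (\<lambda>n. q n x)) \<in> borel_measurable borel"
    using \<Omega> by (intro borel_measurable_scaleR borel_measurable_indicator borel_measurable_lim_metric q) auto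
  then have "(\<lambda>x. indicator \<Omega> x *\<^sub>R lim (\<lambda>n. q n x)) \<in> borel_measurable lebesgue"
    by (simp add: measurable_completion)
  moreover have "AE x in lebesgue. indicator \<Omega> x *\<^sub>R lim (\<lambda>n. q n x) = indicator \<Omega> x *\<^sub>R partial j v x"
  proof -
    have "AE x in lebesgue. x \<in> \<Omega> \<longrightarrow> v differentiable (at x)"
      using diff \<Omega> by (simp add: AE_lebesgue_on_iff)
    then show ?thesis
    proof eventually_elim
      case (elim x)
      show ?case
      proof (cases "x \<in> \<Omega>")
        case True
        then obtain D where D: "(v has_derivative D) (at x)" using elim by (auto simp: differentiable_def)
        have "(w has_derivative D) (at x)"
          using \<Omega> True by (rule_tac has_derivative_transform_within_open[OF D, of \<Omega>]) (auto simp: w_def)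
        then have "(\<lambda>n. q n x) \<longlonglongrightarrow> D (axis j 1)"
          unfolding q_def by (intro difference_quotient_tendsto tl t0)
        then show ?thesis by (simp add: limI partial_eqI[OF D])
      qed simp
    qed
  qed
  ultimately have "(\<lambda>x. indicator \<Omega> x *\<^sub>R partial j v x) \<in> borel_measurable lebesgue"
    by (rule borel_measurable_AE)
  then show ?thesis
    using \<Omega> by (subst borel_measurable_restrict_space_iff) auto
qed

lemma test_function_bound:
  assumes \<phi>: "\<phi> \<in> Cc_infty \<Omega>"
  obtains P where "P \<ge> 0" "\<And>x. \<bar>\<phi> x\<bar> \<le> P" "\<And>x. \<bar>partial j \<phi> x\<bar> \<le> P"
    "\<And>x t. \<bar>\<phi> (x + t *\<^sub>R axis j 1) - \<phi> x\<bar> \<le> P * \<bar>t\<bar>"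
proof -
  let ?S = "closure {x. \<phi> x \<noteq> 0}"
  have "bounded (\<phi> ` ?S)" "bounded (partial j \<phi> ` ?S)"
    using Cc_inftyD(2)[OF \<phi>] Cc_inftyD(3)[OF \<phi>] Cc_inftyD(4)[OF \<phi>]
    by (auto intro!: compact_imp_bounded compact_continuous_image intro: continuous_on_subset)
  then obtain B C where B: "\<And>x. x \<in> ?S \<Longrightarrow> \<bar>\<phi> x\<bar> \<le> B" and C: "\<And>x. x \<in> ?S \<Longrightarrow> \<bar>partial j \<phi> x\<bar> \<le> C"
    unfolding bounded_iff by force
  define P where "P = max 0 (max B C)"
  have P: "P \<ge> 0" "\<bar>\<phi> x\<bar> \<le> P" "\<bar>partial j \<phi> x\<bar> \<le> P" for x
    using B[of x] C[of x] Cc_inftyD(6)[OF \<phi>, of x] Cc_inftyD(7)[OF \<phi>, of x j]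
    unfolding P_def by (cases "x \<in> ?S"; simp; linarith)+
  have "\<bar>\<phi> (x + t *\<^sub>R axis j 1) - \<phi> x\<bar> \<le> P * \<bar>t\<bar>" for x t
  proof -
    have d: "((\<lambda>s. \<phi> (x + s *\<^sub>R axis j 1)) has_field_derivative partial j \<phi> (x + s *\<^sub>R axis j 1)) (at s)" for s
      unfolding partial_def
      by (rule has_derivative_along_axis) (use Cc_inftyD(1)[OF \<phi>] in \<open>simp add: frechet_derivative_works[symmetric]\<close>)
    have "norm (\<phi> (x + t *\<^sub>R axis j 1) - \<phi> (x + 0 *\<^sub>R axis j 1)) \<le> P * norm (t - 0)"
      by (rule field_differentiable_bound[of UNIV "\<lambda>s. \<phi> (x + s *\<^sub>R axis j 1)"])
        (use d P(3) in auto)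
    then show ?thesis by simp
  qed
  then show thesis using P that by blast
qed


text \<open>The integral of a difference quotient of \<open>v \<phi>\<close> vanishes because Lebesgue measure is translation
  invariant. The quotients are dominated since \<open>v\<close> is Lipschitz along segments inside \<open>\<Omega>\<close>, so their
  limit \<open>\<partial>\<^sub>j(v \<phi>)\<close> has integral zero as well.\<close>

lemma has_weak_partial_classical:
  assumes \<Omega>: "open \<Omega>" and cont: "continuous_on \<Omega> v" and bd: "\<And>x. x \<in> \<Omega> \<Longrightarrow> \<bar>v x\<bar> \<le> B"
    and lip: "\<And>x t. closed_segment x (x + t *\<^sub>R axis j 1) \<subseteq> \<Omega> \<Longrightarrow> \<bar>v (x + t *\<^sub>R axis j 1) - v x\<bar> \<le> L * \<bar>t\<bar>"
    and diff: "AE x in lebesgue_on \<Omega>. v differentiable (at x)"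
  shows "has_weak_partial \<Omega> j v (partial j v)"
proof -
  let ?e = "axis j 1 :: R2"
  have pmeas: "partial j v \<in> borel_measurable (lebesgue_on \<Omega>)"
    by (rule partial_measurable[OF \<Omega> cont diff])
  have diff': "AE x in lebesgue. x \<in> \<Omega> \<longrightarrow> v differentiable (at x)"
    using diff \<Omega> by (simp add: AE_lebesgue_on_iff)
  have "AE x in lebesgue. x \<in> \<Omega> \<longrightarrow> \<bar>partial j v x\<bar> \<le> L"
    using diff' by eventually_elim (use partial_bound[OF \<Omega> _ _ lip] in blast)
  then have "AE x in lebesgue_on \<Omega>. \<bar>partial j v x\<bar> \<le> L"
    using \<Omega> by (simp add: AE_lebesgue_on_iff)
  then have dv: "partial j v \<in> L1_loc \<Omega>"
    by (rule bounded_measurable_L1_loc[OF pmeas _ \<Omega>])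
  have vmeas: "v \<in> borel_measurable (lebesgue_on \<Omega>)"
    using cont \<Omega> by (intro continuous_imp_measurable_on_sets_lebesgue) auto
  have v: "v \<in> L1_loc \<Omega>"
    by (rule bounded_measurable_L1_loc[OF vmeas _ \<Omega>, of B]) (use bd in \<open>auto intro: AE_I2\<close>)
  show ?thesis
    unfolding has_weak_partial_def
  proof (intro conjI ballI dv v)
    fix \<phi> assume \<phi>: "\<phi> \<in> Cc_infty \<Omega>"
    define S where "S = closure {x. \<phi> x \<noteq> 0}"
    have S: "compact S" "S \<subseteq> \<Omega>" using Cc_inftyD(4,5)[OF \<phi>] by (auto simp: S_def)
    have S0: "\<phi> x = 0" "partial j \<phi> x = 0" if "x \<notin> S" for x
      using that unfolding S_def by (rule Cc_inftyD(6)[OF \<phi>], rule Cc_inftyD(7)[OF \<phi>])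
    obtain P where P: "P \<ge> 0" "\<And>x. \<bar>\<phi> x\<bar> \<le> P"
      "\<And>x t. \<bar>\<phi> (x + t *\<^sub>R ?e) - \<phi> x\<bar> \<le> P * \<bar>t\<bar>"
      using test_function_bound[OF \<phi>, of j] by metis
    obtain d where d: "d > 0" "(\<Union>x\<in>S. cball x d) \<subseteq> \<Omega>"
      using compact_subset_open_imp_cball_epsilon_subset[OF S(1) \<Omega> S(2)] by auto
    define F where "F x = v x * \<phi> x" for x
    have Fcont: "continuous_on UNIV F"
    proof -
      have "continuous_on \<Omega> F"
        unfolding F_def using cont Cc_inftyD(2)[OF \<phi>] by (intro continuous_on_mult) (auto intro: continuous_on_subset)
      moreover have "continuous_on (- S) F"
        by (rule continuous_on_eq[of _ "\<lambda>_. 0"]) (auto simp: F_def S0)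
      moreover have "\<Omega> \<union> - S = UNIV" using S by auto
      moreover have "open (- S)" using S by (simp add: compact_imp_closed open_Compl)
      ultimately show ?thesis using continuous_on_open_Un[OF \<Omega>, of "- S" F] by simp
    qed
    then have Fm: "F \<in> borel_measurable borel" by (rule borel_measurable_continuous_onI)
    define C where "C = \<bar>B\<bar> * P + P * \<bar>L\<bar>"
    have Flip: "\<bar>F (x + t *\<^sub>R ?e) - F x\<bar> \<le> C * \<bar>t\<bar>" if t: "\<bar>t\<bar> \<le> d" for x t
    proof (cases "x \<in> S \<or> x + t *\<^sub>R ?e \<in> S")
      case True
      then obtain z where z: "z \<in> S" "z = x \<or> z = x + t *\<^sub>R ?e" by auto
      have "closed_segment x (x + t *\<^sub>R ?e) \<subseteq> cball z d"
        using z(2) t d(1) by (intro closed_segment_subset) (auto simp: dist_norm norm_axis_1)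
      also have "\<dots> \<subseteq> \<Omega>" using d(2) z(1) by auto
      finally have seg: "closed_segment x (x + t *\<^sub>R ?e) \<subseteq> \<Omega>" .
      have xs: "x + t *\<^sub>R ?e \<in> \<Omega>" using seg by auto
      have "F (x + t *\<^sub>R ?e) - F x =
          v (x + t *\<^sub>R ?e) * (\<phi> (x + t *\<^sub>R ?e) - \<phi> x) + \<phi> x * (v (x + t *\<^sub>R ?e) - v x)"
        by (simp add: F_def algebra_simps)
      also have "\<bar>\<dots>\<bar> \<le> \<bar>B\<bar> * (P * \<bar>t\<bar>) + P * (\<bar>L\<bar> * \<bar>t\<bar>)"
      proof (rule order_trans[OF abs_triangle_ineq add_mono])
        show "\<bar>v (x + t *\<^sub>R ?e) * (\<phi> (x + t *\<^sub>R ?e) - \<phi> x)\<bar> \<le> \<bar>B\<bar> * (P * \<bar>t\<bar>)"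
          unfolding abs_mult using bd[OF xs] P by (intro mult_mono) auto
        have "\<bar>v (x + t *\<^sub>R ?e) - v x\<bar> \<le> \<bar>L\<bar> * \<bar>t\<bar>"
          using lip[OF seg] mult_right_mono[of L "\<bar>L\<bar>" "\<bar>t\<bar>"] by linarith
        then show "\<bar>\<phi> x * (v (x + t *\<^sub>R ?e) - v x)\<bar> \<le> P * (\<bar>L\<bar> * \<bar>t\<bar>)"
          unfolding abs_mult using P by (intro mult_mono) auto
      qed
      also have "\<dots> = C * \<bar>t\<bar>" by (simp add: C_def algebra_simps)
      finally show ?thesis .
    next
      case False
      then show ?thesis using P by (simp add: F_def S0 C_def)
    qed
    have C0: "C \<ge> 0" using P by (simp add: C_def)
    define t where "t n = d * inverse (real (Suc n))" for n
    have t0: "t n \<noteq> 0" "0 < t n" for n using d by (auto simp: t_def)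
    have "(\<lambda>n. t n) \<longlonglongrightarrow> d * 0"
      unfolding t_def by (intro tendsto_mult tendsto_const LIMSEQ_inverse_real_of_nat)
    then have tl: "t \<longlonglongrightarrow> 0" by simp
    have td: "t n \<le> d" for n
    proof -
      have "inverse (real (Suc n)) \<le> 1" by (rule inverse_le_1_iff[THEN iffD2]) simp
      then have "t n \<le> d * 1" unfolding t_def using d by (intro mult_left_mono) auto
      then show ?thesis by simp
    qed
    define q where "q n x = (F (x + t n *\<^sub>R ?e) - F x) / t n" for n x
    define G where "G x = v x * partial j \<phi> x + partial j v x * \<phi> x" for x
    obtain R where R: "\<And>x. x \<in> S \<Longrightarrow> norm x \<le> R"
      using compact_imp_bounded[OF S(1)] by (auto simp: bounded_iff)
    have Fint: "integrable lebesgue F"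
    proof -
      obtain BF where BF: "\<And>x. x \<in> S \<Longrightarrow> \<bar>F x\<bar> \<le> BF"
        using compact_imp_bounded[OF compact_continuous_image[OF continuous_on_subset[OF Fcont] S(1)]]
        by (auto simp: bounded_iff)
      show ?thesis
      proof (rule Bochner_Integration.integrable_bound)
        show "integrable lebesgue (\<lambda>x. BF * indicator S x)"
          using lmeasurable_compact[OF S(1)]
          by (intro integrable_mult_right integrable_real_indicator) (auto simp: fmeasurable_def)
        show "F \<in> borel_measurable lebesgue" using Fm by (simp add: measurable_completion)
        show "AE x in lebesgue. norm (F x) \<le> norm (BF * indicator S x)"
        proof (rule AE_I2)
          fix x show "norm (F x) \<le> norm (BF * indicator S x)"
            using BF[of x] S0[of x] by (cases "x \<in> S") (auto simp: F_def)
        qed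
      qed
    qed
    have Ftm: "(\<lambda>x. F (x + c)) \<in> borel_measurable borel" for c
      by (rule measurable_compose[OF _ Fm]) simp
    have Ftint: "integrable lebesgue (\<lambda>x. F (x + c))" for c
    proof -
      have "integrable lborel F" using Fint integrable_completion[of F lborel] Fm by simp
      then have "integrable (distr lborel borel ((+) c)) F" by (simp add: lborel_distr_plus)
      then have "integrable lborel (\<lambda>x. F (c + x))"
        by (subst (asm) integrable_distr_eq) (use Fm in auto)
      then show ?thesis using integrable_completion[of "\<lambda>x. F (x + c)" lborel] Ftm by (simp add: add.commute)
    qed
    have q0: "(LINT x|lebesgue. q n x) = 0" for n
      unfolding q_def using Fint Ftint[of "t n *\<^sub>R ?e"] lebesgue_integral_translate[OF Fm, of "t n *\<^sub>R ?e"] by simp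
    have qm: "q n \<in> borel_measurable lebesgue" for n
      unfolding q_def using Fm Ftm by (intro measurable_completion) simp
    have qlim: "AE x in lebesgue. (\<lambda>n. q n x) \<longlonglongrightarrow> G x"
      using diff'
    proof eventually_elim
      case (elim x)
      show ?case
      proof (cases "x \<in> \<Omega>")
        case True
        then obtain D where D: "(v has_derivative D) (at x)" using elim by (auto simp: differentiable_def)
        obtain E where E: "(\<phi> has_derivative E) (at x)" using Cc_inftyD(1)[OF \<phi>] by (auto simp: differentiable_def)
        have "(F has_derivative (\<lambda>h. v x * E h + D h * \<phi> x)) (at x)"
          unfolding F_def by (rule has_derivative_mult[OF D E])
        from difference_quotient_tendsto[OF this tl t0(1), of ?e] show ?thesis
          unfolding q_def G_def by (simp add: partial_eqI[OF D] partial_eqI[OF E])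
      next
        case False
        have "(F has_derivative (\<lambda>h. 0)) (at x)"
        proof (rule has_derivative_transform_within_open[of "\<lambda>_. 0" _ _ _ "- S"])
          show "open (- S)" using S by (simp add: compact_imp_closed open_Compl)
          show "x \<in> - S" using False S by auto
        qed (auto simp: F_def S0)
        from difference_quotient_tendsto[OF this tl t0(1), of ?e]
        have "(\<lambda>n. q n x) \<longlonglongrightarrow> 0" unfolding q_def .
        moreover have "x \<notin> S" using False S(2) by auto
        then have "G x = 0" by (simp add: G_def S0)
        ultimately show ?thesis by simp
      qed
    qed
    have Gm: "G \<in> borel_measurable lebesgue"
    proof (rule borel_measurable_AE)
      show "(\<lambda>x. lim (\<lambda>n. q n x)) \<in> borel_measurable lebesgue"
        by (rule borel_measurable_lim_metric[OF qm])
      show "AE x in lebesgue. lim (\<lambda>n. q n x) = G x"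
        using qlim by eventually_elim (rule limI)
    qed
    have "(\<lambda>n. LINT x|lebesgue. q n x) \<longlonglongrightarrow> (LINT x|lebesgue. G x)"
    proof (rule integral_dominated_convergence[OF Gm qm _ qlim])
      show "integrable lebesgue (\<lambda>x. C * indicator (cball (0::R2) (R + d)) x)"
        by (intro integrable_mult_right integrable_real_indicator) (use lmeasurable_cball[of "0::R2" "R + d"] in \<open>auto simp: fmeasurable_def\<close>)
      show "AE x in lebesgue. norm (q n x) \<le> C * indicator (cball 0 (R + d)) x" for n
      proof (rule AE_I2)
        fix x
        have *: "norm (q n x) \<le> C"
          using Flip[of "t n" x] t0[of n] td[of n] unfolding q_def by (simp add: abs_divide divide_le_eq)
        show "norm (q n x) \<le> C * indicator (cball 0 (R + d)) x"
        proof (cases "x \<in> cball 0 (R + d)")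
          case True then show ?thesis using * by simp
        next
          case False
          have "x \<notin> S" using False R[of x] d by auto
          moreover have "x + t n *\<^sub>R ?e \<notin> S"
          proof
            assume "x + t n *\<^sub>R ?e \<in> S"
            then have "norm (x + t n *\<^sub>R ?e) \<le> R" by (rule R)
            moreover have "norm x \<le> norm (x + t n *\<^sub>R ?e) + norm (t n *\<^sub>R ?e)"
              by (metis add_diff_cancel_right' norm_triangle_ineq4)
            moreover have "norm (t n *\<^sub>R ?e) \<le> d" using td[of n] t0[of n] by (simp add: norm_axis_1)
            ultimately show False using False by simp
          qed
          ultimately show ?thesis using False by (simp add: q_def F_def S0)
        qed
      qed
    qed
    then have G0: "(LINT x|lebesgue. G x) = 0"
      unfolding q0 LIMSEQ_const_iff by simp
    have "G x = indicator \<Omega> x *\<^sub>R G x" for x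
    proof (cases "x \<in> S")
      case True
      then have "x \<in> \<Omega>" using S(2) by auto
      then show ?thesis by simp
    qed (simp add: G_def S0)
    then have "(LINT x|lebesgue_on \<Omega>. G x) = 0"
      using \<Omega> G0 by (simp add: integral_restrict_space del: real_scaleR_def flip: \<open>\<And>x. G x = indicator \<Omega> x *\<^sub>R G x\<close>)
    moreover have "(LINT x|lebesgue_on \<Omega>. G x) =
        (LINT x|lebesgue_on \<Omega>. v x * partial j \<phi> x) + (LINT x|lebesgue_on \<Omega>. partial j v x * \<phi> x)"
      unfolding G_def
      by (intro Bochner_Integration.integral_add integrable_L1_loc_test[OF \<Omega> v \<phi>] integrable_L1_loc_test[OF \<Omega> dv \<phi>])
    ultimately show "(LINT x|lebesgue_on \<Omega>. v x * partial j \<phi> x) = - (LINT x|lebesgue_on \<Omega>. partial j v x * \<phi> x)"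
      by simp
  qed
qed

lemma has_weak_partial_test_function:
  assumes \<Omega>: "open \<Omega>" and \<phi>: "\<phi> \<in> Cc_infty \<Omega>"
  shows "has_weak_partial \<Omega> j \<phi> (partial j \<phi>)"
proof -
  obtain P where P: "\<And>x. \<bar>\<phi> x\<bar> \<le> P" "\<And>x t. \<bar>\<phi> (x + t *\<^sub>R axis j 1) - \<phi> x\<bar> \<le> P * \<bar>t\<bar>"
    using test_function_bound[OF \<phi>, of j] by metis
  show ?thesis
    by (rule has_weak_partial_classical[OF \<Omega> continuous_on_subset[OF Cc_inftyD(2)[OF \<phi>]] P(1) P(2)])
      (auto intro: Cc_inftyD(1)[OF \<phi>])
qed

section \<open>Square-integrable functions and the space of zero boundary values\<close>

text \<open>Completeness of Lebesgue measure: weak derivatives are only known almost everywhere, and this makes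
  them measurable.\<close>

lemma measurable_lebesgue_on_AE_eq:
  fixes f g :: "R2 \<Rightarrow> 'b::euclidean_space"
  assumes f: "f \<in> borel_measurable (lebesgue_on S)" and ae: "AE x in lebesgue_on S. f x = g x"
    and S: "S \<in> sets lebesgue"
  shows "g \<in> borel_measurable (lebesgue_on S)"
proof -
  have "(\<lambda>x. indicator S x *\<^sub>R f x) \<in> borel_measurable lebesgue"
    using f S by (subst (asm) borel_measurable_restrict_space_iff) auto
  moreover have "AE x in lebesgue. x \<in> S \<longrightarrow> f x = g x"
    using ae S by (simp add: AE_lebesgue_on_iff)
  then have "AE x in lebesgue. indicator S x *\<^sub>R f x = indicator S x *\<^sub>R g x"
    by eventually_elim (auto simp: indicator_def)
  ultimately have "(\<lambda>x. indicator S x *\<^sub>R g x) \<in> borel_measurable lebesgue"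
    by (rule borel_measurable_AE)
  then show ?thesis using S by (subst borel_measurable_restrict_space_iff) auto
qed

lemma finite_measure_bounded_open:
  assumes "open \<Omega>" "bounded \<Omega>" shows "finite_measure (lebesgue_on \<Omega>)"
  using assms by (intro finite_measure_lebesgue_on lmeasurable_open)

lemma bounded_measurable_L2:
  fixes f :: "R2 \<Rightarrow> 'b::euclidean_space"
  assumes "open \<Omega>" "bounded \<Omega>" "f \<in> borel_measurable (lebesgue_on \<Omega>)"
    "AE x in lebesgue_on \<Omega>. norm (f x) \<le> B"
  shows "f \<in> L2 \<Omega>"
proof -
  interpret finite_measure "lebesgue_on \<Omega>" using assms by (intro finite_measure_bounded_open)
  have "integrable (lebesgue_on \<Omega>) (\<lambda>x. (norm (f x))\<^sup>2)"
  proof (rule integrable_const_bound)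
    show "AE x in lebesgue_on \<Omega>. norm ((norm (f x))\<^sup>2) \<le> B\<^sup>2"
      using assms(4) by eventually_elim (simp add: power_mono)
    show "(\<lambda>x. (norm (f x))\<^sup>2) \<in> borel_measurable (lebesgue_on \<Omega>)"
      using assms(3) by simp
  qed
  then show ?thesis using assms(3) by (simp add: L2_def)
qed

lemma norm_sq_lincomb_le:
  fixes u v :: "'b::euclidean_space"
  shows "(norm (a *\<^sub>R u + v))\<^sup>2 \<le> 2 * a\<^sup>2 * (norm u)\<^sup>2 + 2 * (norm v)\<^sup>2"
proof -
  have "(norm (a *\<^sub>R u + v))\<^sup>2 \<le> (\<bar>a\<bar> * norm u + norm v)\<^sup>2"
    by (intro power_mono order_trans[OF norm_triangle_ineq]) auto
  also have "\<dots> \<le> 2 * (\<bar>a\<bar> * norm u)\<^sup>2 + 2 * (norm v)\<^sup>2"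
    using zero_le_power2[of "\<bar>a\<bar> * norm u - norm v"] by (simp add: power2_eq_square algebra_simps)
  finally show ?thesis by (simp add: power_mult_distrib)
qed

lemma L2_lincomb:
  fixes f g :: "R2 \<Rightarrow> 'b::euclidean_space"
  assumes f: "f \<in> L2 \<Omega>" and g: "g \<in> L2 \<Omega>"
  shows "(\<lambda>x. a *\<^sub>R f x + g x) \<in> L2 \<Omega>"
    and "ip \<Omega> (\<lambda>x. a *\<^sub>R f x + g x) (\<lambda>x. a *\<^sub>R f x + g x) \<le> 2 * a\<^sup>2 * ip \<Omega> f f + 2 * ip \<Omega> g g"
proof -
  have m: "(\<lambda>x. a *\<^sub>R f x + g x) \<in> borel_measurable (lebesgue_on \<Omega>)"
    using f g unfolding L2_def by (intro borel_measurable_add borel_measurable_scaleR borel_measurable_const) auto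
  have i: "integrable (lebesgue_on \<Omega>) (\<lambda>x. 2 * a\<^sup>2 * (norm (f x))\<^sup>2 + 2 * (norm (g x))\<^sup>2)"
    using f g by (simp add: L2_def)
  have i2: "integrable (lebesgue_on \<Omega>) (\<lambda>x. (norm (a *\<^sub>R f x + g x))\<^sup>2)"
  proof (rule Bochner_Integration.integrable_bound[OF i])
    show "(\<lambda>x. (norm (a *\<^sub>R f x + g x))\<^sup>2) \<in> borel_measurable (lebesgue_on \<Omega>)"
      using m by simp
    show "AE x in lebesgue_on \<Omega>. norm ((norm (a *\<^sub>R f x + g x))\<^sup>2)
        \<le> norm (2 * a\<^sup>2 * (norm (f x))\<^sup>2 + 2 * (norm (g x))\<^sup>2)"
      using norm_sq_lincomb_le[of a] by (intro AE_I2) simp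
  qed
  show "(\<lambda>x. a *\<^sub>R f x + g x) \<in> L2 \<Omega>" using m i2 by (simp add: L2_def)
  have "(LINT x|lebesgue_on \<Omega>. (norm (a *\<^sub>R f x + g x))\<^sup>2)
      \<le> (LINT x|lebesgue_on \<Omega>. 2 * a\<^sup>2 * (norm (f x))\<^sup>2 + 2 * (norm (g x))\<^sup>2)"
    by (intro integral_mono i i2 norm_sq_lincomb_le)
  also have "\<dots> = 2 * a\<^sup>2 * (LINT x|lebesgue_on \<Omega>. (norm (f x))\<^sup>2) + 2 * (LINT x|lebesgue_on \<Omega>. (norm (g x))\<^sup>2)"
    using f g by (simp add: L2_def)
  finally show "ip \<Omega> (\<lambda>x. a *\<^sub>R f x + g x) (\<lambda>x. a *\<^sub>R f x + g x) \<le> 2 * a\<^sup>2 * ip \<Omega> f f + 2 * ip \<Omega> g g"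
    by (simp add: ip_def power2_norm_eq_inner)
qed

lemma ip_self_nonneg: "0 \<le> ip \<Omega> f f"
  by (simp add: ip_def)

lemma ip_AE_cong:
  fixes f g :: "R2 \<Rightarrow> real"
  assumes "f \<in> borel_measurable (lebesgue_on \<Omega>)" "AE x in lebesgue_on \<Omega>. f x = g x" "open \<Omega>"
  shows "ip \<Omega> f f = ip \<Omega> g g"
proof -
  have "g \<in> borel_measurable (lebesgue_on \<Omega>)"
    by (rule measurable_lebesgue_on_AE_eq[OF assms(1,2)]) (use assms(3) in auto)
  then show ?thesis
    unfolding ip_def using assms by (intro integral_cong_AE) (auto elim: eventually_mono)
qed

lemma L2_AE_eq:
  fixes f g :: "R2 \<Rightarrow> real"
  assumes f: "f \<in> L2 \<Omega>" and ae: "AE x in lebesgue_on \<Omega>. f x = g x" and \<Omega>: "open \<Omega>"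
  shows "g \<in> L2 \<Omega>"
proof -
  have fm: "f \<in> borel_measurable (lebesgue_on \<Omega>)" and fi: "integrable (lebesgue_on \<Omega>) (\<lambda>x. (norm (f x))\<^sup>2)"
    using f by (auto simp: L2_def)
  have gm: "g \<in> borel_measurable (lebesgue_on \<Omega>)"
    by (rule measurable_lebesgue_on_AE_eq[OF fm ae]) (use \<Omega> in auto)
  have "integrable (lebesgue_on \<Omega>) (\<lambda>x. (norm (g x))\<^sup>2)"
    using fi
  proof (rule integrable_cong_AE_imp)
    show "(\<lambda>x. (norm (g x))\<^sup>2) \<in> borel_measurable (lebesgue_on \<Omega>)" using gm by simp
    show "AE x in lebesgue_on \<Omega>. (norm (f x))\<^sup>2 = (norm (g x))\<^sup>2" using ae by eventually_elim simp
  qed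
  then show ?thesis using gm by (simp add: L2_def)
qed

lemma has_weak_partial_weak_partial:
  "has_weak_partial \<Omega> j f g \<Longrightarrow> has_weak_partial \<Omega> j f (weak_partial \<Omega> j f)"
  unfolding weak_partial_def by (rule someI[of "has_weak_partial \<Omega> j f"])

lemma H1_weak_partial:
  assumes \<Omega>: "open \<Omega>" and f: "f \<in> H1 \<Omega>"
  shows "has_weak_partial \<Omega> j f (weak_partial \<Omega> j f)" and "weak_partial \<Omega> j f \<in> L2 \<Omega>"
proof -
  obtain g where g: "g \<in> L2 \<Omega>" "has_weak_partial \<Omega> j f g" using f unfolding H1_def by blast
  show "has_weak_partial \<Omega> j f (weak_partial \<Omega> j f)" by (rule has_weak_partial_weak_partial[OF g(2)])
  have "AE x in lebesgue_on \<Omega>. g x = weak_partial \<Omega> j f x"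
    using weak_partial_AE_eq[OF \<Omega> g(2)] by eventually_elim simp
  then show "weak_partial \<Omega> j f \<in> L2 \<Omega>" by (rule L2_AE_eq[OF g(1) _ \<Omega>])
qed

text \<open>The square of the norm satisfies \<open>\<parallel>a f + g\<parallel>\<^sup>2 \<le> 2 a\<^sup>2 \<parallel>f\<parallel>\<^sup>2 + 2 \<parallel>g\<parallel>\<^sup>2\<close>, which replaces the triangle
  inequality in limits.\<close>

definition H1_normsq :: "R2 set \<Rightarrow> (R2 \<Rightarrow> real) \<Rightarrow> real" where
  "H1_normsq \<Omega> f = ip \<Omega> f f + (\<Sum>j\<in>UNIV. ip \<Omega> (weak_partial \<Omega> j f) (weak_partial \<Omega> j f))"

lemma H1_normsq_nonneg: "0 \<le> H1_normsq \<Omega> f"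
  unfolding H1_normsq_def by (intro add_nonneg_nonneg sum_nonneg ip_self_nonneg)

lemma H1_norm_tendsto_0_iff:
  "(\<lambda>n::nat. H1_norm \<Omega> (f n)) \<longlonglongrightarrow> 0 \<longleftrightarrow> (\<lambda>n. H1_normsq \<Omega> (f n)) \<longlonglongrightarrow> 0"
proof
  assume "(\<lambda>n. H1_norm \<Omega> (f n)) \<longlonglongrightarrow> 0"
  from tendsto_power[OF this, of 2] show "(\<lambda>n. H1_normsq \<Omega> (f n)) \<longlonglongrightarrow> 0"
    using H1_normsq_nonneg by (simp add: H1_norm_def H1_normsq_def[symmetric])
next
  assume "(\<lambda>n. H1_normsq \<Omega> (f n)) \<longlonglongrightarrow> 0"
  from tendsto_real_sqrt[OF this] show "(\<lambda>n. H1_norm \<Omega> (f n)) \<longlonglongrightarrow> 0"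
    by (simp add: H1_norm_def H1_normsq_def[symmetric])
qed

lemma H1_lincomb:
  assumes \<Omega>: "open \<Omega>" and f: "f \<in> H1 \<Omega>" and g: "g \<in> H1 \<Omega>"
  shows "(\<lambda>x. a * f x + g x) \<in> H1 \<Omega>"
    and "H1_normsq \<Omega> (\<lambda>x. a * f x + g x) \<le> 2 * a\<^sup>2 * H1_normsq \<Omega> f + 2 * H1_normsq \<Omega> g"
proof -
  have L: "f \<in> L2 \<Omega>" "g \<in> L2 \<Omega>" using f g by (auto simp: H1_def)
  note F = H1_weak_partial[OF \<Omega> f] and G = H1_weak_partial[OF \<Omega> g]
  have wp: "has_weak_partial \<Omega> j (\<lambda>x. a * f x + g x) (\<lambda>x. a * weak_partial \<Omega> j f x + weak_partial \<Omega> j g x)" for j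
    by (rule has_weak_partial_lincomb[OF \<Omega> F(1) G(1)])
  have wpL: "(\<lambda>x. a * weak_partial \<Omega> j f x + weak_partial \<Omega> j g x) \<in> L2 \<Omega>" for j
    using L2_lincomb(1)[OF F(2) G(2), of a] by simp
  show "(\<lambda>x. a * f x + g x) \<in> H1 \<Omega>"
    unfolding H1_def using L2_lincomb(1)[OF L, of a] wp wpL by auto
  have "ip \<Omega> (weak_partial \<Omega> j (\<lambda>x. a * f x + g x)) (weak_partial \<Omega> j (\<lambda>x. a * f x + g x))
      \<le> 2 * a\<^sup>2 * ip \<Omega> (weak_partial \<Omega> j f) (weak_partial \<Omega> j f)
        + 2 * ip \<Omega> (weak_partial \<Omega> j g) (weak_partial \<Omega> j g)" for j
  proof -
    have "AE x in lebesgue_on \<Omega>. a * weak_partial \<Omega> j f x + weak_partial \<Omega> j g x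
        = weak_partial \<Omega> j (\<lambda>x. a * f x + g x) x"
      using weak_partial_AE_eq[OF \<Omega> wp[of j]] by eventually_elim simp
    from ip_AE_cong[OF _ this \<Omega>] L2_lincomb(2)[OF F(2)[of j] G(2)[of j], of a] wpL[of j]
    show ?thesis by (simp add: L2_def)
  qed
  then have "(\<Sum>j\<in>UNIV. ip \<Omega> (weak_partial \<Omega> j (\<lambda>x. a * f x + g x)) (weak_partial \<Omega> j (\<lambda>x. a * f x + g x)))
      \<le> (\<Sum>j\<in>UNIV. 2 * a\<^sup>2 * ip \<Omega> (weak_partial \<Omega> j f) (weak_partial \<Omega> j f)
        + 2 * ip \<Omega> (weak_partial \<Omega> j g) (weak_partial \<Omega> j g))"
    by (intro sum_mono)
  also have "\<dots> = 2 * a\<^sup>2 * (\<Sum>j\<in>UNIV. ip \<Omega> (weak_partial \<Omega> j f) (weak_partial \<Omega> j f))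
      + 2 * (\<Sum>j\<in>UNIV. ip \<Omega> (weak_partial \<Omega> j g) (weak_partial \<Omega> j g))"
    by (simp add: sum.distrib sum_distrib_left)
  finally show "H1_normsq \<Omega> (\<lambda>x. a * f x + g x) \<le> 2 * a\<^sup>2 * H1_normsq \<Omega> f + 2 * H1_normsq \<Omega> g"
    using L2_lincomb(2)[OF L, of a] unfolding H1_normsq_def by (simp add: distrib_left)
qed

lemma test_function_L2:
  assumes \<Omega>: "open \<Omega>" "bounded \<Omega>" and \<phi>: "\<phi> \<in> Cc_infty \<Omega>"
  shows "\<phi> \<in> L2 \<Omega>" "partial j \<phi> \<in> L2 \<Omega>"
proof -
  obtain P where P: "\<And>x. \<bar>\<phi> x\<bar> \<le> P" "\<And>x. \<bar>partial j \<phi> x\<bar> \<le> P"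
    using test_function_bound[OF \<phi>, of j] by metis
  have "continuous_on \<Omega> \<phi>" "continuous_on \<Omega> (partial j \<phi>)"
    using Cc_inftyD(2)[OF \<phi>] Cc_inftyD(3)[OF \<phi>, of j] by (auto intro: continuous_on_subset)
  then have "\<phi> \<in> borel_measurable (lebesgue_on \<Omega>)" "partial j \<phi> \<in> borel_measurable (lebesgue_on \<Omega>)"
    using \<Omega> by (auto intro!: continuous_imp_measurable_on_sets_lebesgue)
  then show "\<phi> \<in> L2 \<Omega>" "partial j \<phi> \<in> L2 \<Omega>"
    using P by (auto intro!: bounded_measurable_L2[OF \<Omega>, of _ P])
qed

lemma test_function_H1:
  assumes \<Omega>: "open \<Omega>" "bounded \<Omega>" and \<phi>: "\<phi> \<in> Cc_infty \<Omega>"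
  shows "\<phi> \<in> H1 \<Omega>"
  unfolding H1_def using test_function_L2[OF assms] has_weak_partial_test_function[OF \<Omega>(1) \<phi>] by auto

lemma H1_0_lincomb:
  assumes \<Omega>: "open \<Omega>" "bounded \<Omega>" and f: "f \<in> H1_0 \<Omega>" and g: "g \<in> H1_0 \<Omega>"
  shows "(\<lambda>x. a * f x + g x) \<in> H1_0 \<Omega>"
proof -
  obtain \<phi> where \<phi>: "\<And>n::nat. \<phi> n \<in> Cc_infty \<Omega>" "(\<lambda>n. H1_normsq \<Omega> (\<lambda>x. f x - \<phi> n x)) \<longlonglongrightarrow> 0"
    using f unfolding H1_0_def H1_norm_tendsto_0_iff by auto
  obtain \<psi> where \<psi>: "\<And>n::nat. \<psi> n \<in> Cc_infty \<Omega>" "(\<lambda>n. H1_normsq \<Omega> (\<lambda>x. g x - \<psi> n x)) \<longlonglongrightarrow> 0"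
    using g unfolding H1_0_def H1_norm_tendsto_0_iff by auto
  have H: "f \<in> H1 \<Omega>" "g \<in> H1 \<Omega>" using f g by (auto simp: H1_0_def)
  have d: "(\<lambda>x. f x - \<phi> n x) \<in> H1 \<Omega>" "(\<lambda>x. g x - \<psi> n x) \<in> H1 \<Omega>" for n
    using H1_lincomb(1)[OF \<Omega>(1) test_function_H1[OF \<Omega> \<phi>(1)] H(1), of "-1"]
      H1_lincomb(1)[OF \<Omega>(1) test_function_H1[OF \<Omega> \<psi>(1)] H(2), of "-1"] by simp_all
  have "(\<lambda>n. H1_normsq \<Omega> (\<lambda>x. (a * f x + g x) - (a * \<phi> n x + \<psi> n x))) \<longlonglongrightarrow> 0"
  proof (rule tendsto_sandwich[OF _ _ tendsto_const])
    show "(\<lambda>n. 2 * a\<^sup>2 * H1_normsq \<Omega> (\<lambda>x. f x - \<phi> n x) + 2 * H1_normsq \<Omega> (\<lambda>x. g x - \<psi> n x)) \<longlonglongrightarrow> 0"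
      using tendsto_add[OF tendsto_mult_left[OF \<phi>(2), of "2 * a\<^sup>2"] tendsto_mult_left[OF \<psi>(2), of 2]] by simp
    have eq: "(\<lambda>x. (a * f x + g x) - (a * \<phi> n x + \<psi> n x)) = (\<lambda>x. a * (f x - \<phi> n x) + (g x - \<psi> n x))" for n
      by (simp add: algebra_simps)
    show "\<forall>\<^sub>F n in sequentially. H1_normsq \<Omega> (\<lambda>x. (a * f x + g x) - (a * \<phi> n x + \<psi> n x))
        \<le> 2 * a\<^sup>2 * H1_normsq \<Omega> (\<lambda>x. f x - \<phi> n x) + 2 * H1_normsq \<Omega> (\<lambda>x. g x - \<psi> n x)"
      unfolding eq by (intro always_eventually allI H1_lincomb(2)[OF \<Omega>(1) d])
  qed (simp add: H1_normsq_nonneg)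
  then show ?thesis
    unfolding H1_0_def using H1_lincomb(1)[OF \<Omega>(1) H, of a] Cc_infty_lincomb[OF \<phi>(1) \<psi>(1), where a = a]
    by (auto simp: H1_norm_tendsto_0_iff intro!: exI[of _ "\<lambda>n x. a * \<phi> n x + \<psi> n x"])
qed

lemma H1_0_approximation:
  assumes \<Omega>: "open \<Omega>" "bounded \<Omega>" and f: "f \<in> H1_0 \<Omega>"
  obtains \<phi> where "\<And>n::nat. \<phi> n \<in> Cc_infty \<Omega>"
    "(\<lambda>n. ip \<Omega> (\<lambda>x. f x - \<phi> n x) (\<lambda>x. f x - \<phi> n x)) \<longlonglongrightarrow> 0"
    "\<And>j. (\<lambda>n. ip \<Omega> (\<lambda>x. weak_partial \<Omega> j f x - partial j (\<phi> n) x)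
       (\<lambda>x. weak_partial \<Omega> j f x - partial j (\<phi> n) x)) \<longlonglongrightarrow> 0"
proof -
  obtain \<phi> where \<phi>: "\<And>n::nat. \<phi> n \<in> Cc_infty \<Omega>" "(\<lambda>n. H1_normsq \<Omega> (\<lambda>x. f x - \<phi> n x)) \<longlonglongrightarrow> 0"
    using f unfolding H1_0_def H1_norm_tendsto_0_iff by auto
  have H: "f \<in> H1 \<Omega>" using f by (auto simp: H1_0_def)
  let ?w = "\<lambda>j n. weak_partial \<Omega> j (\<lambda>x. f x - \<phi> n x)"
  have eq: "ip \<Omega> (?w j n) (?w j n) = ip \<Omega> (\<lambda>x. weak_partial \<Omega> j f x - partial j (\<phi> n) x)
       (\<lambda>x. weak_partial \<Omega> j f x - partial j (\<phi> n) x)" for j n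
  proof -
    have "has_weak_partial \<Omega> j (\<lambda>x. f x - \<phi> n x) (\<lambda>x. weak_partial \<Omega> j f x - partial j (\<phi> n) x)"
      using has_weak_partial_lincomb[OF \<Omega>(1) has_weak_partial_test_function[OF \<Omega>(1) \<phi>(1)] H1_weak_partial(1)[OF \<Omega>(1) H], of j "-1"]
      by simp
    moreover have "?w j n \<in> borel_measurable (lebesgue_on \<Omega>)"
    proof -
      have "(\<lambda>x. f x - \<phi> n x) \<in> H1 \<Omega>"
        using H1_lincomb(1)[OF \<Omega>(1) test_function_H1[OF \<Omega> \<phi>(1)] H, of "-1"] by simp
      from H1_weak_partial(2)[OF \<Omega>(1) this] show ?thesis by (simp add: L2_def)
    qed
    ultimately show ?thesis
      using weak_partial_AE_eq[OF \<Omega>(1)] by (intro ip_AE_cong[OF _ _ \<Omega>(1)])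
  qed
  have "(\<lambda>n. ip \<Omega> (\<lambda>x. f x - \<phi> n x) (\<lambda>x. f x - \<phi> n x)) \<longlonglongrightarrow> 0"
  proof (rule tendsto_sandwich[OF _ _ tendsto_const \<phi>(2)])
    show "\<forall>\<^sub>F n in sequentially. ip \<Omega> (\<lambda>x. f x - \<phi> n x) (\<lambda>x. f x - \<phi> n x) \<le> H1_normsq \<Omega> (\<lambda>x. f x - \<phi> n x)"
      unfolding H1_normsq_def by (intro always_eventually allI) (simp add: sum_nonneg ip_self_nonneg)
  qed (simp add: ip_self_nonneg)
  moreover have "(\<lambda>n. ip \<Omega> (?w j n) (?w j n)) \<longlonglongrightarrow> 0" for j
  proof (rule tendsto_sandwich[OF _ _ tendsto_const \<phi>(2)])
    have "ip \<Omega> (?w j n) (?w j n) \<le> (\<Sum>j\<in>UNIV. ip \<Omega> (?w j n) (?w j n))" for n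
      by (rule member_le_sum) (auto simp: ip_self_nonneg)
    then show "\<forall>\<^sub>F n in sequentially. ip \<Omega> (?w j n) (?w j n) \<le> H1_normsq \<Omega> (\<lambda>x. f x - \<phi> n x)"
      unfolding H1_normsq_def
      by (intro always_eventually allI) (rule add_increasing[OF ip_self_nonneg])
  qed (simp add: ip_self_nonneg)
  ultimately show thesis unfolding eq by (rule that[OF \<phi>(1)])
qed

section \<open>Velocities with zero boundary values do not leave the domain\<close>

lemma lebesgue_distr_translate:
  "(\<lambda>x::R2. x + c) \<in> lebesgue \<rightarrow>\<^sub>M lebesgue" "distr lebesgue lebesgue (\<lambda>x::R2. x + c) = lebesgue"
proof -
  have eq: "(\<lambda>x. c + (\<Sum>j\<in>Basis. (1 * (x \<bullet> j)) *\<^sub>R j)) = (\<lambda>x::R2. x + c)"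
    by (simp add: euclidean_representation add.commute)
  show m: "(\<lambda>x::R2. x + c) \<in> lebesgue \<rightarrow>\<^sub>M lebesgue"
    using lebesgue_affine_measurable[of "\<lambda>_. 1" c] unfolding eq by simp
  show "distr lebesgue lebesgue (\<lambda>x::R2. x + c) = lebesgue"
    using lebesgue_affine_euclidean[of "\<lambda>_. 1" c] unfolding eq by (simp add: density_1)
qed

lemma AE_translate:
  assumes "AE x::R2 in lebesgue. P x" shows "AE x in lebesgue. P (x + c)"
proof -
  have "AE x in distr lebesgue lebesgue (\<lambda>x::R2. x + c). P x"
    unfolding lebesgue_distr_translate(2) by (rule assms)
  then show ?thesis by (rule AE_distrD[OF lebesgue_distr_translate(1)])
qed

text \<open>Young's inequality \<open>\<bar>a\<bar> \<le> \<eta> + a\<^sup>2/\<eta>\<close> bounds integrals over a set of finite measure by the \<open>L\<^sup>2\<close> norm; the bound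
  is uniform in the shift because Lebesgue measure is translation invariant.\<close>

lemma shift_integral_bound:
  fixes h :: "R2 \<Rightarrow> real"
  assumes h: "h \<in> borel_measurable lebesgue" and h2: "integrable lebesgue (\<lambda>x. (h x)\<^sup>2)"
    and E: "E \<in> lmeasurable" and \<eta>: "\<eta> > 0"
  shows "set_integrable lebesgue E (\<lambda>x. h (x + c))"
    and "(LINT x:E|lebesgue. \<bar>h (x + c)\<bar>) \<le> \<eta> * measure lebesgue E + (LINT x|lebesgue. (h x)\<^sup>2) / \<eta>"
proof -
  let ?b = "\<lambda>x. \<eta> * indicator E x + (h (x + c))\<^sup>2 / \<eta>"
  have m: "(\<lambda>x. h (x + c)) \<in> borel_measurable lebesgue"
    by (rule measurable_compose[OF lebesgue_distr_translate(1) h])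
  have E': "E \<in> sets lebesgue" using E by (simp add: fmeasurable_def)
  have i2: "integrable lebesgue (\<lambda>x. (h (x + c))\<^sup>2)"
    using h2 integrable_distr_eq[OF lebesgue_distr_translate(1)[of c], of "\<lambda>x. (h x)\<^sup>2"] h
    by (simp add: lebesgue_distr_translate(2))
  have int2: "(LINT x|lebesgue. (h (x + c))\<^sup>2) = (LINT x|lebesgue. (h x)\<^sup>2)"
    using integral_distr[OF lebesgue_distr_translate(1)[of c], of "\<lambda>x. (h x)\<^sup>2"] h
    by (simp add: lebesgue_distr_translate(2))
  have iE: "integrable lebesgue (\<lambda>x. \<eta> * indicator E x)"
    using E by (intro integrable_mult_right integrable_real_indicator) (auto simp: fmeasurable_def)
  have ib: "integrable lebesgue ?b"
    using iE i2 by (intro Bochner_Integration.integrable_add) auto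
  have young: "\<bar>a\<bar> \<le> \<eta> + a\<^sup>2 / \<eta>" for a
  proof (cases "\<bar>a\<bar> \<le> \<eta>")
    case True
    have "a\<^sup>2 / \<eta> \<ge> 0" using \<eta> by simp
    with True show ?thesis by linarith
  next
    case False
    then have "\<bar>a\<bar> * \<eta> \<le> \<bar>a\<bar> * \<bar>a\<bar>" by (intro mult_left_mono) auto
    then have "\<bar>a\<bar> \<le> a\<^sup>2 / \<eta>" using \<eta> by (simp add: le_divide_eq power2_eq_square)
    then show ?thesis using \<eta> by linarith
  qed
  have le: "\<bar>indicator E x *\<^sub>R h (x + c)\<bar> \<le> ?b x" for x
    using young[of "h (x + c)"] \<eta> by (auto simp: indicator_def)
  have mi: "(\<lambda>x. indicator E x *\<^sub>R h (x + c)) \<in> borel_measurable lebesgue"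
    by (rule borel_measurable_scaleR[OF borel_measurable_indicator[OF E'] m])
  show si: "set_integrable lebesgue E (\<lambda>x. h (x + c))"
    unfolding set_integrable_def
  proof (rule Bochner_Integration.integrable_bound[OF ib mi])
    show "AE x in lebesgue. norm (indicator E x *\<^sub>R h (x + c)) \<le> norm (?b x)"
    proof (rule AE_I2)
      fix x show "norm (indicator E x *\<^sub>R h (x + c)) \<le> norm (?b x)"
        using le[of x] by (simp only: real_norm_def)
    qed
  qed
  have "(LINT x:E|lebesgue. \<bar>h (x + c)\<bar>) = (LINT x|lebesgue. \<bar>indicator E x *\<^sub>R h (x + c)\<bar>)"
    unfolding set_lebesgue_integral_def
    by (intro Bochner_Integration.integral_cong refl) (auto simp: indicator_def)
  also have "\<dots> \<le> (LINT x|lebesgue. ?b x)"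
    using si le unfolding set_integrable_def by (intro integral_mono integrable_abs ib) auto
  also have "\<dots> = (LINT x|lebesgue. \<eta> * indicator E x) + (LINT x|lebesgue. (h (x + c))\<^sup>2 / \<eta>)"
    using iE i2 by (intro Bochner_Integration.integral_add) auto
  also have "\<dots> = \<eta> * measure lebesgue E + (LINT x|lebesgue. (h x)\<^sup>2) / \<eta>"
    using E' int2 by simp
  finally show "(LINT x:E|lebesgue. \<bar>h (x + c)\<bar>) \<le> \<eta> * measure lebesgue E + (LINT x|lebesgue. (h x)\<^sup>2) / \<eta>" .
qed

text \<open>It suffices to test with the superlevel sets \<open>{D > c}\<close>, cut to balls to make their measure finite.\<close>

lemma AE_le_if_set_integrals_le:
  fixes D :: "R2 \<Rightarrow> real"
  assumes D: "D \<in> borel_measurable lebesgue"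
    and int: "\<And>E. E \<in> lmeasurable \<Longrightarrow> set_integrable lebesgue E D"
    and le: "\<And>E. E \<in> lmeasurable \<Longrightarrow> (LINT x:E|lebesgue. D x) \<le> c * measure lebesgue E"
  shows "AE x in lebesgue. D x \<le> c"
proof -
  have "AE x in lebesgue. x \<in> ball 0 (real n) \<longrightarrow> D x \<le> c" for n
  proof -
    define E where "E = ball 0 (real n) \<inter> {x. D x > c}"
    have "{x. D x > c} \<in> sets lebesgue"
      using D borel_measurable_iff_greater[of D lebesgue] by simp
    then have E: "E \<in> lmeasurable"
      unfolding E_def by (intro fmeasurable_Int_fmeasurable) auto
    have E': "E \<in> sets lebesgue" using E by (simp add: fmeasurable_def)
    have iD: "integrable lebesgue (\<lambda>x. indicator E x * D x)"
      using int[OF E] by (simp add: set_integrable_def)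
    have ic: "integrable lebesgue (\<lambda>x. indicator E x * c)"
      using E by (intro integrable_mult_left integrable_real_indicator) (auto simp: fmeasurable_def)
    have i: "integrable lebesgue (\<lambda>x. indicator E x * D x - indicator E x * c)"
      using iD ic by (rule Bochner_Integration.integrable_diff)
    have "(LINT x|lebesgue. indicator E x * D x - indicator E x * c) \<le> 0"
      using le[OF E] iD ic E' by (simp add: set_lebesgue_integral_def mult.commute)
    moreover have nn: "0 \<le> indicator E x * D x - indicator E x * c" for x
      by (auto simp: E_def indicator_def)
    ultimately have "(LINT x|lebesgue. indicator E x * D x - indicator E x * c) = 0"
      by (simp add: antisym integral_nonneg_AE)
    then have "AE x in lebesgue. indicator E x * D x - indicator E x * c = 0"
      using integral_nonneg_eq_0_iff_AE[OF i] nn by simp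
    then show ?thesis
      by eventually_elim (auto simp: E_def indicator_def split: if_splits)
  qed
  then have "AE x in lebesgue. \<forall>n. x \<in> ball 0 (real n) \<longrightarrow> D x \<le> c"
    by (intro AE_all_countable[THEN iffD2] allI)
  then show ?thesis
  proof eventually_elim
    case (elim x)
    obtain n where "norm x < real n" using reals_Archimedean2 by blast
    then show ?case using elim by auto
  qed
qed

text \<open>Averaging over \<open>E\<close> turns the increment of a test function into a real function of the shift, to which
  the mean value theorem applies.\<close>

lemma test_function_shift_deriv:
  assumes \<phi>: "\<phi> \<in> Cc_infty \<Omega>" and E: "E \<in> lmeasurable"
  shows "((\<lambda>s. LINT x:E|lebesgue. \<phi> (x + s *\<^sub>R axis j 1)) has_field_derivative
    (LINT x:E|lebesgue. partial j \<phi> (x + s *\<^sub>R axis j 1))) (at s)"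
proof -
  let ?e = "axis j 1 :: R2"
  let ?h = "\<lambda>s. LINT x:E|lebesgue. \<phi> (x + s *\<^sub>R ?e)"
  obtain P where P: "P \<ge> 0" "\<And>x. \<bar>\<phi> x\<bar> \<le> P" "\<And>x. \<bar>partial j \<phi> x\<bar> \<le> P"
      "\<And>x t. \<bar>\<phi> (x + t *\<^sub>R ?e) - \<phi> x\<bar> \<le> P * \<bar>t\<bar>"
    using test_function_bound[OF \<phi>, of j] by metis
  have E': "E \<in> sets lebesgue" using E by (simp add: fmeasurable_def)
  have iE: "integrable lebesgue (\<lambda>x. P * indicator E x)"
    using E by (intro integrable_mult_right integrable_real_indicator) (auto simp: fmeasurable_def)
  have sh: "(\<lambda>x. f (x + c)) \<in> borel_measurable lebesgue" if "continuous_on UNIV f" for f :: "R2 \<Rightarrow> real" and c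
    by (rule measurable_compose[OF lebesgue_distr_translate(1) continuous_measurable_lebesgue[OF that]])
  note m\<phi> = sh[OF Cc_inftyD(2)[OF \<phi>]] and m\<phi>' = sh[OF Cc_inftyD(3)[OF \<phi>, of j]]
  have i\<phi>: "integrable lebesgue (\<lambda>x. indicator E x *\<^sub>R \<phi> (x + c))" for c
  proof (rule Bochner_Integration.integrable_bound[OF iE])
    show "(\<lambda>x. indicator E x *\<^sub>R \<phi> (x + c)) \<in> borel_measurable lebesgue"
      by (rule borel_measurable_scaleR[OF borel_measurable_indicator[OF E'] m\<phi>])
    show "AE x in lebesgue. norm (indicator E x *\<^sub>R \<phi> (x + c)) \<le> norm (P * indicator E x)"
      using P(1,2) by (intro AE_I2) (auto simp: indicator_def)
  qed
  have "((\<lambda>t. (?h (s + t) - ?h s) / t) \<longlongrightarrow> (LINT x:E|lebesgue. partial j \<phi> (x + s *\<^sub>R ?e))) (at 0)"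
    unfolding tendsto_at_iff_sequentially
  proof (intro allI impI)
    fix t :: "nat \<Rightarrow> real" assume t0: "\<forall>i. t i \<in> UNIV - {0}" and tl: "t \<longlonglongrightarrow> 0"
    have t0': "t n \<noteq> 0" for n using t0 by auto
    let ?q = "\<lambda>n x. indicator E x *\<^sub>R ((\<phi> (x + (s + t n) *\<^sub>R ?e) - \<phi> (x + s *\<^sub>R ?e)) / t n)"
    have eq: "(?h (s + t n) - ?h s) / t n = (LINT x|lebesgue. ?q n x)" for n
    proof -
      have "(LINT x|lebesgue. ?q n x) = (LINT x|lebesgue. (indicator E x *\<^sub>R \<phi> (x + (s + t n) *\<^sub>R ?e)
          - indicator E x *\<^sub>R \<phi> (x + s *\<^sub>R ?e)) / t n)"
        by (intro Bochner_Integration.integral_cong refl) (simp add: diff_divide_distrib right_diff_distrib)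
      also have "\<dots> = (?h (s + t n) - ?h s) / t n"
        unfolding set_lebesgue_integral_def
        using i\<phi>[of "(s + t n) *\<^sub>R ?e"] i\<phi>[of "s *\<^sub>R ?e"] by simp
      finally show ?thesis by (rule sym)
    qed
    have "(\<lambda>n. LINT x|lebesgue. ?q n x) \<longlonglongrightarrow>
        (LINT x|lebesgue. indicator E x *\<^sub>R partial j \<phi> (x + s *\<^sub>R ?e))"
    proof (rule integral_dominated_convergence[OF _ _ iE])
      show "(\<lambda>x. indicator E x *\<^sub>R partial j \<phi> (x + s *\<^sub>R ?e)) \<in> borel_measurable lebesgue"
        by (rule borel_measurable_scaleR[OF borel_measurable_indicator[OF E'] m\<phi>'])
      show "?q n \<in> borel_measurable lebesgue" for n
        by (intro borel_measurable_scaleR[OF borel_measurable_indicator[OF E']] borel_measurable_divide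
            borel_measurable_diff m\<phi> borel_measurable_const)
      show "AE x in lebesgue. (\<lambda>n. ?q n x) \<longlonglongrightarrow> indicator E x *\<^sub>R partial j \<phi> (x + s *\<^sub>R ?e)"
      proof (rule AE_I2)
        fix x
        obtain D where D: "(\<phi> has_derivative D) (at (x + s *\<^sub>R ?e))"
          using Cc_inftyD(1)[OF \<phi>] by (auto simp: differentiable_def)
        have "(\<lambda>n. (\<phi> (x + s *\<^sub>R ?e + t n *\<^sub>R ?e) - \<phi> (x + s *\<^sub>R ?e)) / t n) \<longlonglongrightarrow> D ?e"
          by (rule difference_quotient_tendsto[OF D tl t0'])
        then show "(\<lambda>n. ?q n x) \<longlonglongrightarrow> indicator E x *\<^sub>R partial j \<phi> (x + s *\<^sub>R ?e)"
          by (intro tendsto_scaleR tendsto_const) (simp add: partial_eqI[OF D] scaleR_add_left add.assoc)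
      qed
      show "AE x in lebesgue. norm (?q n x) \<le> P * indicator E x" for n
      proof (rule AE_I2)
        fix x
        have "\<bar>\<phi> (x + s *\<^sub>R ?e + t n *\<^sub>R ?e) - \<phi> (x + s *\<^sub>R ?e)\<bar> \<le> P * \<bar>t n\<bar>" by (rule P(4))
        then have "\<bar>(\<phi> (x + (s + t n) *\<^sub>R ?e) - \<phi> (x + s *\<^sub>R ?e)) / t n\<bar> \<le> P"
          using t0'[of n] by (simp add: abs_divide divide_le_eq scaleR_add_left add.assoc)
        then show "norm (?q n x) \<le> P * indicator E x" by (simp add: indicator_def)
      qed
    qed
    then show "((\<lambda>t. (?h (s + t) - ?h s) / t) \<circ> t) \<longlonglongrightarrow> (LINT x:E|lebesgue. partial j \<phi> (x + s *\<^sub>R ?e))"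
      unfolding comp_def eq unfolding set_lebesgue_integral_def .
  qed
  then show ?thesis by (simp add: DERIV_def)
qed


text \<open>Test functions converging to \<open>f\<close> in \<open>H\<^sup>1\<close> satisfy the mean value inequality after averaging over
  any set \<open>E\<close> of finite measure; in the limit the averages of the increments of the zero extension
  of \<open>f\<close> are controlled by the bound for its weak derivative.\<close>

lemma H1_0_increment_bound:
  assumes \<Omega>: "open \<Omega>" "bounded \<Omega>" and f: "f \<in> H1_0 \<Omega>"
    and L: "AE x in lebesgue_on \<Omega>. \<bar>weak_partial \<Omega> j f x\<bar> \<le> L" "L \<ge> 0"
  defines "F \<equiv> \<lambda>x. indicator \<Omega> x * f x"
  shows "AE x in lebesgue. \<bar>F (x + t *\<^sub>R axis j 1) - F x\<bar> \<le> L * \<bar>t\<bar>"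
proof -
  let ?e = "axis j 1 :: R2"
  define G where "G x = indicator \<Omega> x * weak_partial \<Omega> j f x" for x
  obtain \<phi> where \<phi>: "\<And>n::nat. \<phi> n \<in> Cc_infty \<Omega>"
    "(\<lambda>n. ip \<Omega> (\<lambda>x. f x - \<phi> n x) (\<lambda>x. f x - \<phi> n x)) \<longlonglongrightarrow> 0"
    "\<And>j. (\<lambda>n. ip \<Omega> (\<lambda>x. weak_partial \<Omega> j f x - partial j (\<phi> n) x)
       (\<lambda>x. weak_partial \<Omega> j f x - partial j (\<phi> n) x)) \<longlonglongrightarrow> 0"
    by (rule H1_0_approximation[OF \<Omega> f]) (rule that; assumption)
  have H: "f \<in> H1 \<Omega>" using f by (auto simp: H1_0_def)
  have out: "\<phi> n x = 0" "partial j (\<phi> n) x = 0" if "x \<notin> \<Omega>" for n x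
  proof -
    have *: "x \<notin> closure {x. \<phi> n x \<noteq> 0}" using Cc_inftyD(5)[OF \<phi>(1)[of n]] that by auto
    show "\<phi> n x = 0" "partial j (\<phi> n) x = 0"
      by (rule Cc_inftyD(6)[OF \<phi>(1) *], rule Cc_inftyD(7)[OF \<phi>(1) *])
  qed
  have ext: "(\<lambda>x. indicator \<Omega> x * u x - v x) \<in> borel_measurable lebesgue"
    "integrable lebesgue (\<lambda>x. (indicator \<Omega> x * u x - v x)\<^sup>2)"
    "(LINT x|lebesgue. (indicator \<Omega> x * u x - v x)\<^sup>2) = ip \<Omega> (\<lambda>x. u x - v x) (\<lambda>x. u x - v x)"
    if u: "u \<in> L2 \<Omega>" and v: "v \<in> L2 \<Omega>" and v0: "\<And>x. x \<notin> \<Omega> \<Longrightarrow> v x = 0" for u v :: "R2 \<Rightarrow> real"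
  proof -
    have uv: "(\<lambda>x. u x - v x) \<in> L2 \<Omega>" using L2_lincomb(1)[OF v u, of "-1"] by simp
    have eq: "indicator \<Omega> x * u x - v x = indicator \<Omega> x *\<^sub>R (u x - v x)" for x
      using v0[of x] by (auto simp: indicator_def)
    have eq2: "(indicator \<Omega> x * u x - v x)\<^sup>2 = indicator \<Omega> x *\<^sub>R (norm (u x - v x))\<^sup>2" for x
      unfolding eq by (simp add: indicator_def)
    show "(\<lambda>x. indicator \<Omega> x * u x - v x) \<in> borel_measurable lebesgue"
      unfolding eq using uv \<Omega>(1) by (subst borel_measurable_restrict_space_iff[symmetric]) (auto simp: L2_def)
    show "integrable lebesgue (\<lambda>x. (indicator \<Omega> x * u x - v x)\<^sup>2)"
      unfolding eq2 using uv \<Omega>(1) by (subst integrable_restrict_space[symmetric]) (auto simp: L2_def)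
    show "(LINT x|lebesgue. (indicator \<Omega> x * u x - v x)\<^sup>2) = ip \<Omega> (\<lambda>x. u x - v x) (\<lambda>x. u x - v x)"
      unfolding eq2 using \<Omega>(1)
      by (subst integral_restrict_space[symmetric]) (auto simp: ip_def power2_eq_square)
  qed
  have fL: "f \<in> L2 \<Omega>" using H by (simp add: H1_def)
  have ext1: "(\<lambda>x. F x - \<phi> n x) \<in> borel_measurable lebesgue"
    "integrable lebesgue (\<lambda>x. (F x - \<phi> n x)\<^sup>2)"
    "(LINT x|lebesgue. (F x - \<phi> n x)\<^sup>2) = ip \<Omega> (\<lambda>x. f x - \<phi> n x) (\<lambda>x. f x - \<phi> n x)" for n
    unfolding F_def by (rule ext[OF fL test_function_L2(1)[OF \<Omega> \<phi>(1)] out(1)]; assumption)+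
  have ext2: "(\<lambda>x. G x - partial j (\<phi> n) x) \<in> borel_measurable lebesgue"
    "integrable lebesgue (\<lambda>x. (G x - partial j (\<phi> n) x)\<^sup>2)"
    "(LINT x|lebesgue. (G x - partial j (\<phi> n) x)\<^sup>2) =
      ip \<Omega> (\<lambda>x. weak_partial \<Omega> j f x - partial j (\<phi> n) x) (\<lambda>x. weak_partial \<Omega> j f x - partial j (\<phi> n) x)" for n
    unfolding G_def by (rule ext[OF H1_weak_partial(2)[OF \<Omega>(1) H] test_function_L2(2)[OF \<Omega> \<phi>(1)] out(2)]; assumption)+
  have z: "(\<lambda>x. 0) \<in> L2 \<Omega>" by (simp add: L2_def)
  have extF: "F \<in> borel_measurable lebesgue" "integrable lebesgue (\<lambda>x. (F x)\<^sup>2)"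
    using ext(1,2)[OF fL z] by (simp_all add: F_def)
  have G: "AE x in lebesgue. \<bar>G x\<bar> \<le> L"
  proof -
    have "AE x in lebesgue. x \<in> \<Omega> \<longrightarrow> \<bar>weak_partial \<Omega> j f x\<bar> \<le> L"
      using L(1) \<Omega>(1) by (simp add: AE_lebesgue_on_iff)
    then show ?thesis by eventually_elim (use L(2) in \<open>auto simp: G_def indicator_def\<close>)
  qed
  have key: "\<bar>LINT x:E|lebesgue. F (x + t *\<^sub>R ?e) - F x\<bar> \<le> L * \<bar>t\<bar> * measure lebesgue E"
    if E: "E \<in> lmeasurable" for E
  proof -
    let ?m = "measure lebesgue E"
    have siF: "set_integrable lebesgue E (\<lambda>x. F (x + c))" for c
      by (rule shift_integral_bound(1)[OF extF E zero_less_one])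
    have E': "E \<in> sets lebesgue" using E by (simp add: fmeasurable_def)
    define \<alpha> where "\<alpha> n = (LINT x|lebesgue. (F x - \<phi> n x)\<^sup>2)" for n
    define \<beta> where "\<beta> n = (LINT x|lebesgue. (G x - partial j (\<phi> n) x)\<^sup>2)" for n
    have \<alpha>: "\<alpha> \<longlonglongrightarrow> 0" and \<beta>: "\<beta> \<longlonglongrightarrow> 0"
      unfolding \<alpha>_def \<beta>_def ext1(3) ext2(3) by (rule \<phi>(2), rule \<phi>(3))
    have bound: "\<bar>LINT x:E|lebesgue. F (x + t *\<^sub>R ?e) - F x\<bar>
        \<le> (\<eta> * ?m + \<beta> n / \<eta> + L * ?m) * \<bar>t\<bar> + 2 * (\<eta> * ?m + \<alpha> n / \<eta>)" if \<eta>: "\<eta> > 0" for \<eta> n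
    proof -
      note b1 = shift_integral_bound[OF ext1(1,2)[of n] E \<eta>]
      note b2 = shift_integral_bound[OF ext2(1,2)[of n] E \<eta>]
      have si\<phi>: "set_integrable lebesgue E (\<lambda>x. \<phi> n (x + c))" for c
        using set_integral_diff(1)[OF siF[of c] b1(1)[of c]] by simp
      have d1: "\<bar>(LINT x:E|lebesgue. F (x + c)) - (LINT x:E|lebesgue. \<phi> n (x + c))\<bar> \<le> \<eta> * ?m + \<alpha> n / \<eta>" for c
      proof -
        have "(LINT x:E|lebesgue. F (x + c)) - (LINT x:E|lebesgue. \<phi> n (x + c))
            = (LINT x:E|lebesgue. F (x + c) - \<phi> n (x + c))"
          by (rule set_integral_diff(2)[symmetric, OF siF si\<phi>])
        also have "\<bar>\<dots>\<bar> \<le> (LINT x:E|lebesgue. \<bar>F (x + c) - \<phi> n (x + c)\<bar>)"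
          using set_integral_norm_bound[OF b1(1)[of c]] by simp
        also have "\<dots> \<le> \<eta> * ?m + \<alpha> n / \<eta>" unfolding \<alpha>_def by (rule b1(2))
        finally show ?thesis .
      qed
      have d2: "\<bar>LINT x:E|lebesgue. partial j (\<phi> n) (x + s *\<^sub>R ?e)\<bar> \<le> \<eta> * ?m + \<beta> n / \<eta> + L * ?m" for s
      proof -
        let ?c = "s *\<^sub>R ?e"
        have iL: "set_integrable lebesgue E (\<lambda>x. L)"
          unfolding set_integrable_def using E
          by (intro integrable_scaleR_left) (auto simp: fmeasurable_def integrable_indicator_iff)
        have p: "(\<lambda>x. partial j (\<phi> n) (x + ?c)) \<in> borel_measurable lebesgue"
          by (rule measurable_compose[OF lebesgue_distr_translate(1) continuous_measurable_lebesgue[OF Cc_inftyD(3)[OF \<phi>(1)]]])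
        have ab: "set_integrable lebesgue E (\<lambda>x. \<bar>G (x + ?c) - partial j (\<phi> n) (x + ?c)\<bar> + L)"
          by (rule set_integral_add(1)[OF set_integrable_abs[OF b2(1)] iL])
        have ae: "AE x in lebesgue. \<bar>indicator E x *\<^sub>R partial j (\<phi> n) (x + ?c)\<bar>
            \<le> indicator E x *\<^sub>R (\<bar>G (x + ?c) - partial j (\<phi> n) (x + ?c)\<bar> + L)"
          using AE_translate[OF G, of ?c] by eventually_elim (auto simp: indicator_def)
        have "integrable lebesgue (\<lambda>x. indicator E x *\<^sub>R partial j (\<phi> n) (x + ?c))"
        proof (rule Bochner_Integration.integrable_bound[OF ab[unfolded set_integrable_def]])
          show "(\<lambda>x. indicator E x *\<^sub>R partial j (\<phi> n) (x + ?c)) \<in> borel_measurable lebesgue"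
            by (rule borel_measurable_scaleR[OF borel_measurable_indicator[OF E'] p])
          show "AE x in lebesgue. norm (indicator E x *\<^sub>R partial j (\<phi> n) (x + ?c))
            \<le> norm (indicator E x *\<^sub>R (\<bar>G (x + ?c) - partial j (\<phi> n) (x + ?c)\<bar> + L))"
            using ae
          proof eventually_elim
            case (elim x)
            show ?case unfolding real_norm_def by (rule order_trans[OF elim abs_ge_self])
          qed
        qed
        then have ip: "integrable lebesgue (\<lambda>x. \<bar>indicator E x *\<^sub>R partial j (\<phi> n) (x + ?c)\<bar>)"
          by (rule integrable_abs)
        have "\<bar>LINT x:E|lebesgue. partial j (\<phi> n) (x + ?c)\<bar>
            \<le> (LINT x|lebesgue. \<bar>indicator E x *\<^sub>R partial j (\<phi> n) (x + ?c)\<bar>)"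
          unfolding set_lebesgue_integral_def by (rule integral_abs_bound)
        also have "\<dots> \<le> (LINT x:E|lebesgue. \<bar>G (x + ?c) - partial j (\<phi> n) (x + ?c)\<bar> + L)"
          unfolding set_lebesgue_integral_def
          by (rule integral_mono_AE[OF ip ab[unfolded set_integrable_def] ae])
        also have "\<dots> = (LINT x:E|lebesgue. \<bar>G (x + ?c) - partial j (\<phi> n) (x + ?c)\<bar>) + (LINT x:E|lebesgue. L)"
          by (rule set_integral_add(2)[OF set_integrable_abs[OF b2(1)] iL])
        also have "(LINT x:E|lebesgue. L) = L * ?m"
          using E' by (simp add: set_lebesgue_integral_def)
        also have "(LINT x:E|lebesgue. \<bar>G (x + ?c) - partial j (\<phi> n) (x + ?c)\<bar>) \<le> \<eta> * ?m + \<beta> n / \<eta>"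
          unfolding \<beta>_def by (rule b2(2))
        finally show ?thesis by simp
      qed
      have "norm ((LINT x:E|lebesgue. \<phi> n (x + t *\<^sub>R ?e)) - (LINT x:E|lebesgue. \<phi> n (x + 0 *\<^sub>R ?e)))
          \<le> (\<eta> * ?m + \<beta> n / \<eta> + L * ?m) * norm (t - 0)"
        by (rule field_differentiable_bound[of UNIV "\<lambda>s. LINT x:E|lebesgue. \<phi> n (x + s *\<^sub>R ?e)"])
          (use test_function_shift_deriv[OF \<phi>(1) E, of n j] d2 in auto)
      moreover have "(LINT x:E|lebesgue. F (x + t *\<^sub>R ?e) - F x)
          = (LINT x:E|lebesgue. F (x + t *\<^sub>R ?e)) - (LINT x:E|lebesgue. F (x + 0))"
        using set_integral_diff(2)[OF siF[of "t *\<^sub>R ?e"] siF[of 0]] by simp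
      ultimately show ?thesis using d1[of "t *\<^sub>R ?e"] d1[of 0] by simp
    qed
    have bound': "\<bar>LINT x:E|lebesgue. F (x + t *\<^sub>R ?e) - F x\<bar>
        \<le> (\<eta> * ?m + L * ?m) * \<bar>t\<bar> + 2 * (\<eta> * ?m)" if \<eta>: "\<eta> > 0" for \<eta>
    proof (rule LIMSEQ_le_const)
      have "(\<lambda>n. (\<eta> * ?m + \<beta> n / \<eta> + L * ?m) * \<bar>t\<bar> + 2 * (\<eta> * ?m + \<alpha> n / \<eta>))
          \<longlonglongrightarrow> (\<eta> * ?m + 0 / \<eta> + L * ?m) * \<bar>t\<bar> + 2 * (\<eta> * ?m + 0 / \<eta>)"
        using \<eta> by (intro tendsto_intros \<alpha> \<beta>) auto
      then show "(\<lambda>n. (\<eta> * ?m + \<beta> n / \<eta> + L * ?m) * \<bar>t\<bar> + 2 * (\<eta> * ?m + \<alpha> n / \<eta>))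
          \<longlonglongrightarrow> (\<eta> * ?m + L * ?m) * \<bar>t\<bar> + 2 * (\<eta> * ?m)" by simp
      show "\<exists>N. \<forall>n\<ge>N. \<bar>LINT x:E|lebesgue. F (x + t *\<^sub>R ?e) - F x\<bar>
          \<le> (\<eta> * ?m + \<beta> n / \<eta> + L * ?m) * \<bar>t\<bar> + 2 * (\<eta> * ?m + \<alpha> n / \<eta>)"
        using bound[OF \<eta>] by blast
    qed
    show ?thesis
    proof (rule field_le_epsilon)
      fix \<epsilon> :: real assume \<epsilon>: "\<epsilon> > 0"
      define K where "K = ?m * \<bar>t\<bar> + 2 * ?m + 1"
      have K: "K > 0" unfolding K_def by (intro add_nonneg_pos add_nonneg_nonneg) auto
      have "(\<epsilon> / K) * (?m * \<bar>t\<bar> + 2 * ?m) \<le> (\<epsilon> / K) * K"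
        using \<epsilon> K by (intro mult_left_mono) (auto simp: K_def)
      also have "\<dots> = \<epsilon>" using K by simp
      finally have "(\<epsilon> / K) * (?m * \<bar>t\<bar> + 2 * ?m) \<le> \<epsilon>" .
      moreover have "\<bar>LINT x:E|lebesgue. F (x + t *\<^sub>R ?e) - F x\<bar>
          \<le> L * \<bar>t\<bar> * ?m + (\<epsilon> / K) * (?m * \<bar>t\<bar> + 2 * ?m)"
        using bound'[of "\<epsilon> / K"] \<epsilon> K by (simp add: algebra_simps)
      ultimately show "\<bar>LINT x:E|lebesgue. F (x + t *\<^sub>R ?e) - F x\<bar> \<le> L * \<bar>t\<bar> * ?m + \<epsilon>"
        by linarith
    qed
  qed
  have mF: "(\<lambda>x. F (x + c)) \<in> borel_measurable lebesgue" for c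
    by (rule measurable_compose[OF lebesgue_distr_translate(1) extF(1)])
  have mD: "(\<lambda>x. F (x + t *\<^sub>R ?e) - F x) \<in> borel_measurable lebesgue"
    by (rule borel_measurable_diff[OF mF extF(1)])
  have iD: "set_integrable lebesgue E (\<lambda>x. F (x + t *\<^sub>R ?e) - F x)" if "E \<in> lmeasurable" for E
    using set_integral_diff(1)[OF shift_integral_bound(1)[OF extF that zero_less_one, of "t *\<^sub>R ?e"]
      shift_integral_bound(1)[OF extF that zero_less_one, of 0]] by simp
  have "AE x in lebesgue. F (x + t *\<^sub>R ?e) - F x \<le> L * \<bar>t\<bar>"
    by (rule AE_le_if_set_integrals_le[OF mD iD]) (use key in \<open>auto simp: abs_le_iff\<close>)
  moreover have "AE x in lebesgue. - (F (x + t *\<^sub>R ?e) - F x) \<le> L * \<bar>t\<bar>"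
  proof (rule AE_le_if_set_integrals_le)
    show "(\<lambda>x. - (F (x + t *\<^sub>R ?e) - F x)) \<in> borel_measurable lebesgue"
      by (rule borel_measurable_uminus[OF mD])
    show "set_integrable lebesgue E (\<lambda>x. - (F (x + t *\<^sub>R ?e) - F x))" if "E \<in> lmeasurable" for E
      using iD[OF that] unfolding set_integrable_def scaleR_minus_right by (rule integrable_minus)
    show "(LINT x:E|lebesgue. - (F (x + t *\<^sub>R ?e) - F x)) \<le> L * \<bar>t\<bar> * measure lebesgue E" if E: "E \<in> lmeasurable" for E
    proof -
      have "(LINT x:E|lebesgue. - (F (x + t *\<^sub>R ?e) - F x)) = - (LINT x:E|lebesgue. F (x + t *\<^sub>R ?e) - F x)"
        unfolding set_lebesgue_integral_def scaleR_minus_right by (rule Bochner_Integration.integral_minus)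
      then show ?thesis using key[OF E] by linarith
    qed
  qed
  ultimately show ?thesis by eventually_elim linarith
qed


text \<open>The increment bound is applied with rational increments only, so that countably many null sets have
  to be avoided. They still approximate every exterior point, and the zero extension vanishes near it.\<close>

lemma W1inf_0_boundary_bound:
  assumes \<Omega>: "open \<Omega>" "bounded \<Omega>" and f: "f \<in> W1inf_0 \<Omega>"
    and L: "\<And>j. AE x in lebesgue_on \<Omega>. \<bar>weak_partial \<Omega> j f x\<bar> \<le> L" "L \<ge> 0"
  shows "AE x in lebesgue_on \<Omega>. \<forall>y. y \<notin> closure \<Omega> \<longrightarrow> \<bar>f x\<bar> \<le> L * (\<bar>y$1 - x$1\<bar> + \<bar>y$2 - x$2\<bar>)"
proof -
  define F where "F x = indicator \<Omega> x * f x" for x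
  have f0: "f \<in> H1_0 \<Omega>" using f by (simp add: W1inf_0_def)
  have inc: "AE x in lebesgue. \<bar>F (x + t *\<^sub>R axis j 1) - F x\<bar> \<le> L * \<bar>t\<bar>" for t j
    unfolding F_def by (rule H1_0_increment_bound[OF \<Omega> f0 L])
  have step: "AE x in lebesgue. \<bar>F (x + r *\<^sub>R axis 1 1 + s *\<^sub>R axis 2 1) - F x\<bar> \<le> L * (\<bar>r\<bar> + \<bar>s\<bar>)" for r s
    using inc[of r 1] AE_translate[OF inc[of s 2], of "r *\<^sub>R axis 1 1"]
  proof eventually_elim
    case (elim x)
    then show ?case unfolding distrib_left by linarith
  qed
  have "AE x in lebesgue. \<forall>p::rat \<times> rat.
      \<bar>F (x + of_rat (fst p) *\<^sub>R axis 1 1 + of_rat (snd p) *\<^sub>R axis 2 1) - F x\<bar>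
        \<le> L * (\<bar>of_rat (fst p)\<bar> + \<bar>of_rat (snd p)\<bar>)"
    by (intro AE_all_countable[THEN iffD2] allI step)
  then have "AE x in lebesgue. x \<in> \<Omega> \<longrightarrow>
      (\<forall>y. y \<notin> closure \<Omega> \<longrightarrow> \<bar>f x\<bar> \<le> L * (\<bar>y$1 - x$1\<bar> + \<bar>y$2 - x$2\<bar>))"
  proof eventually_elim
    case (elim x)
    have H: "\<bar>F (x + of_rat a *\<^sub>R axis 1 1 + of_rat b *\<^sub>R axis 2 1) - F x\<bar> \<le> L * (\<bar>of_rat a\<bar> + \<bar>of_rat b\<bar>)" for a b
      using elim[rule_format, of "(a, b)"] by simp
    show ?case
    proof (intro impI allI)
      fix y assume x: "x \<in> \<Omega>" and y: "y \<notin> closure \<Omega>"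
      have "open (- closure \<Omega>)" by auto
      then obtain e where e: "e > 0" "ball y e \<subseteq> - closure \<Omega>" using y openE by blast
      show "\<bar>f x\<bar> \<le> L * (\<bar>y$1 - x$1\<bar> + \<bar>y$2 - x$2\<bar>)"
      proof (rule field_le_epsilon)
        fix \<delta> :: real assume \<delta>: "\<delta> > 0"
        define d where "d = min (e/2) (\<delta> / (2 * (L + 1)))"
        have "d > 0" unfolding d_def using e \<delta> L(2) by simp
        moreover have "d \<le> e/2" "d \<le> \<delta> / (2 * (L + 1))"
          unfolding d_def by (rule min.cobounded1, rule min.cobounded2)
        ultimately have d: "d > 0" "d \<le> e/2" "d \<le> \<delta> / (2 * (L + 1))" by auto
        have "L * (2 * d) \<le> (L + 1) * (2 * (\<delta> / (2 * (L + 1))))"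
          using L(2) d by (intro mult_mono) auto
        also have "\<dots> = \<delta>"
        proof -
          have "M * (2 * (\<delta> / (2 * M))) = \<delta>" if "M \<noteq> 0" for M using that by simp
          from this[of "L + 1"] L(2) show ?thesis by linarith
        qed
        finally have Ld: "L * (2 * d) \<le> \<delta>" .
        obtain a :: rat where a: "y$1 - x$1 - d < of_rat a" "of_rat a < y$1 - x$1 + d"
          using of_rat_dense[of "y$1 - x$1 - d" "y$1 - x$1 + d"] d by auto
        obtain b :: rat where b: "y$2 - x$2 - d < of_rat b" "of_rat b < y$2 - x$2 + d"
          using of_rat_dense[of "y$2 - x$2 - d" "y$2 - x$2 + d"] d by auto
        let ?z = "x + of_rat a *\<^sub>R axis 1 1 + of_rat b *\<^sub>R axis 2 1"
        have z1: "?z $ 1 = x $ 1 + of_rat a" "?z $ 2 = x $ 2 + of_rat b"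
          by (simp_all add: axis_def)
        have "norm (?z - y) \<le> \<bar>(?z - y) $ 1\<bar> + \<bar>(?z - y) $ 2\<bar>"
          using norm_le_l1_cart[of "?z - y"] by (simp add: sum_2)
        also have "\<dots> < e" using a b d unfolding vector_minus_component z1 by linarith
        finally have "?z \<in> ball y e" by (simp add: dist_norm norm_minus_commute)
        then have "?z \<notin> \<Omega>" using e(2) closure_subset[of \<Omega>] by auto
        then have "F ?z = 0" by (simp add: F_def)
        moreover have "F x = f x" using x by (simp add: F_def)
        ultimately have "\<bar>f x\<bar> \<le> L * (\<bar>of_rat a\<bar> + \<bar>of_rat b\<bar>)" using H[of a b] by simp
        also have "\<dots> \<le> L * (\<bar>y$1 - x$1\<bar> + \<bar>y$2 - x$2\<bar> + 2 * d)"
        proof (rule mult_left_mono[OF _ L(2)])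
          have near: "\<bar>u\<bar> \<le> \<bar>v\<bar> + d" if "v - d < u" "u < v + d" for u v :: real
            using that by linarith
          show "\<bar>of_rat a\<bar> + \<bar>of_rat b\<bar> \<le> \<bar>y$1 - x$1\<bar> + \<bar>y$2 - x$2\<bar> + 2 * d"
            using near[OF a] near[OF b] by linarith
        qed
        also have "\<dots> \<le> L * (\<bar>y$1 - x$1\<bar> + \<bar>y$2 - x$2\<bar>) + \<delta>"
          using Ld by (simp add: distrib_left)
        finally show "\<bar>f x\<bar> \<le> L * (\<bar>y$1 - x$1\<bar> + \<bar>y$2 - x$2\<bar>) + \<delta>" .
      qed
    qed
  qed
  then show ?thesis using \<Omega>(1) by (simp add: AE_lebesgue_on_iff)
qed

text \<open>By the time-step restriction the displacement of a point is at most half its \<open>\<ell>\<^sup>1\<close> distance to any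
  exterior point, so the image of the point cannot be exterior.\<close>

lemma X1_in_closure:
  assumes \<Omega>: "open \<Omega>" "bounded \<Omega>" and w: "w \<in> C_W1inf_0 Tf \<Omega>"
    and dt: "\<Delta>t > 0" and cfl: "ereal \<Delta>t * C_W1inf_seminorm Tf \<Omega> w \<le> ereal (1/4)"
    and t: "real n * \<Delta>t \<in> {0..Tf}"
  shows "AE x in lebesgue_on \<Omega>. X1 w \<Delta>t n x \<in> closure \<Omega>"
proof -
  let ?w = "w (real n * \<Delta>t)"
  define L where "L = 1 / (4 * \<Delta>t)"
  have L0: "L \<ge> 0" using dt by (simp add: L_def)
  have wi: "(\<lambda>x. ?w x $ i) \<in> W1inf_0 \<Omega>" for i
    using w t unfolding C_W1inf_0_def by auto
  have sem: "C_W1inf_seminorm Tf \<Omega> w \<le> ereal L"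
  proof (cases "C_W1inf_seminorm Tf \<Omega> w")
    case (real r)
    then have "\<Delta>t * r \<le> 1/4" using cfl by simp
    then show ?thesis using dt real by (simp add: L_def field_simps)
  qed (use cfl dt in auto)
  have Linf: "AE x in lebesgue_on \<Omega>. \<bar>weak_partial \<Omega> j (\<lambda>x. ?w x $ i) x\<bar> \<le> L" for i j
  proof -
    have "Linf_norm \<Omega> (weak_partial \<Omega> j (\<lambda>x. ?w x $ i)) \<le> W1inf_seminorm \<Omega> ?w"
      unfolding W1inf_seminorm_def by (rule SUP_upper2[of i], simp, rule SUP_upper, simp)
    also have "\<dots> \<le> C_W1inf_seminorm Tf \<Omega> w"
      unfolding C_W1inf_seminorm_def using t by (rule SUP_upper)
    finally have le: "Linf_norm \<Omega> (weak_partial \<Omega> j (\<lambda>x. ?w x $ i)) \<le> ereal L" using sem by simp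
    have "AE x in lebesgue_on \<Omega>. ereal \<bar>weak_partial \<Omega> j (\<lambda>x. ?w x $ i) x\<bar>
        \<le> Linf_norm \<Omega> (weak_partial \<Omega> j (\<lambda>x. ?w x $ i))"
      unfolding Linf_norm_def by (rule esssup_AE)
    then show ?thesis
    proof eventually_elim
      case (elim x)
      from order_trans[OF this le] show ?case by simp
    qed
  qed
  have "AE x in lebesgue_on \<Omega>. x \<in> \<Omega>" by (rule AE_I2) simp
  with W1inf_0_boundary_bound[OF \<Omega> wi Linf L0, of 1] W1inf_0_boundary_bound[OF \<Omega> wi Linf L0, of 2]
  show ?thesis
  proof eventually_elim
    case (elim x)
    show ?case
    proof (rule ccontr)
      assume y: "X1 w \<Delta>t n x \<notin> closure \<Omega>"
      have d: "\<bar>X1 w \<Delta>t n x $ i - x $ i\<bar> = \<Delta>t * \<bar>?w x $ i\<bar>" for i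
        using dt by (simp add: X1_def abs_mult)
      have "\<bar>?w x $ i\<bar> \<le> L * (\<Delta>t * \<bar>?w x $ 1\<bar> + \<Delta>t * \<bar>?w x $ 2\<bar>)" if "i = 1 \<or> i = 2" for i
        using elim(1,2) y that unfolding d[symmetric] by auto
      moreover have "L * (\<Delta>t * a + \<Delta>t * b) = (a + b) / 4" for a b
        using dt by (simp add: L_def field_simps)
      ultimately have "\<bar>?w x $ 1\<bar> \<le> (\<bar>?w x $ 1\<bar> + \<bar>?w x $ 2\<bar>) / 4" "\<bar>?w x $ 2\<bar> \<le> (\<bar>?w x $ 1\<bar> + \<bar>?w x $ 2\<bar>) / 4"
        by auto
      moreover have "a \<le> (a + b) / 4 \<Longrightarrow> b \<le> (a + b) / 4 \<Longrightarrow> a + b \<le> 0" for a b :: real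
        by (simp add: le_divide_eq)
      ultimately have "\<bar>?w x $ 1\<bar> + \<bar>?w x $ 2\<bar> \<le> 0" by blast
      moreover have "\<bar>a\<bar> + \<bar>b\<bar> \<le> 0 \<Longrightarrow> a = 0 \<and> b = 0" for a b :: real by linarith
      ultimately have "?w x $ 1 = 0 \<and> ?w x $ 2 = 0" by blast
      then have "?w x = 0" by (simp add: vec_eq_iff forall_2)
      then have "X1 w \<Delta>t n x = x" by (simp add: X1_def)
      then show False using y elim(3) closure_subset by auto
    qed
  qed
qed

section \<open>Zeros of coercive maps in coordinates\<close>

text \<open>Bolzano-Weierstrass one coordinate at a time.\<close>

lemma bounded_coordinates_subsequence:
  fixes X :: "nat \<Rightarrow> nat \<Rightarrow> real"
  assumes "\<And>m i. i < n \<Longrightarrow> \<bar>X m i\<bar> \<le> R"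
  shows "\<exists>r x. strict_mono r \<and> (\<forall>i<n. (\<lambda>m. X (r m) i) \<longlonglongrightarrow> x i)"
  using assms
proof (induction n)
  case 0
  show ?case by (rule exI[of _ id]) (simp add: strict_mono_def)
next
  case (Suc n)
  then obtain r x where r: "strict_mono r" "\<And>i. i < n \<Longrightarrow> (\<lambda>m. X (r m) i) \<longlonglongrightarrow> x i"
    by (metis less_SucI)
  have "bounded (range (\<lambda>m. X (r m) n))"
    using Suc.prems by (auto simp: bounded_iff)
  then obtain l s where s: "strict_mono s" "((\<lambda>m. X (r m) n) \<circ> s) \<longlonglongrightarrow> l"
    using bounded_imp_convergent_subsequence by blast
  have "strict_mono (r \<circ> s)" using r(1) s(1) by (rule strict_mono_o)
  moreover have "(\<lambda>m. X ((r \<circ> s) m) i) \<longlonglongrightarrow> (x(n := l)) i" if "i < Suc n" for i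
  proof (cases "i = n")
    case True
    then show ?thesis using s(2) by (simp add: comp_def)
  next
    case False
    then have "i < n" using that by simp
    from LIMSEQ_subseq_LIMSEQ[OF r(2)[OF this] s(1)] show ?thesis using False by (simp add: comp_def)
  qed
  ultimately show ?case by blast
qed

text \<open>The Poincare-Miranda theorem, from Kuhn's combinatorial lemma. The dimension is a number and
  not a type, since it is the dimension of a finite element space that depends on the mesh.\<close>

lemma poincare_miranda:
  fixes F :: "(nat \<Rightarrow> real) \<Rightarrow> nat \<Rightarrow> real"
  assumes R: "R > 0"
    and cont: "\<And>X x i. (\<And>j. j < n \<Longrightarrow> (\<lambda>m. X m j) \<longlonglongrightarrow> x j) \<Longrightarrow> i < n \<Longrightarrow> (\<lambda>m::nat. F (X m) i) \<longlonglongrightarrow> F x i"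
    and lo: "\<And>x i. (\<And>j. j < n \<Longrightarrow> \<bar>x j\<bar> \<le> R) \<Longrightarrow> i < n \<Longrightarrow> x i = - R \<Longrightarrow> F x i \<le> 0"
    and hi: "\<And>x i. (\<And>j. j < n \<Longrightarrow> \<bar>x j\<bar> \<le> R) \<Longrightarrow> i < n \<Longrightarrow> x i = R \<Longrightarrow> F x i \<ge> 0"
  shows "\<exists>x. \<forall>i<n. F x i = 0"
proof -
  define P where "P m q i = - R + 2 * R * (real (q i) / real (Suc m))" for m :: nat and q :: "nat \<Rightarrow> nat" and i :: nat
  have Pbd: "\<bar>P m q i\<bar> \<le> R" if "q i \<le> Suc m" for m q i
  proof -
    have "real (q i) / real (Suc m) \<le> 1" "0 \<le> real (q i) / real (Suc m)"
      using that by (auto simp: divide_le_eq)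
    moreover have "\<bar>- R + 2 * R * t\<bar> \<le> R" if "t \<le> 1" "0 \<le> t" for t
    proof -
      have "0 \<le> 2 * R * t" using that R by simp
      moreover have "2 * R * t \<le> 2 * R * 1" using that R by (intro mult_left_mono) auto
      ultimately show ?thesis by linarith
    qed
    ultimately show ?thesis unfolding P_def by blast
  qed
  define Good where "Good m q r s \<longleftrightarrow> (\<forall>i<n. q i \<le> Suc m \<and> (\<forall>j<n. r i j \<le> Suc m \<and> s i j \<le> Suc m \<and>
      \<bar>P m (r i) j - P m q j\<bar> \<le> 2 * R / real (Suc m) \<and> \<bar>P m (s i) j - P m q j\<bar> \<le> 2 * R / real (Suc m)) \<and>
      F (P m (r i)) i \<le> 0 \<and> F (P m (s i)) i \<ge> 0)" for m q r s
  have "\<exists>q r s. Good m q r s" for m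
  proof -
    define label :: "(nat \<Rightarrow> nat) \<Rightarrow> nat \<Rightarrow> nat" where
      "label q i = (if q i = 0 then 0 else if q i = Suc m then 1 else if F (P m q) i \<le> 0 then 0 else 1)" for q i
    have lab: "F (P m q) i \<le> 0" if "\<forall>j<n. q j \<le> Suc m" "i < n" "label q i = 0" for q i
    proof (cases "q i = 0")
      case True
      then have "P m q i = - R" by (simp add: P_def)
      then show ?thesis using that Pbd by (intro lo) auto
    qed (use that in \<open>auto simp: label_def split: if_splits\<close>)
    have lab1: "F (P m q) i \<ge> 0" if "\<forall>j<n. q j \<le> Suc m" "i < n" "label q i = 1" for q i
    proof (cases "q i = Suc m")
      case True
      then have "P m q i = R" by (simp add: P_def)
      then show ?thesis using that Pbd by (intro hi) auto
    qed (use that in \<open>auto simp: label_def split: if_splits\<close>)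
    obtain q where q: "\<forall>i<n. q i < Suc m"
      "\<forall>i<n. \<exists>r s. (\<forall>j<n. q j \<le> r j \<and> r j \<le> q j + 1) \<and> (\<forall>j<n. q j \<le> s j \<and> s j \<le> q j + 1) \<and> label r i \<noteq> label s i"
      by (rule kuhn_lemma[of "Suc m" n label]) (auto simp: label_def)
    have near: "\<bar>P m r j - P m q j\<bar> \<le> 2 * R / real (Suc m)" if "q j \<le> r j" "r j \<le> q j + 1" for r j
    proof -
      have "P m r j - P m q j = (2 * R / real (Suc m)) * (real (r j) - real (q j))"
        by (simp add: P_def diff_divide_distrib algebra_simps)
      also have "\<bar>\<dots>\<bar> = (2 * R / real (Suc m)) * \<bar>real (r j) - real (q j)\<bar>"
        using R by (simp add: abs_mult)
      also have "\<dots> \<le> (2 * R / real (Suc m)) * 1"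
        using that R by (intro mult_left_mono) auto
      finally show ?thesis by simp
    qed
    have "\<exists>r s. (\<forall>j<n. r j \<le> Suc m \<and> s j \<le> Suc m \<and>
      \<bar>P m r j - P m q j\<bar> \<le> 2 * R / real (Suc m) \<and> \<bar>P m s j - P m q j\<bar> \<le> 2 * R / real (Suc m)) \<and>
      F (P m r) i \<le> 0 \<and> F (P m s) i \<ge> 0" if i: "i < n" for i
    proof -
      obtain r s where rs: "\<forall>j<n. q j \<le> r j \<and> r j \<le> q j + 1" "\<forall>j<n. q j \<le> s j \<and> s j \<le> q j + 1" "label r i \<noteq> label s i"
        using q(2) i by blast
      have le: "\<forall>j<n. r j \<le> Suc m" "\<forall>j<n. s j \<le> Suc m" using rs q(1) by (metis Suc_eq_plus1 Suc_leI order_trans not_less_eq_eq)+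
      have "label q i = 0 \<or> label q i = 1" for q by (simp add: label_def)
      then consider "label r i = 0" "label s i = 1" | "label r i = 1" "label s i = 0" using rs(3) by metis
      then show ?thesis
      proof cases
        case 1
        have "\<forall>j<n. r j \<le> Suc m \<and> s j \<le> Suc m \<and>
          \<bar>P m r j - P m q j\<bar> \<le> 2 * R / real (Suc m) \<and> \<bar>P m s j - P m q j\<bar> \<le> 2 * R / real (Suc m)"
          using le rs near by blast
        then show ?thesis using lab[OF le(1) i 1(1)] lab1[OF le(2) i 1(2)] by blast
      next
        case 2
        have "\<forall>j<n. s j \<le> Suc m \<and> r j \<le> Suc m \<and>
          \<bar>P m s j - P m q j\<bar> \<le> 2 * R / real (Suc m) \<and> \<bar>P m r j - P m q j\<bar> \<le> 2 * R / real (Suc m)"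
          using le rs near by blast
        then show ?thesis using lab[OF le(2) i 2(2)] lab1[OF le(1) i 2(1)] by blast
      qed
    qed
    then obtain r s where "\<And>i. i < n \<Longrightarrow> (\<forall>j<n. r i j \<le> Suc m \<and> s i j \<le> Suc m \<and>
      \<bar>P m (r i) j - P m q j\<bar> \<le> 2 * R / real (Suc m) \<and> \<bar>P m (s i) j - P m q j\<bar> \<le> 2 * R / real (Suc m)) \<and>
      F (P m (r i)) i \<le> 0 \<and> F (P m (s i)) i \<ge> 0"
      by metis
    then have "Good m q r s" using q(1) unfolding Good_def by (simp add: less_imp_le)
    then show ?thesis by blast
  qed
  then obtain q r s where "\<And>m. Good m (q m) (r m) (s m)" by metis
  then have Q: "\<And>m i. i < n \<Longrightarrow> q m i \<le> Suc m"
    and near: "\<And>m i j. i < n \<Longrightarrow> j < n \<Longrightarrow> \<bar>P m (r m i) j - P m (q m) j\<bar> \<le> 2 * R / real (Suc m)"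
      "\<And>m i j. i < n \<Longrightarrow> j < n \<Longrightarrow> \<bar>P m (s m i) j - P m (q m) j\<bar> \<le> 2 * R / real (Suc m)"
    and sign: "\<And>m i. i < n \<Longrightarrow> F (P m (r m i)) i \<le> 0" "\<And>m i. i < n \<Longrightarrow> F (P m (s m i)) i \<ge> 0"
    unfolding Good_def by blast+
  have "\<bar>P m (q m) i\<bar> \<le> R" if "i < n" for m i by (rule Pbd[of "q m" i m, OF Q[OF that]])
  then obtain \<rho> x where \<rho>: "strict_mono \<rho>" "\<And>j. j < n \<Longrightarrow> (\<lambda>m. P (\<rho> m) (q (\<rho> m)) j) \<longlonglongrightarrow> x j"
    using bounded_coordinates_subsequence[of n "\<lambda>m. P m (q m)" R] by blast
  have "(\<lambda>m. (2 * R) * inverse (real (Suc m))) \<longlonglongrightarrow> (2 * R) * 0"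
    by (intro tendsto_mult tendsto_const LIMSEQ_inverse_real_of_nat)
  then have "(\<lambda>m. 2 * R / real (Suc m)) \<longlonglongrightarrow> 0" by (simp add: divide_inverse)
  from LIMSEQ_subseq_LIMSEQ[OF this \<rho>(1)] have mesh: "(\<lambda>m. 2 * R / real (Suc (\<rho> m))) \<longlonglongrightarrow> 0"
    by (simp add: comp_def)
  have lim: "(\<lambda>m. F (P (\<rho> m) (y (\<rho> m))) i) \<longlonglongrightarrow> F x i"
    if i: "i < n" and y: "\<And>m j. j < n \<Longrightarrow> \<bar>P m (y m) j - P m (q m) j\<bar> \<le> 2 * R / real (Suc m)" for i y
  proof (rule cont[OF _ i])
    fix j assume j: "j < n"
    have "(\<lambda>m. P (\<rho> m) (y (\<rho> m)) j - P (\<rho> m) (q (\<rho> m)) j) \<longlonglongrightarrow> 0"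
      by (rule Lim_null_comparison[OF _ mesh]) (use y[OF j] in auto)
    from tendsto_add[OF this \<rho>(2)[OF j]] show "(\<lambda>m. P (\<rho> m) (y (\<rho> m)) j) \<longlonglongrightarrow> x j" by simp
  qed
  have "F x i = 0" if i: "i < n" for i
  proof (rule antisym)
    show "F x i \<le> 0"
      by (rule LIMSEQ_le_const2[OF lim[OF i, of "\<lambda>m. r m i"]]) (use near(1) sign(1) i in auto)
    show "0 \<le> F x i"
      by (rule LIMSEQ_le_const[OF lim[OF i, of "\<lambda>m. s m i"]]) (use near(2) sign(2) i in auto)
  qed
  then show ?thesis by blast
qed

text \<open>If \<open>F\<close> had no zero, \<open>x + R F(\<pi> x)/\<bar>F(\<pi> x)\<bar>\<close>, with \<open>\<pi>\<close> the radial projection onto the ball,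
  would satisfy the sign conditions on the faces of the cube; at a zero of it \<open>F\<close> points inwards.\<close>

lemma zero_of_outward_map:
  fixes F :: "(nat \<Rightarrow> real) \<Rightarrow> nat \<Rightarrow> real"
  assumes R: "R > 0"
    and cont: "\<And>X x i. (\<And>j. j < n \<Longrightarrow> (\<lambda>m. X m j) \<longlonglongrightarrow> x j) \<Longrightarrow> i < n \<Longrightarrow> (\<lambda>m::nat. F (X m) i) \<longlonglongrightarrow> F x i"
    and outward: "\<And>x. (\<Sum>i<n. (x i)\<^sup>2) = R\<^sup>2 \<Longrightarrow> (\<Sum>i<n. x i * F x i) \<ge> 0"
  shows "\<exists>x. \<forall>i<n. F x i = 0"
proof (rule ccontr)
  assume no: "\<not> ?thesis"
  define N where "N x = sqrt (\<Sum>i<n. (x i)\<^sup>2)" for x :: "nat \<Rightarrow> real"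
  have N0: "N x \<ge> 0" for x by (simp add: N_def sum_nonneg)
  have Nsq: "(N x)\<^sup>2 = (\<Sum>i<n. (x i)\<^sup>2)" for x by (simp add: N_def sum_nonneg)
  have Ni: "\<bar>x i\<bar> \<le> N x" if "i < n" for x i
  proof -
    have "(x i)\<^sup>2 \<le> (\<Sum>i<n. (x i)\<^sup>2)" using that by (intro member_le_sum) auto
    then have "sqrt ((x i)\<^sup>2) \<le> N x" unfolding N_def by (rule real_sqrt_le_mono)
    then show ?thesis by simp
  qed
  have Ncont: "(\<lambda>m. N (X m)) \<longlonglongrightarrow> N x" if "\<And>j. j < n \<Longrightarrow> (\<lambda>m::nat. X m j) \<longlonglongrightarrow> x j" for X x
    unfolding N_def by (intro tendsto_real_sqrt tendsto_sum tendsto_power that) simp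
  define p where "p x i = (R / max R (N x)) * x i" for x :: "nat \<Rightarrow> real" and i
  define g where "g x = F (p x)" for x
  have pcont: "(\<lambda>m. p (X m) i) \<longlonglongrightarrow> p x i" if X: "\<And>j. j < n \<Longrightarrow> (\<lambda>m::nat. X m j) \<longlonglongrightarrow> x j" and "i < n" for X x i
    unfolding p_def using R that(2) by (intro tendsto_intros Ncont X) auto
  have gcont: "(\<lambda>m. g (X m) i) \<longlonglongrightarrow> g x i" if X: "\<And>j. j < n \<Longrightarrow> (\<lambda>m::nat. X m j) \<longlonglongrightarrow> x j" and "i < n" for X x i
    unfolding g_def by (rule cont[OF pcont[OF X] that(2)])
  have gpos: "N (g x) > 0" for x
  proof -
    obtain i where "i < n" "F (p x) i \<noteq> 0" using no by blast
    then show ?thesis using Ni[of i "g x"] by (simp add: g_def)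
  qed
  define G where "G x i = x i + R * (g x i / N (g x))" for x i
  have gN: "\<bar>g x i / N (g x)\<bar> \<le> 1" if "i < n" for x i
    using Ni[OF that, of "g x"] gpos[of x] by (simp add: abs_divide divide_le_eq)
  have "\<exists>x. \<forall>i<n. G x i = 0"
  proof (rule poincare_miranda[OF R])
    show "(\<lambda>m. G (X m) i) \<longlonglongrightarrow> G x i" if X: "\<And>j. j < n \<Longrightarrow> (\<lambda>m::nat. X m j) \<longlonglongrightarrow> x j" and i: "i < n" for X x i
    proof -
      have "(\<lambda>m. N (g (X m))) \<longlonglongrightarrow> N (g x)" by (rule Ncont[OF gcont[OF X]])
      moreover have "N (g x) \<noteq> 0" using gpos[of x] by simp
      ultimately show ?thesis
        unfolding G_def by (intro tendsto_add tendsto_mult tendsto_divide tendsto_const X[OF i] gcont[OF X i])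
    qed
    show "G x i \<le> 0" if "i < n" "x i = - R" for x i
    proof -
      have "R * (g x i / N (g x)) \<le> R * 1"
        using abs_le_D1[OF gN[OF that(1), of x]] R by (intro mult_left_mono) auto
      then show ?thesis using that by (simp add: G_def)
    qed
    show "G x i \<ge> 0" if "i < n" "x i = R" for x i
    proof -
      have "R * (g x i / N (g x)) \<ge> R * (-1)"
        using abs_le_D2[OF gN[OF that(1), of x]] R by (intro mult_left_mono) auto
      then show ?thesis using that by (simp add: G_def)
    qed
  qed
  then obtain x where "\<And>i. i < n \<Longrightarrow> x i + R * (g x i / N (g x)) = 0"
    unfolding G_def by blast
  then have x: "x i = - (R / N (g x)) * g x i" if "i < n" for i
    using that by (simp add: eq_neg_iff_add_eq_0)
  let ?c = "R / N (g x)"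
  have "(\<Sum>i<n. (x i)\<^sup>2) = (\<Sum>i<n. ?c\<^sup>2 * (g x i)\<^sup>2)"
  proof (rule sum.cong[OF refl])
    fix i assume "i \<in> {..<n}"
    then have "x i = - ?c * g x i" using x by simp
    then have "(x i)\<^sup>2 = (- ?c * g x i)\<^sup>2" by (rule arg_cong)
    then show "(x i)\<^sup>2 = ?c\<^sup>2 * (g x i)\<^sup>2" by (simp only: power_mult_distrib power2_minus)
  qed
  also have "\<dots> = ?c\<^sup>2 * (N (g x))\<^sup>2" by (simp add: Nsq sum_distrib_left)
  also have "\<dots> = R\<^sup>2" using gpos[of x] by (simp add: power_divide)
  finally have sph: "(\<Sum>i<n. (x i)\<^sup>2) = R\<^sup>2" .
  then have "N x = R" using R by (simp add: N_def)
  then have "p x = x" using R by (simp add: p_def fun_eq_iff)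
  then have gx: "g x = F x" by (simp add: g_def)
  have "(\<Sum>i<n. x i * F x i) = (\<Sum>i<n. - ?c * (g x i)\<^sup>2)"
  proof (rule sum.cong[OF refl])
    fix i assume "i \<in> {..<n}"
    then have "x i * g x i = (- ?c * g x i) * g x i" using x by simp
    then show "x i * F x i = - ?c * (g x i)\<^sup>2" by (simp add: gx power2_eq_square)
  qed
  also have "\<dots> = - ?c * (N (g x))\<^sup>2" by (simp add: Nsq sum_distrib_left)
  also have "\<dots> < 0" using R gpos[of x] by simp
  finally show False using outward[OF sph] by simp
qed

text \<open>A positive definite quadratic form dominates any linear form on a large sphere.\<close>

lemma zero_of_coercive_map:
  fixes F :: "(nat \<Rightarrow> real) \<Rightarrow> nat \<Rightarrow> real"
  assumes cont: "\<And>X x i. (\<And>j. j < n \<Longrightarrow> (\<lambda>m. X m j) \<longlonglongrightarrow> x j) \<Longrightarrow> i < n \<Longrightarrow> (\<lambda>m::nat. F (X m) i) \<longlonglongrightarrow> F x i"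
    and qcont: "\<And>X x. (\<And>j. j < n \<Longrightarrow> (\<lambda>m::nat. X m j) \<longlonglongrightarrow> x j) \<Longrightarrow> (\<lambda>m. q (X m)) \<longlonglongrightarrow> q x"
    and qhom: "\<And>t x. q (\<lambda>i. t * x i) = t\<^sup>2 * q x"
    and qpos: "\<And>x i. i < n \<Longrightarrow> x i \<noteq> 0 \<Longrightarrow> (q x :: real) > 0"
    and coer: "\<And>x. (\<Sum>i<n. x i * F x i) \<ge> q x - (\<Sum>i<n. x i * l i)"
  shows "\<exists>x. \<forall>i<n. F x i = 0"
proof -
  have "\<exists>\<mu>>0. \<forall>x. (\<Sum>i<n. (x i)\<^sup>2) = 1 \<longrightarrow> \<mu> \<le> q x"
  proof (rule ccontr)
    assume "\<not> ?thesis"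
    then have "\<forall>m::nat. \<exists>x. (\<Sum>i<n. (x i)\<^sup>2) = 1 \<and> q x < inverse (real (Suc m))"
      by (metis inverse_positive_iff_positive not_le of_nat_0_less_iff zero_less_Suc)
    then obtain X where X: "\<And>m. (\<Sum>i<n. (X m i)\<^sup>2) = 1" "\<And>m::nat. q (X m) < inverse (real (Suc m))"
      by metis
    have bd: "\<bar>X m i\<bar> \<le> 1" if "i < n" for m i
    proof -
      have "(X m i)\<^sup>2 \<le> (\<Sum>i<n. (X m i)\<^sup>2)" using that by (intro member_le_sum) auto
      then show ?thesis using X(1)[of m] by (simp add: abs_square_le_1)
    qed
    obtain r x where r: "strict_mono r" "\<And>i. i < n \<Longrightarrow> (\<lambda>m. X (r m) i) \<longlonglongrightarrow> x i"
      using bounded_coordinates_subsequence[of n X 1] bd by metis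
    have "(\<lambda>m. \<Sum>i<n. (X (r m) i)\<^sup>2) \<longlonglongrightarrow> (\<Sum>i<n. (x i)\<^sup>2)"
      by (intro tendsto_sum tendsto_power r(2)) simp
    then have s1: "(\<Sum>i<n. (x i)\<^sup>2) = 1" unfolding X(1) LIMSEQ_const_iff by simp
    then obtain i where i: "i < n" "x i \<noteq> 0"
      by (metis (mono_tags, lifting) lessThan_iff power_zero_numeral sum.neutral zero_neq_one)
    have "q x \<le> 0"
    proof (rule LIMSEQ_le)
      show "(\<lambda>m. q (X (r m))) \<longlonglongrightarrow> q x" by (rule qcont[OF r(2)])
      show "(\<lambda>m. inverse (real (Suc (r m)))) \<longlonglongrightarrow> 0"
        using LIMSEQ_subseq_LIMSEQ[OF LIMSEQ_inverse_real_of_nat r(1)] by (simp add: comp_def)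
      show "\<exists>N. \<forall>m\<ge>N. q (X (r m)) \<le> inverse (real (Suc (r m)))"
        using X(2) less_imp_le by blast
    qed
    then show False using qpos[of i x] i by simp
  qed
  then obtain \<mu> where \<mu>: "\<mu> > 0" "\<And>x. (\<Sum>i<n. (x i)\<^sup>2) = 1 \<Longrightarrow> \<mu> \<le> q x" by blast
  define M where "M = (\<Sum>i<n. \<bar>l i\<bar>)"
  define R where "R = M / \<mu> + 1"
  have M: "M \<ge> 0" by (simp add: M_def sum_nonneg)
  have R: "R > 0" using M \<mu> by (simp add: R_def add_nonneg_pos)
  have Rmu: "M \<le> \<mu> * R" using \<mu>(1) by (simp add: R_def distrib_left)
  show ?thesis
  proof (rule zero_of_outward_map[OF R cont])
    fix x assume x: "(\<Sum>i<n. (x i)\<^sup>2) = R\<^sup>2"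
    have "(\<Sum>i<n. (inverse R * x i)\<^sup>2) = 1"
      using x R by (simp add: power_mult_distrib sum_distrib_left[symmetric] power_inverse)
    then have "\<mu> \<le> q (\<lambda>i. inverse R * x i)" by (rule \<mu>(2))
    then have "\<mu> * R\<^sup>2 \<le> q x"
      unfolding qhom using R by (simp add: power_inverse field_simps)
    moreover have "(\<Sum>i<n. x i * l i) \<le> R * M"
      unfolding M_def sum_distrib_left
    proof (rule sum_mono)
      fix i assume "i \<in> {..<n}"
      then have "(x i)\<^sup>2 \<le> R\<^sup>2" unfolding x[symmetric] by (intro member_le_sum) auto
      then have "\<bar>x i\<bar> \<le> R" using R by (simp add: abs_le_square_iff[symmetric])
      then have "\<bar>x i\<bar> * \<bar>l i\<bar> \<le> R * \<bar>l i\<bar>" by (intro mult_right_mono) auto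
      then show "x i * l i \<le> R * \<bar>l i\<bar>" using abs_ge_self[of "x i * l i"] by (simp add: abs_mult)
    qed
    moreover have "R * M \<le> \<mu> * R\<^sup>2"
      using mult_left_mono[OF Rmu, of R] R by (simp add: power2_eq_square mult.left_commute)
    ultimately show "(\<Sum>i<n. x i * F x i) \<ge> 0" using coer[of x] by linarith
  qed
qed

text \<open>A basis modulo the common kernel of finitely many functionals. Finite element functions are total
  functions on the plane that only matter on the closed domain, where their nodal values determine
  them, so no finite basis in the literal sense exists. In the induction step the new basis element is a
  member on which the additional functional does not vanish.\<close>

lemma basis_relative_to_functionals:
  fixes ev :: "'i \<Rightarrow> ('a \<Rightarrow> 'e::real_vector) \<Rightarrow> real"
  assumes "finite I"
    and evlin: "\<And>i f g a. ev i (\<lambda>x. a *\<^sub>R f x + g x) = a * ev i f + ev i g"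
    and "\<forall>f\<in>S. \<forall>g\<in>S. \<forall>a. (\<lambda>x. a *\<^sub>R f x + g x) \<in> S"
  shows "\<exists>(n::nat) e. (\<forall>k<n. e k \<in> S) \<and> (\<forall>f\<in>S. \<exists>c. \<forall>i\<in>I. ev i f = (\<Sum>k<n. c k * ev i (e k))) \<and>
    (\<forall>c. (\<forall>i\<in>I. (\<Sum>k<n. c k * ev i (e k)) = 0) \<longrightarrow> (\<forall>k<n. c k = 0))"
  using assms(1,3)
proof (induction I arbitrary: S rule: finite_induct)
  case empty
  show ?case by (rule_tac x="0::nat" in exI, rule_tac x="\<lambda>_ _. 0" in exI) simp
next
  case (insert i I)
  show ?case
  proof (cases "\<forall>f\<in>S. ev i f = 0")
    case True
    obtain n :: nat and e where e: "\<forall>k<n. e k \<in> S" "\<forall>f\<in>S. \<exists>c. \<forall>i\<in>I. ev i f = (\<Sum>k<n. c k * ev i (e k))"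
      "\<forall>c. (\<forall>i\<in>I. (\<Sum>k<n. c k * ev i (e k)) = 0) \<longrightarrow> (\<forall>k<n. c k = 0)"
      using insert.IH[OF insert.prems] by blast
    have "\<exists>c. \<forall>j\<in>insert i I. ev j f = (\<Sum>k<n. c k * ev j (e k))" if "f \<in> S" for f
    proof -
      obtain c where "\<forall>i\<in>I. ev i f = (\<Sum>k<n. c k * ev i (e k))" using e(2) \<open>f \<in> S\<close> by blast
      then show ?thesis using True that e(1) by (intro exI[of _ c]) auto
    qed
    then show ?thesis using e(1,3) by (intro exI[of _ n] exI[of _ e]) blast
  next
    case False
    then obtain f0 where f0: "f0 \<in> S" "ev i f0 \<noteq> 0" by blast
    define S' where "S' = {f \<in> S. ev i f = 0}"
    have "\<forall>f\<in>S'. \<forall>g\<in>S'. \<forall>a. (\<lambda>x. a *\<^sub>R f x + g x) \<in> S'"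
      using insert.prems evlin by (simp add: S'_def)
    from insert.IH[OF this] obtain n :: nat and e where e: "\<forall>k<n. e k \<in> S'" "\<forall>f\<in>S'. \<exists>c. \<forall>i\<in>I. ev i f = (\<Sum>k<n. c k * ev i (e k))"
      "\<forall>c. (\<forall>i\<in>I. (\<Sum>k<n. c k * ev i (e k)) = 0) \<longrightarrow> (\<forall>k<n. c k = 0)"
      by blast
    define e' where "e' = e(n := f0)"
    have sum': "(\<Sum>k<Suc n. c k * ev j (e' k)) = (\<Sum>k<n. c k * ev j (e k)) + c n * ev j f0" for c j
      by (simp add: e'_def)
    have ei: "(\<Sum>k<n. c k * ev i (e k)) = 0" for c
      using e(1) by (intro sum.neutral) (auto simp: S'_def)
    have "e' k \<in> S" if "k < Suc n" for k
      using that e(1) f0(1) by (auto simp: e'_def S'_def less_Suc_eq)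
    moreover have "\<exists>c. \<forall>j\<in>insert i I. ev j f = (\<Sum>k<Suc n. c k * ev j (e' k))" if "f \<in> S" for f
    proof -
      define a where "a = ev i f / ev i f0"
      have a: "ev i f = a * ev i f0" using f0(2) by (simp add: a_def)
      have "(\<lambda>x. (- a) *\<^sub>R f0 x + f x) \<in> S'"
        using insert.prems[rule_format, OF f0(1) that, of "- a"] evlin[of i "- a" f0 f] a by (simp add: S'_def)
      then obtain c where c: "\<forall>j\<in>I. ev j (\<lambda>x. (- a) *\<^sub>R f0 x + f x) = (\<Sum>k<n. c k * ev j (e k))"
        using e(2) by blast
      have cs: "(\<Sum>k<n. (c(n := a)) k * ev j (e k)) = (\<Sum>k<n. c k * ev j (e k))" for j
        by (intro sum.cong) auto
      have "ev j f = (\<Sum>k<Suc n. (c(n := a)) k * ev j (e' k))" if "j \<in> insert i I" for j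
      proof (cases "j = i")
        case True
        then show ?thesis unfolding sum' cs using a ei[of c] by simp
      next
        case False
        then have "j \<in> I" using that by simp
        then have "- a * ev j f0 + ev j f = (\<Sum>k<n. c k * ev j (e k))"
          using c evlin[of j "- a" f0 f] by auto
        then show ?thesis unfolding sum' cs by simp
      qed
      then show ?thesis by blast
    qed
    moreover have "\<forall>k<Suc n. c k = 0" if c: "\<forall>j\<in>insert i I. (\<Sum>k<Suc n. c k * ev j (e' k)) = 0" for c
    proof -
      have "c n * ev i f0 = 0" using c ei[of c] unfolding sum' by simp
      then have cn: "c n = 0" using f0(2) by simp
      then have "\<forall>j\<in>I. (\<Sum>k<n. c k * ev j (e k)) = 0" using c unfolding sum' by simp
      then show ?thesis using e(3) cn by (auto simp: less_Suc_eq)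
    qed
    ultimately show ?thesis by (intro exI[of _ "Suc n"] exI[of _ e']) blast
  qed
qed

section \<open>Finite element functions\<close>

text \<open>The vector-valued counterpart of \<^const>\<open>partial\<close>.\<close>

definition axis_deriv :: "2 \<Rightarrow> (R2 \<Rightarrow> 'e::real_normed_vector) \<Rightarrow> R2 \<Rightarrow> 'e" where
  "axis_deriv j U x = frechet_derivative U (at x) (axis j 1)"

lemma axis_deriv_eqI: "(U has_derivative D) (at x) \<Longrightarrow> axis_deriv j U x = D (axis j 1)"
  unfolding axis_deriv_def by (metis frechet_derivative_at)

lemma axis_deriv_inner:
  assumes "U differentiable (at x)"
  shows "partial j (\<lambda>y. U y \<bullet> b) x = axis_deriv j U x \<bullet> b"
proof -
  obtain D where D: "(U has_derivative D) (at x)" using assms by (auto simp: differentiable_def)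
  have "((\<lambda>y. U y \<bullet> b) has_derivative (\<lambda>h. D h \<bullet> b)) (at x)"
    by (rule bounded_linear.has_derivative[OF bounded_linear_inner_left D])
  then show ?thesis by (simp add: partial_eqI axis_deriv_eqI[OF D])
qed

lemma axis_deriv_sum:
  assumes "\<And>k. k < n \<Longrightarrow> e k differentiable (at x)"
  shows "axis_deriv j (\<lambda>y. \<Sum>k<(n::nat). c k *\<^sub>R e k y) x = (\<Sum>k<n. c k *\<^sub>R axis_deriv j (e k) x)"
proof -
  have "((\<lambda>y. \<Sum>k<n. c k *\<^sub>R e k y) has_derivative
      (\<lambda>h. \<Sum>k<n. c k *\<^sub>R frechet_derivative (e k) (at x) h)) (at x)"
    using assms by (intro has_derivative_sum has_derivative_scaleR_right) (simp add: frechet_derivative_works)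
  from axis_deriv_eqI[OF this] show ?thesis by (simp add: axis_deriv_def)
qed

text \<open>The condition \<open>interior (closure \<Omega>) = \<Omega>\<close> puts the interiors of the triangles inside the domain.\<close>

locale mesh =
  fixes \<Omega> :: "R2 set" and \<T> :: "R2 set set"
  assumes open_domain: "open \<Omega>" and bounded_domain: "bounded \<Omega>" and connected_domain: "connected \<Omega>"
    and regular_domain: "interior (closure \<Omega>) = \<Omega>" and triangulated: "triangulation_of \<Omega> \<T>"
begin

lemma finite_mesh: "finite \<T>"
  using triangulated by (simp add: triangulation_of_def triangulation_def)

lemma mesh_covers: "\<Union>\<T> = closure \<Omega>"
  using triangulated by (simp add: triangulation_of_def)

lemma triangle_simplex: "K \<in> \<T> \<Longrightarrow> 2 simplex K"
  using triangulated by (simp add: triangulation_of_def)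

lemma triangle:
  assumes K: "K \<in> \<T>"
  shows "compact K" "convex K" "closed K" "interior K \<noteq> {}" "interior K \<subseteq> \<Omega>" "K \<subseteq> closure \<Omega>"
proof -
  note s = triangle_simplex[OF K]
  show "compact K" "convex K" "closed K"
    using s compact_simplex convex_simplex closed_simplex by blast+
  have "aff_dim K = int DIM(R2)" using aff_dim_simplex[OF s] by simp
  then have "affine hull K = UNIV" using aff_dim_eq_full[of K] by simp
  then have "rel_interior K = interior K" by (rule rel_interior_interior)
  moreover have "K \<noteq> {}" using s by auto
  ultimately show "interior K \<noteq> {}" using rel_interior_eq_empty[OF \<open>convex K\<close>] by simp
  show "K \<subseteq> closure \<Omega>" using mesh_covers K by auto
  from interior_mono[OF this] show "interior K \<subseteq> \<Omega>" by (simp add: regular_domain)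
qed

lemma compact_closure_domain: "compact (closure \<Omega>)"
  using bounded_domain by (simp add: compact_closure)

lemma domain_lebesgue: "\<Omega> \<in> sets lebesgue"
  using open_domain by auto

definition mesh_interior :: "R2 set" where
  "mesh_interior = (\<Union>K\<in>\<T>. interior K)"

lemma AE_mesh_interior: "AE x in lebesgue_on \<Omega>. x \<in> mesh_interior"
proof -
  have "AE x in lebesgue. x \<notin> frontier K" if "K \<in> \<T>" for K
  proof -
    have "frontier K \<in> null_sets lebesgue"
      using negligible_convex_frontier[OF triangle(2)[OF that]] by (simp add: negligible_iff_null_sets)
    then show ?thesis by (rule AE_not_in)
  qed
  then have "AE x in lebesgue. \<forall>K\<in>\<T>. x \<notin> frontier K"
    using finite_mesh by (intro AE_finite_allI)
  then have "AE x in lebesgue. x \<in> \<Omega> \<longrightarrow> x \<in> mesh_interior"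
  proof eventually_elim
    case (elim x)
    show ?case
    proof
      assume "x \<in> \<Omega>"
      then have "x \<in> \<Union>\<T>" using closure_subset[of \<Omega>] mesh_covers by auto
      then obtain K where K: "K \<in> \<T>" "x \<in> K" by blast
      then have "x \<in> interior K" using elim triangle(3)[OF K(1)] by (auto simp: frontier_def)
      then show "x \<in> mesh_interior" using K(1) by (auto simp: mesh_interior_def)
    qed
  qed
  then show ?thesis using domain_lebesgue by (simp add: AE_lebesgue_on_iff)
qed

lemma M_h_lincomb:
  assumes f: "f \<in> M_h \<Omega> \<T>" and g: "g \<in> M_h \<Omega> \<T>"
  shows "(\<lambda>x. a * f x + g x) \<in> M_h \<Omega> \<T>"
proof -
  have "\<exists>u c. \<forall>x\<in>K. a * f x + g x = u \<bullet> x + c" if K: "K \<in> \<T>" for K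
  proof -
    obtain u c where u: "\<forall>x\<in>K. f x = u \<bullet> x + c" using f K unfolding M_h_def by blast
    obtain v d where v: "\<forall>x\<in>K. g x = v \<bullet> x + d" using g K unfolding M_h_def by blast
    show ?thesis
      by (rule exI[of _ "a *\<^sub>R u + v"], rule exI[of _ "a * c + d"])
        (use u v in \<open>simp add: inner_add_left distrib_left\<close>)
  qed
  then show ?thesis using f g unfolding M_h_def by (auto intro!: continuous_intros)
qed

lemma M_h_zero: "(\<lambda>x. 0) \<in> M_h \<Omega> \<T>"
  unfolding M_h_def by (auto intro: exI[of _ 0])

lemma affine_has_derivative:
  assumes "\<forall>y\<in>K. v y = a \<bullet> y + c" and x: "x \<in> interior K"
  shows "(v has_derivative (\<lambda>h. a \<bullet> h)) (at x)"
proof (rule has_derivative_transform_within_open[of "\<lambda>y. a \<bullet> y + c" _ _ _ "interior K"])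
  show "((\<lambda>y. a \<bullet> y + c) has_derivative (\<lambda>h. a \<bullet> h)) (at x)"
    by (auto intro!: derivative_eq_intros)
  show "a \<bullet> y + c = v y" if "y \<in> interior K" for y
    using that assms(1) interior_subset[of K] by auto
qed (use x in auto)

lemma M_h_differentiable:
  assumes "v \<in> M_h \<Omega> \<T>" "x \<in> mesh_interior" shows "v differentiable (at x)"
proof -
  obtain K where K: "K \<in> \<T>" "x \<in> interior K" using assms(2) by (auto simp: mesh_interior_def)
  obtain a c where "\<forall>y\<in>K. v y = a \<bullet> y + c" using assms(1) K(1) unfolding M_h_def by blast
  from affine_has_derivative[OF this K(2)] show ?thesis by (auto simp: differentiable_def)
qed

text \<open>A segment inside the closed domain is covered by finitely many closed pieces, one for each
  triangle, on which the function is affine.\<close>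

lemma M_h_segment_lipschitz:
  assumes v: "v \<in> M_h \<Omega> \<T>"
  obtains L where "L \<ge> 0"
    "\<And>x y. closed_segment x y \<subseteq> closure \<Omega> \<Longrightarrow> \<bar>v y - v x\<bar> \<le> L * norm (y - x)"
proof -
  have "\<forall>K\<in>\<T>. \<exists>a c. \<forall>x\<in>K. v x = a \<bullet> x + c" using v by (simp add: M_h_def)
  then obtain A C where A: "\<And>K x. K \<in> \<T> \<Longrightarrow> x \<in> K \<Longrightarrow> v x = A K \<bullet> x + C K" by metis
  define L where "L = (\<Sum>K\<in>\<T>. norm (A K))"
  have L0: "L \<ge> 0" by (simp add: L_def sum_nonneg)
  have AL: "norm (A K) \<le> L" if "K \<in> \<T>" for K
    unfolding L_def using finite_mesh that by (intro member_le_sum) auto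
  have "\<bar>v y - v x\<bar> \<le> L * norm (y - x)" if seg: "closed_segment x y \<subseteq> closure \<Omega>" for x y
  proof -
    define g where "g s = x + s *\<^sub>R (y - x)" for s
    define U where "U K = {0..1} \<inter> g -` K" for K
    have "lipschitz_on (L * norm (y - x)) {0..1} (\<lambda>s. v (g s))"
    proof (rule lipschitz_on_closed_Union[of \<T> _ U])
      fix K assume K: "K \<in> \<T>"
      have "continuous_on {0..1} g" unfolding g_def by (intro continuous_intros)
      then show "closed (U K)"
        unfolding U_def using triangle(3)[OF K] by (intro continuous_closed_preimage) auto
      show "lipschitz_on (L * norm (y - x)) (U K) (\<lambda>s. v (g s))"
      proof (rule lipschitz_onI)
        fix s t assume "s \<in> U K" "t \<in> U K"
        then have st: "g s \<in> K" "g t \<in> K" by (auto simp: U_def)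
        have "v (g s) - v (g t) = A K \<bullet> (g s - g t)"
          using A[OF K st(1)] A[OF K st(2)] by (simp add: inner_diff_right)
        also have "g s - g t = (s - t) *\<^sub>R (y - x)" by (simp add: g_def scaleR_diff_left)
        finally have "\<bar>v (g s) - v (g t)\<bar> \<le> norm (A K) * norm ((s - t) *\<^sub>R (y - x))"
          using Cauchy_Schwarz_ineq2 by metis
        also have "\<dots> \<le> L * norm ((s - t) *\<^sub>R (y - x))"
          by (intro mult_right_mono AL K) simp
        finally show "dist (v (g s)) (v (g t)) \<le> L * norm (y - x) * dist s t"
          unfolding dist_real_def norm_scaleR by (simp only: mult_ac)
      qed (simp add: L0)
    next
      show "{0..1} \<subseteq> (\<Union>K\<in>\<T>. U K)"
      proof
        fix s :: real assume s: "s \<in> {0..1}"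
        then have "g s \<in> closed_segment x y"
          unfolding g_def closed_segment_def by (auto intro!: exI[of _ s] simp: algebra_simps)
        then have "g s \<in> \<Union>\<T>" using seg mesh_covers by auto
        then show "s \<in> (\<Union>K\<in>\<T>. U K)" using s by (auto simp: U_def)
      qed
    qed (use finite_mesh L0 in auto)
    from lipschitz_onD[OF this, of 1 0] show ?thesis by (simp add: g_def dist_real_def)
  qed
  then show thesis using that L0 by blast
qed

lemma M_h_bounded:
  assumes v: "v \<in> M_h \<Omega> \<T>"
  obtains B where "\<And>x. x \<in> closure \<Omega> \<Longrightarrow> \<bar>v x\<bar> \<le> B"
proof -
  have "continuous_on (closure \<Omega>) v" using v by (simp add: M_h_def)
  from compact_imp_bounded[OF compact_continuous_image[OF this compact_closure_domain]]
  show thesis using that by (auto simp: bounded_iff)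
qed

lemma M_h_continuous_on_domain: "v \<in> M_h \<Omega> \<T> \<Longrightarrow> continuous_on \<Omega> v"
  unfolding M_h_def using closure_subset by (auto intro: continuous_on_subset)

lemma M_h_AE_differentiable:
  "v \<in> M_h \<Omega> \<T> \<Longrightarrow> AE x in lebesgue_on \<Omega>. v differentiable (at x)"
  using AE_mesh_interior by eventually_elim (rule M_h_differentiable)

lemma M_h_partial:
  assumes v: "v \<in> M_h \<Omega> \<T>"
  shows "AE x in lebesgue_on \<Omega>. weak_partial \<Omega> j v x = partial j v x"
    and "partial j v \<in> borel_measurable (lebesgue_on \<Omega>)"
    and "\<exists>L. \<forall>x\<in>mesh_interior. \<bar>partial j v x\<bar> \<le> L"
proof -
  obtain B where B: "\<And>x. x \<in> closure \<Omega> \<Longrightarrow> \<bar>v x\<bar> \<le> B" using M_h_bounded[OF v] by metis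
  obtain L where L: "\<And>x y. closed_segment x y \<subseteq> closure \<Omega> \<Longrightarrow> \<bar>v y - v x\<bar> \<le> L * norm (y - x)"
    using M_h_segment_lipschitz[OF v] by metis
  have lip: "\<bar>v (x + t *\<^sub>R axis j 1) - v x\<bar> \<le> L * \<bar>t\<bar>" if "closed_segment x (x + t *\<^sub>R axis j 1) \<subseteq> \<Omega>" for x t
    using L[OF order_trans[OF that closure_subset]] by (simp add: norm_axis_1)
  have bd: "\<bar>v x\<bar> \<le> B" if "x \<in> \<Omega>" for x using B closure_subset that by auto
  have "has_weak_partial \<Omega> j v (partial j v)"
    by (rule has_weak_partial_classical[OF open_domain M_h_continuous_on_domain[OF v] bd lip M_h_AE_differentiable[OF v]])
  then show "AE x in lebesgue_on \<Omega>. weak_partial \<Omega> j v x = partial j v x"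
    by (rule weak_partial_AE_eq[OF open_domain])
  show "partial j v \<in> borel_measurable (lebesgue_on \<Omega>)"
    by (rule partial_measurable[OF open_domain M_h_continuous_on_domain[OF v] M_h_AE_differentiable[OF v]])
  have "\<bar>partial j v x\<bar> \<le> L" if x: "x \<in> mesh_interior" for x
  proof -
    have "x \<in> \<Omega>" using x triangle(5) by (auto simp: mesh_interior_def)
    then show ?thesis by (rule partial_bound[OF open_domain _ M_h_differentiable[OF v x] lip])
  qed
  then show "\<exists>L. \<forall>x\<in>mesh_interior. \<bar>partial j v x\<bar> \<le> L" by blast
qed

text \<open>Velocities, pressures, conformation tensors and triples of them are all treated at once as
  vector-valued functions with components in \<^term>\<open>M_h \<Omega> \<T>\<close>.\<close>

definition PL :: "(R2 \<Rightarrow> 'e::euclidean_space) set" where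
  "PL = {U. \<forall>b\<in>Basis. (\<lambda>x. U x \<bullet> b) \<in> M_h \<Omega> \<T>}"

lemma PL_continuous: "U \<in> PL \<Longrightarrow> continuous_on (closure \<Omega>) U"
  unfolding PL_def M_h_def by (subst continuous_on_componentwise) auto

lemma PL_differentiable: "U \<in> PL \<Longrightarrow> x \<in> mesh_interior \<Longrightarrow> U differentiable (at x)"
  using M_h_differentiable unfolding PL_def by (subst differentiable_componentwise_within) auto

lemma PL_bounded:
  assumes "U \<in> PL" obtains B where "\<And>x. x \<in> closure \<Omega> \<Longrightarrow> norm (U x) \<le> B"
  using compact_imp_bounded[OF compact_continuous_image[OF PL_continuous[OF assms] compact_closure_domain]]
  by (auto simp: bounded_iff)

lemma PL_measurable: "U \<in> PL \<Longrightarrow> U \<in> borel_measurable (lebesgue_on \<Omega>)"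
  using domain_lebesgue closure_subset PL_continuous
  by (intro continuous_imp_measurable_on_sets_lebesgue) (auto intro: continuous_on_subset)

lemma PL_axis_deriv:
  assumes U: "U \<in> PL"
  shows "axis_deriv j U \<in> borel_measurable (lebesgue_on \<Omega>)"
    and "\<exists>L. \<forall>x\<in>mesh_interior. norm (axis_deriv j U x) \<le> L"
    and "b \<in> Basis \<Longrightarrow> AE x in lebesgue_on \<Omega>. weak_partial \<Omega> j (\<lambda>y. U y \<bullet> b) x = axis_deriv j U x \<bullet> b"
proof -
  have Ub: "(\<lambda>y. U y \<bullet> b) \<in> M_h \<Omega> \<T>" if "b \<in> Basis" for b using U that by (simp add: PL_def)
  have eq: "axis_deriv j U x \<bullet> b = partial j (\<lambda>y. U y \<bullet> b) x" if "x \<in> mesh_interior" for x b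
    using axis_deriv_inner[OF PL_differentiable[OF U that]] by simp
  have "(\<lambda>x. \<Sum>b\<in>Basis. partial j (\<lambda>y. U y \<bullet> b) x *\<^sub>R b) \<in> borel_measurable (lebesgue_on \<Omega>)"
    by (intro borel_measurable_sum borel_measurable_scaleR borel_measurable_const M_h_partial(2) Ub)
  moreover have "AE x in lebesgue_on \<Omega>. (\<Sum>b\<in>Basis. partial j (\<lambda>y. U y \<bullet> b) x *\<^sub>R b) = axis_deriv j U x"
    using AE_mesh_interior
  proof eventually_elim
    case (elim x)
    show ?case unfolding eq[OF elim, symmetric] by (rule euclidean_representation)
  qed
  ultimately show "axis_deriv j U \<in> borel_measurable (lebesgue_on \<Omega>)"
    by (rule measurable_lebesgue_on_AE_eq[OF _ _ domain_lebesgue])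
  have "\<forall>b\<in>Basis. \<exists>L. \<forall>x\<in>mesh_interior. \<bar>partial j (\<lambda>y. U y \<bullet> b) x\<bar> \<le> L"
    using M_h_partial(3) Ub by blast
  then obtain L where L: "\<And>b x. b \<in> Basis \<Longrightarrow> x \<in> mesh_interior \<Longrightarrow> \<bar>partial j (\<lambda>y. U y \<bullet> b) x\<bar> \<le> L b" by metis
  have "norm (axis_deriv j U x) \<le> (\<Sum>b\<in>Basis. L b)" if x: "x \<in> mesh_interior" for x
  proof -
    have "norm (axis_deriv j U x) \<le> (\<Sum>b\<in>Basis. \<bar>axis_deriv j U x \<bullet> b\<bar>)" by (rule norm_le_l1)
    also have "\<dots> \<le> (\<Sum>b\<in>Basis. L b)" by (intro sum_mono) (simp add: eq[OF x] L x)
    finally show ?thesis .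
  qed
  then show "\<exists>L. \<forall>x\<in>mesh_interior. norm (axis_deriv j U x) \<le> L" by blast
  show "AE x in lebesgue_on \<Omega>. weak_partial \<Omega> j (\<lambda>y. U y \<bullet> b) x = axis_deriv j U x \<bullet> b" if b: "b \<in> Basis"
    using M_h_partial(1)[OF Ub[OF b], of j] AE_mesh_interior by eventually_elim (simp add: eq)
qed

text \<open>The nodes are the vertices of the triangles: the zero set of an affine function is convex, so it
  contains a triangle as soon as it contains the vertices.\<close>

lemma mesh_nodes:
  obtains P where "finite P" "P \<subseteq> closure \<Omega>"
    "\<And>U :: R2 \<Rightarrow> 'e::euclidean_space. U \<in> PL \<Longrightarrow> \<forall>x\<in>P. U x = 0 \<Longrightarrow> \<forall>x\<in>closure \<Omega>. U x = 0"
proof -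
  have "\<forall>K\<in>\<T>. \<exists>C. finite C \<and> K = convex hull C"
    using triangle_simplex unfolding simplex by blast
  then obtain C where C: "\<And>K. K \<in> \<T> \<Longrightarrow> finite (C K)" "\<And>K. K \<in> \<T> \<Longrightarrow> K = convex hull (C K)" by metis
  define P where "P = (\<Union>K\<in>\<T>. C K)"
  have "finite P" using finite_mesh C(1) by (simp add: P_def)
  moreover have "P \<subseteq> closure \<Omega>"
  proof -
    have "C K \<subseteq> closure \<Omega>" if "K \<in> \<T>" for K
      using hull_subset[of "C K" convex] C(2)[OF that] triangle(6)[OF that] by auto
    then show ?thesis by (auto simp: P_def)
  qed
  moreover have "\<forall>x\<in>closure \<Omega>. U x = 0" if U: "U \<in> PL" and z: "\<forall>x\<in>P. U x = 0" for U :: "R2 \<Rightarrow> 'e"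
  proof
    fix x assume "x \<in> closure \<Omega>"
    then obtain K where K: "K \<in> \<T>" "x \<in> K" using mesh_covers by blast
    have "U x \<bullet> b = 0" if b: "b \<in> Basis" for b
    proof -
      have "(\<lambda>x. U x \<bullet> b) \<in> M_h \<Omega> \<T>" using U b by (simp add: PL_def)
      then obtain a c where ac: "\<forall>x\<in>K. U x \<bullet> b = a \<bullet> x + c" using K(1) unfolding M_h_def by blast
      have "C K \<subseteq> {y. a \<bullet> y = - c}"
      proof
        fix y assume y: "y \<in> C K"
        then have "y \<in> K" using hull_subset[of "C K" convex] C(2)[OF K(1)] by auto
        moreover have "U y = 0" using y z K(1) by (auto simp: P_def)
        ultimately show "y \<in> {y. a \<bullet> y = - c}" using ac by fastforce
      qed
      then have "convex hull (C K) \<subseteq> {y. a \<bullet> y = - c}" by (rule hull_minimal) (rule convex_hyperplane)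
      then show ?thesis using K C(2)[OF K(1)] ac by auto
    qed
    then show "U x = 0" by (simp add: euclidean_eq_iff[of "U x" 0])
  qed
  ultimately show thesis using that by blast
qed

text \<open>A triangle may touch the boundary, where a weak gradient has arbitrary values; that part is a null
  set.\<close>

lemma ip_triangle:
  fixes f g :: "R2 \<Rightarrow> 'e::euclidean_space"
  assumes K: "K \<in> \<T>" and m: "(\<lambda>x. f x \<bullet> g x) \<in> borel_measurable (lebesgue_on \<Omega>)"
  shows "ip K f g = (LINT x|lebesgue_on \<Omega>. indicator K x * (f x \<bullet> g x))"
proof -
  have Km: "K \<in> sets lebesgue" using lmeasurable_compact[OF triangle(1)[OF K]] by (simp add: fmeasurable_def)
  have m': "(\<lambda>x. indicator \<Omega> x *\<^sub>R (indicator K x * (f x \<bullet> g x))) \<in> borel_measurable lebesgue"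
  proof (subst borel_measurable_restrict_space_iff[symmetric])
    have "indicator K \<in> borel_measurable (lebesgue_on \<Omega>)"
      by (rule measurable_restrict_space1) (rule borel_measurable_indicator[OF Km])
    then show "(\<lambda>x. indicator K x * (f x \<bullet> g x)) \<in> borel_measurable (lebesgue_on \<Omega>)"
      by (rule borel_measurable_times[OF _ m])
  qed (use domain_lebesgue in auto)
  have "frontier K \<in> null_sets lebesgue"
    using negligible_convex_frontier[OF triangle(2)[OF K]] by (simp add: negligible_iff_null_sets)
  from AE_not_in[OF this]
  have ae: "AE x in lebesgue. indicator \<Omega> x *\<^sub>R (indicator K x * (f x \<bullet> g x)) = indicator K x *\<^sub>R (f x \<bullet> g x)"
  proof eventually_elim
    case (elim x)
    then have "x \<in> K \<Longrightarrow> x \<in> \<Omega>" using triangle(3,5)[OF K] by (auto simp: frontier_def)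
    then show ?case by (auto simp: indicator_def)
  qed
  have "ip K f g = (LINT x|lebesgue. indicator K x *\<^sub>R (f x \<bullet> g x))"
    unfolding ip_def using Km by (subst integral_restrict_space) auto
  also have "\<dots> = (LINT x|lebesgue. indicator \<Omega> x *\<^sub>R (indicator K x * (f x \<bullet> g x)))"
  proof (rule integral_cong_AE)
    show "(\<lambda>x. indicator K x *\<^sub>R (f x \<bullet> g x)) \<in> borel_measurable lebesgue"
      by (rule borel_measurable_AE[OF m' ae])
    show "AE x in lebesgue. indicator K x *\<^sub>R (f x \<bullet> g x) = indicator \<Omega> x *\<^sub>R (indicator K x * (f x \<bullet> g x))"
      using ae by eventually_elim simp
  qed (rule m')
  also have "\<dots> = (LINT x|lebesgue_on \<Omega>. indicator K x * (f x \<bullet> g x))"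
    using domain_lebesgue by (subst integral_restrict_space) auto
  finally show ?thesis .
qed

end

section \<open>The forms of the scheme, pointwise\<close>

text \<open>A jet consists of the value of a triple \<open>(u, p, C)\<close> at a point and its two partial derivatives. The
  forms of the scheme are integrals of functions of jets, so that linearity, continuity and coercivity
  become statements about finite-dimensional algebra.\<close>

type_synonym state = "R2 \<times> real \<times> M2"
type_synonym jet = "state \<times> state \<times> state"

definition vel :: "jet \<Rightarrow> R2" where "vel y = fst (fst y)"
definition pre :: "jet \<Rightarrow> real" where "pre y = fst (snd (fst y))"
definition con :: "jet \<Rightarrow> M2" where "con y = snd (snd (fst y))"
definition dj :: "2 \<Rightarrow> jet \<Rightarrow> state" where "dj j y = (if j = 1 then fst (snd y) else snd (snd y))"
definition Gu :: "jet \<Rightarrow> M2" where "Gu y = (\<chi> i j. fst (dj j y) $ i)"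
definition gp :: "jet \<Rightarrow> R2" where "gp y = (\<chi> j. fst (snd (dj j y)))"
definition gC :: "2 \<Rightarrow> 2 \<Rightarrow> jet \<Rightarrow> R2" where "gC i k y = (\<chi> j. snd (snd (dj j y)) $ i $ k)"
definition sym_part :: "M2 \<Rightarrow> M2" where "sym_part A = (1/2) *\<^sub>R (A + transpose A)"

lemma linear_jet_parts: "linear vel" "linear pre" "linear con" "linear (dj j)" "linear Gu" "linear gp" "linear (gC i k)"
  by (auto intro!: linearI simp: vel_def pre_def con_def dj_def Gu_def gp_def gC_def vec_eq_iff)

lemma linear_matrix_parts: "linear (trace :: M2 \<Rightarrow> real)" "linear sharp" "linear sym_part"
proof -
  show "linear (trace :: M2 \<Rightarrow> real)"
    by (rule linearI) (simp_all add: trace_def sum.distrib sum_distrib_left)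
  show "linear sharp"
    by (rule linearI) (simp_all add: sharp_def vec_eq_iff forall_2)
  show "linear sym_part"
    by (rule linearI) (simp_all add: sym_part_def vec_eq_iff transpose_def distrib_left)
qed

lemmas jet_add = linear_jet_parts[THEN linear_add] linear_matrix_parts[THEN linear_add]
lemmas jet_scale = linear_jet_parts[THEN linear_scale] linear_matrix_parts[THEN linear_scale]

lemma continuous_on_linear:
  fixes f :: "'a::euclidean_space \<Rightarrow> 'b::real_normed_vector"
  assumes "linear f" "continuous_on S g" shows "continuous_on S (\<lambda>x. f (g x))"
  by (rule continuous_on_compose2[OF linear_continuous_on assms(2)])
    (use assms(1) in \<open>auto simp: linear_conv_bounded_linear\<close>)

lemma continuous_on_matrix_mult:
  fixes f g :: "'a::topological_space \<Rightarrow> M2"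
  assumes "continuous_on S f" "continuous_on S g"
  shows "continuous_on S (\<lambda>x. f x ** g x)"
proof -
  have "bilinear ((**) :: M2 \<Rightarrow> M2 \<Rightarrow> M2)"
    unfolding bilinear_def
    by (intro conjI allI linearI)
      (simp_all add: matrix_matrix_mult_def vec_eq_iff sum.distrib distrib_left distrib_right sum_distrib_left mult_ac)
  then have "bounded_bilinear ((**) :: M2 \<Rightarrow> M2 \<Rightarrow> M2)"
    by (simp add: bilinear_conv_bounded_bilinear)
  then show ?thesis using assms by (rule bounded_bilinear.continuous_on)
qed

lemmas continuous_on_jet = linear_jet_parts[THEN continuous_on_linear] linear_matrix_parts[THEN continuous_on_linear]
  continuous_on_matrix_mult

text \<open>Here \<open>a\<close> stands for \<open>1/\<Delta>t\<close>, and \<open>k\<close> for the factor \<open>h\<^sub>K\<^sup>2\<close> of the stabilization at the point considered.\<close>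

definition momentum_form :: "real \<Rightarrow> real \<Rightarrow> real \<Rightarrow> real \<Rightarrow> jet \<Rightarrow> jet \<Rightarrow> real" where
  "momentum_form a \<nu> \<delta> k y z = a * (vel y \<bullet> vel z) + \<nu> * (2 * (sym_part (Gu y) \<bullet> sym_part (Gu z)))
     - trace (Gu y) * pre z - trace (Gu z) * pre y - \<delta> * (k * (gp y \<bullet> gp z))
     + trace (con y) * (con y \<bullet> Gu z)"

definition conformation_form :: "real \<Rightarrow> real \<Rightarrow> jet \<Rightarrow> jet \<Rightarrow> real" where
  "conformation_form a \<epsilon> y z = a * (con y \<bullet> con z) + \<epsilon> * (\<Sum>i\<in>UNIV. \<Sum>k\<in>UNIV. gC i k y \<bullet> gC i k z)
     - 2 * ((Gu y ** con y) \<bullet> con z) - trace (Gu y) * (sharp (con y) \<bullet> con z)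
     + (trace (con y))\<^sup>2 * (con y \<bullet> con z) - trace (con y) * (mat 1 \<bullet> con z)"

definition energy_form :: "real \<Rightarrow> real \<Rightarrow> real \<Rightarrow> jet \<Rightarrow> real" where
  "energy_form a \<delta> k y = a * (vel y \<bullet> vel y) + (a/2 - 1) * (con y \<bullet> con y) + \<delta> * (k * (gp y \<bullet> gp y))"

text \<open>This map is a linear bijection of the discrete space, so testing with the images of a basis is as good
  as testing with the basis.\<close>

definition energy_test :: "state \<Rightarrow> state" where
  "energy_test z = (fst z, - fst (snd z), (1/2) *\<^sub>R snd (snd z))"

definition energy_test_jet :: "jet \<Rightarrow> jet" where
  "energy_test_jet y = (energy_test (fst y), energy_test (fst (snd y)), energy_test (snd (snd y)))"

lemma linear_energy_test: "linear energy_test" "linear energy_test_jet"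
  by (rule linearI; simp add: energy_test_def energy_test_jet_def scaleR_add_right)+

lemma energy_test_parts:
  "vel (energy_test_jet y) = vel y" "pre (energy_test_jet y) = - pre y" "con (energy_test_jet y) = (1/2) *\<^sub>R con y"
  "Gu (energy_test_jet y) = Gu y" "gp (energy_test_jet y) = - gp y" "gC i k (energy_test_jet y) = (1/2) *\<^sub>R gC i k y"
  by (simp_all add: energy_test_jet_def energy_test_def vel_def pre_def con_def Gu_def gp_def gC_def dj_def vec_eq_iff)

lemma linear_forms:
  "linear (momentum_form a \<nu> \<delta> k y)" "linear (conformation_form a \<epsilon> y)"
  by (rule linearI; simp add: momentum_form_def conformation_form_def jet_add jet_scale inner_add_right
      sum.distrib sum_distrib_left algebra_simps)+

text \<open>For symmetric \<open>C\<close> the Cayley-Hamilton theorem gives \<open>C\<^sup>2 = (tr C) C - (det C) I\<close>, and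
  \<open>C\<^sup>#\<close> paired with \<open>C\<close> is \<open>2 det C\<close>.\<close>

lemma stress_power_cancellation:
  fixes C G :: M2
  assumes C: "transpose C = C"
  shows "trace C * (C \<bullet> G) - ((G ** C) \<bullet> C) - (1/2) * (trace G * (sharp C \<bullet> C)) = 0"
proof -
  have s: "C $ 2 $ 1 = C $ 1 $ 2" 
  proof -
    have "transpose C $ 1 $ 2 = C $ 1 $ 2" using C by simp
    then show ?thesis by (simp add: transpose_def)
  qed
  show ?thesis
    by (simp add: inner_vec_def trace_def sum_2 matrix_matrix_mult_def sharp_def s algebra_simps)
qed

lemma trace_sq_le: fixes C :: M2 shows "(trace C)\<^sup>2 \<le> 2 * (C \<bullet> C)"
proof -
  have "(x + y)\<^sup>2 \<le> 2 * (x * x + y * y)" for x y :: real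
    using zero_le_power2[of "x - y"] by (simp add: power2_eq_square algebra_simps)
  from this[of "C$1$1" "C$2$2"] have "(trace C)\<^sup>2 \<le> 2 * (C$1$1 * C$1$1 + C$2$2 * C$2$2)"
    by (simp add: trace_def sum_2)
  also have "\<dots> \<le> 2 * (C \<bullet> C)" by (simp add: inner_vec_def sum_2)
  finally show ?thesis .
qed

lemma mat_1_inner: fixes C :: M2 shows "mat 1 \<bullet> C = trace C"
  by (simp add: inner_vec_def trace_def sum_2 mat_def)

lemma energy_estimate:
  assumes C: "transpose (con y) = con y" and "\<nu> \<ge> 0" "\<epsilon> \<ge> 0"
  shows "momentum_form a \<nu> \<delta> k y (energy_test_jet y) + conformation_form a \<epsilon> y (energy_test_jet y)
    \<ge> energy_form a \<delta> k y"
proof -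
  define S where "S = sym_part (Gu y) \<bullet> sym_part (Gu y)"
  define N where "N = (\<Sum>i\<in>UNIV. \<Sum>k\<in>UNIV. gC i k y \<bullet> gC i k y)"
  have S: "\<nu> * S \<ge> 0" using assms(2) by (simp add: S_def)
  have N: "\<epsilon> * N \<ge> 0" using assms(3) by (simp add: N_def sum_nonneg)
  have sN: "(\<Sum>i\<in>UNIV. \<Sum>k\<in>UNIV. gC i k y \<bullet> ((1/2) *\<^sub>R gC i k y)) = N / 2"
    by (simp add: N_def sum_divide_distrib)
  define T where "T = (trace (con y))\<^sup>2 * (con y \<bullet> con y)"
  have T: "T \<ge> 0" by (simp add: T_def)
  have tr: "trace (con y) * trace (con y) \<le> 2 * (con y \<bullet> con y)"
    using trace_sq_le[of "con y"] by (simp add: power2_eq_square)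
  have "momentum_form a \<nu> \<delta> k y (energy_test_jet y) + conformation_form a \<epsilon> y (energy_test_jet y)
    = a * (vel y \<bullet> vel y) + \<nu> * (2 * S) + \<delta> * (k * (gp y \<bullet> gp y)) + (a/2) * (con y \<bullet> con y) + \<epsilon> * (N / 2)
      + (1/2) * T - (1/2) * (trace (con y) * trace (con y))
      + (trace (con y) * (con y \<bullet> Gu y) - ((Gu y ** con y) \<bullet> con y) - (1/2) * (trace (Gu y) * (sharp (con y) \<bullet> con y)))"
    unfolding momentum_form_def conformation_form_def energy_test_parts sN S_def T_def
    by (simp add: mat_1_inner algebra_simps)
  then show ?thesis
    unfolding stress_power_cancellation[OF C] energy_form_def using S N T tr by (simp add: algebra_simps)
qed

definition jet :: "(R2 \<Rightarrow> state) \<Rightarrow> R2 \<Rightarrow> jet" where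
  "jet U x = (U x, axis_deriv 1 U x, axis_deriv 2 U x)"

lemma dj_jet: "dj j (jet U x) = axis_deriv j U x"
  using exhaust_2[of j] by (auto simp: dj_def jet_def)

lemma jet_parts: "vel (jet U x) = fst (U x)" "pre (jet U x) = fst (snd (U x))" "con (jet U x) = snd (snd (U x))"
  by (simp_all add: vel_def pre_def con_def jet_def)

lemma axis_deriv_linear:
  fixes T :: "'a::euclidean_space \<Rightarrow> 'b::real_normed_vector"
  assumes T: "linear T" and U: "U differentiable (at x)"
  shows "axis_deriv j (\<lambda>y. T (U y)) x = T (axis_deriv j U x)"
proof -
  obtain D where D: "(U has_derivative D) (at x)" using U by (auto simp: differentiable_def)
  have "((\<lambda>y. T (U y)) has_derivative (\<lambda>h. T (D h))) (at x)"
    by (rule bounded_linear.has_derivative[OF _ D]) (use T in \<open>simp add: linear_conv_bounded_linear\<close>)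
  then show ?thesis by (simp add: axis_deriv_eqI axis_deriv_eqI[OF D])
qed

context mesh
begin

section \<open>Integrals over the mesh\<close>

text \<open>Finite element functions are continuous and their derivatives piecewise constant. Only measurability
  and essential boundedness are retained; both survive composition with continuous functions and imply
  integrability.\<close>

definition ess_bounded :: "(R2 \<Rightarrow> 'b::euclidean_space) \<Rightarrow> bool" where
  "ess_bounded f \<longleftrightarrow> f \<in> borel_measurable (lebesgue_on \<Omega>) \<and> (\<exists>B. AE x in lebesgue_on \<Omega>. norm (f x) \<le> B)"

lemma finite_measure_domain: "finite_measure (lebesgue_on \<Omega>)"
  by (rule finite_measure_bounded_open[OF open_domain bounded_domain])

lemma ess_bounded_integrable:
  assumes "ess_bounded f" shows "integrable (lebesgue_on \<Omega>) f"
proof -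
  obtain B where "AE x in lebesgue_on \<Omega>. norm (f x) \<le> B" "f \<in> borel_measurable (lebesgue_on \<Omega>)"
    using assms by (auto simp: ess_bounded_def)
  then show ?thesis by (rule finite_measure.integrable_const_bound[OF finite_measure_domain])
qed

lemma ess_bounded_Pair:
  assumes "ess_bounded f" "ess_bounded g" shows "ess_bounded (\<lambda>x. (f x, g x))"
proof -
  obtain B C where B: "AE x in lebesgue_on \<Omega>. norm (f x) \<le> B" "AE x in lebesgue_on \<Omega>. norm (g x) \<le> C"
    using assms by (auto simp: ess_bounded_def)
  have "AE x in lebesgue_on \<Omega>. norm (f x, g x) \<le> B + C"
    using B
  proof eventually_elim
    case (elim x)
    then show ?case using norm_Pair_le[of "f x" "g x"] by linarith
  qed
  moreover have "(\<lambda>x. (f x, g x)) \<in> borel_measurable (lebesgue_on \<Omega>)"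
    using assms by (intro borel_measurable_Pair) (auto simp: ess_bounded_def)
  ultimately show ?thesis by (auto simp: ess_bounded_def)
qed

lemma ess_bounded_compose:
  fixes \<Phi> :: "'b::euclidean_space \<Rightarrow> 'c::euclidean_space"
  assumes f: "ess_bounded f" and \<Phi>: "continuous_on UNIV \<Phi>"
  shows "ess_bounded (\<lambda>x. \<Phi> (f x))"
proof -
  obtain B where B: "AE x in lebesgue_on \<Omega>. norm (f x) \<le> B" using f by (auto simp: ess_bounded_def)
  have "bounded (\<Phi> ` cball 0 B)"
    by (intro compact_imp_bounded compact_continuous_image continuous_on_subset[OF \<Phi>]) auto
  then obtain C where "\<forall>y\<in>cball 0 B. norm (\<Phi> y) \<le> C" by (auto simp: bounded_iff)
  then have C: "norm (\<Phi> y) \<le> C" if "norm y \<le> B" for y using that by simp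
  have "AE x in lebesgue_on \<Omega>. norm (\<Phi> (f x)) \<le> C" using B by eventually_elim (rule C)
  moreover have "(\<lambda>x. \<Phi> (f x)) \<in> borel_measurable (lebesgue_on \<Omega>)"
    by (rule measurable_compose[OF _ borel_measurable_continuous_onI[OF \<Phi>]]) (use f in \<open>simp add: ess_bounded_def\<close>)
  ultimately show ?thesis by (auto simp: ess_bounded_def)
qed

lemma ess_bounded_const: "ess_bounded (\<lambda>x. c)"
  by (auto simp: ess_bounded_def intro!: exI[of _ "norm c"])

lemma PL_ess_bounded: assumes "U \<in> PL" shows "ess_bounded U" "ess_bounded (axis_deriv j U)"
proof -
  obtain B where B: "\<And>x. x \<in> closure \<Omega> \<Longrightarrow> norm (U x) \<le> B" using PL_bounded[OF assms] by metis
  have "AE x in lebesgue_on \<Omega>. norm (U x) \<le> B" using B closure_subset[of \<Omega>] by (intro AE_I2) auto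
  then show "ess_bounded U" using PL_measurable[OF assms] by (auto simp: ess_bounded_def)
  obtain L where L: "\<forall>x\<in>mesh_interior. norm (axis_deriv j U x) \<le> L" using PL_axis_deriv(2)[OF assms] by blast
  have "AE x in lebesgue_on \<Omega>. norm (axis_deriv j U x) \<le> L"
    using AE_mesh_interior by eventually_elim (use L in blast)
  then show "ess_bounded (axis_deriv j U)" using PL_axis_deriv(1)[OF assms] by (auto simp: ess_bounded_def)
qed

lemma jet_ess_bounded: "U \<in> PL \<Longrightarrow> ess_bounded (jet U)"
  using ess_bounded_Pair[OF PL_ess_bounded(1) ess_bounded_Pair[OF PL_ess_bounded(2)[of _ 1] PL_ess_bounded(2)[of _ 2]]]
  unfolding jet_def[abs_def] by blast

text \<open>The weight that turns the stabilization, a sum over triangles, into one integral over \<open>\<Omega>\<close>.\<close>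

definition mesh_weight :: "R2 \<Rightarrow> real" where
  "mesh_weight x = (\<Sum>K\<in>\<T>. (diameter K)\<^sup>2 * indicator K x)"

lemma mesh_weight_nonneg: "mesh_weight x \<ge> 0"
  unfolding mesh_weight_def by (intro sum_nonneg) auto

lemma mesh_weight_pos:
  assumes "x \<in> mesh_interior" shows "mesh_weight x > 0"
proof -
  obtain K where K: "K \<in> \<T>" "x \<in> interior K" using assms by (auto simp: mesh_interior_def)
  obtain r where r: "r > 0" "ball x r \<subseteq> interior K" using K(2) openE[OF open_interior] by blast
  have "x + (r/2) *\<^sub>R axis 1 1 \<in> ball x r" using r(1) by (simp add: dist_norm norm_axis_1)
  then have "x \<in> K" "x + (r/2) *\<^sub>R axis 1 1 \<in> K" using r K(2) interior_subset[of K] by auto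
  from diameter_bounded_bound[OF compact_imp_bounded[OF triangle(1)[OF K(1)]] this]
  have "diameter K > 0" using r(1) by (simp add: dist_norm norm_axis_1)
  then have "0 < (diameter K)\<^sup>2 * indicator K x" using \<open>x \<in> K\<close> by simp
  also have "\<dots> \<le> mesh_weight x"
    unfolding mesh_weight_def using finite_mesh K(1) by (intro member_le_sum) auto
  finally show ?thesis .
qed

lemma indicator_ess_bounded: assumes "K \<in> \<T>" shows "ess_bounded (indicator K :: R2 \<Rightarrow> real)"
proof -
  have "K \<in> sets lebesgue" using lmeasurable_compact[OF triangle(1)[OF assms]] by (simp add: fmeasurable_def)
  then have "(indicator K :: R2 \<Rightarrow> real) \<in> borel_measurable (lebesgue_on \<Omega>)"
    by (intro measurable_restrict_space1 borel_measurable_indicator)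
  moreover have "AE x in lebesgue_on \<Omega>. norm (indicator K x :: real) \<le> 1"
    by (intro AE_I2) (simp add: indicator_def)
  ultimately show ?thesis unfolding ess_bounded_def by blast
qed

lemma ess_bounded_add: "ess_bounded f \<Longrightarrow> ess_bounded g \<Longrightarrow> ess_bounded (\<lambda>x. f x + g x)"
  using ess_bounded_compose[OF ess_bounded_Pair, of f g "\<lambda>w. fst w + snd w"] by (simp add: continuous_intros)

lemma ess_bounded_mult: "ess_bounded f \<Longrightarrow> ess_bounded g \<Longrightarrow> ess_bounded (\<lambda>x. f x * g x :: real)"
  using ess_bounded_compose[OF ess_bounded_Pair, of f g "\<lambda>w. fst w * snd w"] by (simp add: continuous_intros)

lemma ess_bounded_sum:
  assumes "finite I" "\<And>i. i \<in> I \<Longrightarrow> ess_bounded (f i)" shows "ess_bounded (\<lambda>x. \<Sum>i\<in>I. f i x)"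
  using assms by (induction I rule: finite_induct) (auto intro: ess_bounded_const ess_bounded_add)

lemma mesh_weight_ess_bounded: "ess_bounded mesh_weight"
  unfolding mesh_weight_def[abs_def]
  by (intro ess_bounded_sum finite_mesh ess_bounded_mult ess_bounded_const indicator_ess_bounded)

lemma L2_times_ess_bounded_integrable:
  fixes g h :: "R2 \<Rightarrow> 'b::euclidean_space"
  assumes g: "g \<in> L2 \<Omega>" and h: "ess_bounded h"
  shows "integrable (lebesgue_on \<Omega>) (\<lambda>x. g x \<bullet> h x)"
proof -
  interpret finite_measure "lebesgue_on \<Omega>" by (rule finite_measure_domain)
  obtain B where B: "AE x in lebesgue_on \<Omega>. norm (h x) \<le> B" using h by (auto simp: ess_bounded_def)
  have "integrable (lebesgue_on \<Omega>) (\<lambda>x. \<bar>B\<bar> * (1 + (norm (g x))\<^sup>2))"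
    using g by (intro integrable_mult_right Bochner_Integration.integrable_add) (auto simp: L2_def)
  then show ?thesis
  proof (rule Bochner_Integration.integrable_bound)
    show "(\<lambda>x. g x \<bullet> h x) \<in> borel_measurable (lebesgue_on \<Omega>)"
      using g h by (auto simp: L2_def ess_bounded_def intro!: borel_measurable_inner)
    show "AE x in lebesgue_on \<Omega>. norm (g x \<bullet> h x) \<le> norm (\<bar>B\<bar> * (1 + (norm (g x))\<^sup>2))"
      using B
    proof eventually_elim
      case (elim x)
      have "norm (g x \<bullet> h x) \<le> norm (h x) * norm (g x)" using Cauchy_Schwarz_ineq2[of "g x" "h x"] by (simp add: mult.commute)
      also have "\<dots> \<le> \<bar>B\<bar> * norm (g x)" using elim by (intro mult_right_mono) auto
      also have "norm (g x) \<le> 1 + (norm (g x))\<^sup>2"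
      proof -
        have "2 * norm (g x) \<le> 1 + (norm (g x))\<^sup>2"
          using zero_le_power2[of "norm (g x) - 1"] by (simp add: power2_eq_square algebra_simps)
        then show ?thesis using norm_ge_zero[of "g x"] by linarith
      qed
      finally show ?case by (simp add: mult_left_mono)
    qed
  qed
qed

lemma ip_eqI:
  assumes ae: "AE x in lebesgue_on \<Omega>. f x \<bullet> g x = h x" and h: "ess_bounded h"
  shows "ip \<Omega> f g = (LINT x|lebesgue_on \<Omega>. h x)"
proof -
  have hm: "h \<in> borel_measurable (lebesgue_on \<Omega>)" using h by (simp add: ess_bounded_def)
  have "AE x in lebesgue_on \<Omega>. h x = f x \<bullet> g x" using ae by eventually_elim simp
  from measurable_lebesgue_on_AE_eq[OF hm this domain_lebesgue]
  have "(\<lambda>x. f x \<bullet> g x) \<in> borel_measurable (lebesgue_on \<Omega>)" .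
  then show ?thesis unfolding ip_def by (intro integral_cong_AE hm ae)
qed

lemma AE_zero_imp_zero:
  fixes f :: "R2 \<Rightarrow> 'b::euclidean_space"
  assumes f: "continuous_on (closure \<Omega>) f" and ae: "AE x in lebesgue_on \<Omega>. f x = 0" and x: "x \<in> closure \<Omega>"
  shows "f x = 0"
proof (rule continuous_constant_on_closure[OF f _ x])
  fix y assume y: "y \<in> \<Omega>"
  have "continuous_on \<Omega> f" using f closure_subset by (rule continuous_on_subset)
  then have op: "open (\<Omega> \<inter> f -` (- {0}))" using open_domain by (rule continuous_open_preimage) auto
  have "AE x in lebesgue. x \<in> \<Omega> \<longrightarrow> f x = 0" using ae domain_lebesgue by (simp add: AE_lebesgue_on_iff)
  then have "AE x in lebesgue. x \<notin> \<Omega> \<inter> f -` (- {0})" by eventually_elim auto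
  then have "\<Omega> \<inter> f -` (- {0}) \<in> null_sets lebesgue" using op by (subst AE_iff_null_sets) auto
  then have "negligible (\<Omega> \<inter> f -` (- {0}))" by (simp add: negligible_iff_null_sets)
  then have "\<Omega> \<inter> f -` (- {0}) = {}" using open_not_negligible[OF op] by blast
  then show "f y = 0" using y by auto
qed

text \<open>The integrand depends continuously on the coefficients and is dominated as long as they stay
  bounded.\<close>

lemma integral_continuous_in_coefficients:
  fixes \<Psi> :: "real \<times> jet \<times> jet \<Rightarrow> real" and n :: nat
  assumes \<Psi>: "continuous_on UNIV \<Psi>" and Y: "\<And>k. k < n \<Longrightarrow> ess_bounded (Y k)"
    and w: "ess_bounded w" and Z: "ess_bounded Z"
    and X: "\<And>k. k < n \<Longrightarrow> (\<lambda>m::nat. X m k) \<longlonglongrightarrow> x k"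
  shows "(\<lambda>m. LINT t|lebesgue_on \<Omega>. \<Psi> (w t, \<Sum>k<n. X m k *\<^sub>R Y k t, Z t))
    \<longlonglongrightarrow> (LINT t|lebesgue_on \<Omega>. \<Psi> (w t, \<Sum>k<n. x k *\<^sub>R Y k t, Z t))"
proof -
  interpret finite_measure "lebesgue_on \<Omega>" by (rule finite_measure_domain)
  have scal: "ess_bounded (\<lambda>t. c *\<^sub>R Y k t)" if "k < n" for c k
    by (rule ess_bounded_compose[OF Y[OF that], of "\<lambda>y. c *\<^sub>R y"]) (intro continuous_intros)
  have sumb: "ess_bounded (\<lambda>t. \<Sum>k<n. c k *\<^sub>R Y k t)" for c
    by (rule ess_bounded_sum) (auto intro: scal)
  have args: "ess_bounded (\<lambda>t. (w t, \<Sum>k<n. c k *\<^sub>R Y k t, Z t))" for c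
    by (intro ess_bounded_Pair w Z sumb)
  have meas: "(\<lambda>t. \<Psi> (w t, \<Sum>k<n. c k *\<^sub>R Y k t, Z t)) \<in> borel_measurable (lebesgue_on \<Omega>)" for c
    using ess_bounded_compose[OF args \<Psi>, of c] by (simp add: ess_bounded_def)
  have "\<exists>R. \<forall>m. \<bar>X m k\<bar> \<le> R" if "k < n" for k
  proof -
    have "bounded (range (\<lambda>m. X m k))" by (rule convergent_imp_bounded[OF X[OF that]])
    then show ?thesis by (auto simp: bounded_iff)
  qed
  then obtain R where R: "\<And>k m. k < n \<Longrightarrow> \<bar>X m k\<bar> \<le> R k" by metis
  have "\<exists>B. AE t in lebesgue_on \<Omega>. norm (Y k t) \<le> B" if "k < n" for k
    using Y[OF that] by (simp add: ess_bounded_def)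
  then obtain B where B: "\<And>k. k < n \<Longrightarrow> AE t in lebesgue_on \<Omega>. norm (Y k t) \<le> B k" by metis
  obtain Bw where Bw: "AE t in lebesgue_on \<Omega>. norm (w t) \<le> Bw" using w by (auto simp: ess_bounded_def)
  obtain Bz where Bz: "AE t in lebesgue_on \<Omega>. norm (Z t) \<le> Bz" using Z by (auto simp: ess_bounded_def)
  have allB: "AE t in lebesgue_on \<Omega>. \<forall>k\<in>{..<n}. norm (Y k t) \<le> B k"
    by (rule AE_finite_allI) (auto intro: B)
  define S where "S = cball (0::real) Bw \<times> cball (0::jet) (\<Sum>k<n. R k * B k) \<times> cball (0::jet) Bz"
  have "compact S" unfolding S_def by (intro compact_Times compact_cball)
  then have "bounded (\<Psi> ` S)"
    by (intro compact_imp_bounded compact_continuous_image continuous_on_subset[OF \<Psi>]) auto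
  then obtain C where C: "\<And>s. s \<in> S \<Longrightarrow> norm (\<Psi> s) \<le> C" by (auto simp: bounded_iff)
  show ?thesis
  proof (rule integral_dominated_convergence[OF meas meas])
    show "integrable (lebesgue_on \<Omega>) (\<lambda>t. C)" by simp
    show "AE t in lebesgue_on \<Omega>. (\<lambda>m. \<Psi> (w t, \<Sum>k<n. X m k *\<^sub>R Y k t, Z t))
        \<longlonglongrightarrow> \<Psi> (w t, \<Sum>k<n. x k *\<^sub>R Y k t, Z t)"
    proof (rule AE_I2)
      fix t
      have "(\<lambda>m. (w t, \<Sum>k<n. X m k *\<^sub>R Y k t, Z t)) \<longlonglongrightarrow> (w t, \<Sum>k<n. x k *\<^sub>R Y k t, Z t)"
        by (intro tendsto_Pair tendsto_const tendsto_sum tendsto_scaleR X) simp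
      then show "(\<lambda>m. \<Psi> (w t, \<Sum>k<n. X m k *\<^sub>R Y k t, Z t)) \<longlonglongrightarrow> \<Psi> (w t, \<Sum>k<n. x k *\<^sub>R Y k t, Z t)"
        by (rule continuous_on_tendsto_compose[OF \<Psi>]) auto
    qed
    show "AE t in lebesgue_on \<Omega>. norm (\<Psi> (w t, \<Sum>k<n. X m k *\<^sub>R Y k t, Z t)) \<le> C" for m
      using allB Bw Bz
    proof eventually_elim
      case (elim t)
      have "norm (\<Sum>k<n. X m k *\<^sub>R Y k t) \<le> (\<Sum>k<n. R k * B k)"
      proof (rule sum_norm_le)
        fix k assume "k \<in> {..<n}"
        then have k: "k < n" by simp
        have R0: "R k \<ge> 0" using R[OF k, of m] by linarith
        show "norm (X m k *\<^sub>R Y k t) \<le> R k * B k"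
          unfolding norm_scaleR using R[OF k, of m] elim(1) k R0 by (intro mult_mono) auto
      qed
      then have "(w t, \<Sum>k<n. X m k *\<^sub>R Y k t, Z t) \<in> S" using elim(2,3) by (simp add: S_def)
      then show ?case by (rule C)
    qed
  qed
qed


section \<open>The discrete state space\<close>

text \<open>The three unknowns are packed into one function, so that one basis serves the whole system.\<close>

definition FE :: "(R2 \<Rightarrow> state) set" where
  "FE = {U. (\<lambda>x. fst (U x)) \<in> V_h \<Omega> \<T> \<and> (\<lambda>x. fst (snd (U x))) \<in> Q_h \<Omega> \<T> \<and> (\<lambda>x. snd (snd (U x))) \<in> W_h \<Omega> \<T>}"

lemma V_h_lincomb: "f \<in> V_h \<Omega> \<T> \<Longrightarrow> g \<in> V_h \<Omega> \<T> \<Longrightarrow> (\<lambda>x. a *\<^sub>R f x + g x) \<in> V_h \<Omega> \<T>"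
  unfolding V_h_def by (simp add: M_h_lincomb H1_0_lincomb[OF open_domain bounded_domain])

lemma M_h_ess_bounded: assumes "v \<in> M_h \<Omega> \<T>" shows "ess_bounded v"
  using PL_ess_bounded(1)[of v] assms by (simp add: PL_def)

lemma Q_h_lincomb:
  assumes "f \<in> Q_h \<Omega> \<T>" "g \<in> Q_h \<Omega> \<T>" shows "(\<lambda>x. a * f x + g x) \<in> Q_h \<Omega> \<T>"
proof -
  have M: "f \<in> M_h \<Omega> \<T>" "g \<in> M_h \<Omega> \<T>" using assms by (auto simp: Q_h_def)
  have i: "integrable (lebesgue_on \<Omega>) f" "integrable (lebesgue_on \<Omega>) g"
    using M by (auto intro: ess_bounded_integrable M_h_ess_bounded)
  have "(LINT x|lebesgue_on \<Omega>. a * f x + g x) = 0"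
    using assms i by (simp add: Q_h_def L2_0_def)
  moreover have "(\<lambda>x. a * f x + g x) \<in> L2 \<Omega>"
    using L2_lincomb(1)[of f \<Omega> g a] assms by (simp add: Q_h_def L2_0_def)
  ultimately show ?thesis using M_h_lincomb[OF M, of a] by (simp add: Q_h_def L2_0_def)
qed

lemma W_h_lincomb:
  assumes "f \<in> W_h \<Omega> \<T>" "g \<in> W_h \<Omega> \<T>" shows "(\<lambda>x. a *\<^sub>R f x + g x) \<in> W_h \<Omega> \<T>"
proof -
  have "transpose (a *\<^sub>R A + B) = a *\<^sub>R transpose A + transpose B" for A B :: M2
    by (simp add: transpose_def vec_eq_iff)
  then show ?thesis using assms unfolding W_h_def by (simp add: M_h_lincomb)
qed

text \<open>The zero velocity is \<open>v - v\<close>, which avoids approximating it by test functions.\<close>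

lemma zero_members:
  assumes "v \<in> V_h \<Omega> \<T>"
  shows "(\<lambda>x. 0) \<in> V_h \<Omega> \<T>" "(\<lambda>x. 0) \<in> Q_h \<Omega> \<T>" "(\<lambda>x. 0) \<in> W_h \<Omega> \<T>"
proof -
  show "(\<lambda>x. 0) \<in> V_h \<Omega> \<T>" using V_h_lincomb[OF assms assms, of "-1"] by simp
  show "(\<lambda>x. 0) \<in> Q_h \<Omega> \<T>" using M_h_zero by (simp add: Q_h_def L2_0_def L2_def)
  show "(\<lambda>x. 0) \<in> W_h \<Omega> \<T>" using M_h_zero by (simp add: W_h_def transpose_def vec_eq_iff)
qed

lemma FE_lincomb: "U \<in> FE \<Longrightarrow> V \<in> FE \<Longrightarrow> (\<lambda>x. a *\<^sub>R U x + V x) \<in> FE"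
  unfolding FE_def by (simp add: V_h_lincomb Q_h_lincomb W_h_lincomb)

lemma FE_PL: assumes "U \<in> FE" shows "U \<in> PL"
  unfolding PL_def
proof (intro CollectI ballI)
  fix b :: state assume "b \<in> Basis"
  then consider i where "b = (axis i 1, 0)" | "b = (0, 1, 0)" | i k where "b = (0, 0, axis i (axis k 1))"
    by (auto simp: Basis_prod_def Basis_vec_def)
  then show "(\<lambda>x. U x \<bullet> b) \<in> M_h \<Omega> \<T>"
    by cases (use assms in \<open>simp_all add: FE_def V_h_def Q_h_def W_h_def inner_prod_def inner_axis\<close>)
qed

lemma FE_sum:
  fixes n :: nat
  assumes "U0 \<in> FE" "\<And>k. k < n \<Longrightarrow> e k \<in> FE" shows "(\<lambda>x. \<Sum>k<n. c k *\<^sub>R e k x) \<in> FE"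
  using assms(2)
proof (induction n)
  case 0
  show ?case using FE_lincomb[OF assms(1) assms(1), of "-1"] by simp
next
  case (Suc n)
  then have "(\<lambda>x. c n *\<^sub>R e n x + (\<Sum>k<n. c k *\<^sub>R e k x)) \<in> FE"
    by (intro FE_lincomb) auto
  then show ?case by (simp add: add.commute)
qed

text \<open>Nodal values separate the members of \<^const>\<open>FE\<close> on the closed domain.\<close>

lemma FE_basis:
  obtains n :: nat and e where "\<And>k. k < n \<Longrightarrow> e k \<in> FE"
    "\<And>U. U \<in> FE \<Longrightarrow> \<exists>c. \<forall>x\<in>closure \<Omega>. U x = (\<Sum>k<n. c k *\<^sub>R e k x)"
    "\<And>c k. \<forall>x\<in>closure \<Omega>. (\<Sum>k<n. c k *\<^sub>R e k x) = 0 \<Longrightarrow> k < n \<Longrightarrow> c k = 0"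
proof -
  obtain P where P: "finite P" "P \<subseteq> closure \<Omega>"
    "\<And>U :: R2 \<Rightarrow> state. U \<in> PL \<Longrightarrow> \<forall>x\<in>P. U x = 0 \<Longrightarrow> \<forall>x\<in>closure \<Omega>. U x = 0"
    using mesh_nodes[where 'e = state] by metis
  let ?ev = "\<lambda>(x, b) (f :: R2 \<Rightarrow> state). f x \<bullet> b"
  have fin: "finite (P \<times> (Basis :: state set))" using P(1) by simp
  have lin: "?ev i (\<lambda>x. a *\<^sub>R f x + g x) = a * ?ev i f + ?ev i g" for i f g a
    by (cases i) (simp add: inner_add_left)
  have cl: "\<forall>f\<in>FE. \<forall>g\<in>FE. \<forall>a. (\<lambda>x. a *\<^sub>R f x + g x) \<in> FE" using FE_lincomb by blast
  obtain n :: nat and e where e: "\<forall>k<n. e k \<in> FE"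
    "\<forall>f\<in>FE. \<exists>c. \<forall>i\<in>P \<times> Basis. ?ev i f = (\<Sum>k<n. c k * ?ev i (e k))"
    "\<forall>c. (\<forall>i\<in>P \<times> Basis. (\<Sum>k<n. c k * ?ev i (e k)) = 0) \<longrightarrow> (\<forall>k<n. c k = 0)"
    using basis_relative_to_functionals[of "P \<times> Basis" ?ev FE, OF fin lin cl] by blast
  show thesis
  proof (rule that[of n e])
    show "e k \<in> FE" if "k < n" for k using e(1) that by blast
    show "\<exists>c. \<forall>x\<in>closure \<Omega>. U x = (\<Sum>k<n. c k *\<^sub>R e k x)" if U: "U \<in> FE" for U
    proof -
      obtain c where c: "\<forall>i\<in>P \<times> Basis. ?ev i U = (\<Sum>k<n. c k * ?ev i (e k))" using e(2) U by blast
      have S: "(\<lambda>x. \<Sum>k<n. c k *\<^sub>R e k x) \<in> FE" by (rule FE_sum[OF U]) (use e(1) in blast)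
      have "(\<lambda>x. (-1) *\<^sub>R (\<Sum>k<n. c k *\<^sub>R e k x) + U x) \<in> PL" by (rule FE_PL[OF FE_lincomb[OF S U]])
      moreover have "\<forall>x\<in>P. (-1) *\<^sub>R (\<Sum>k<n. c k *\<^sub>R e k x) + U x = 0"
      proof
        fix x assume x: "x \<in> P"
        have "U x \<bullet> b = (\<Sum>k<n. c k *\<^sub>R e k x) \<bullet> b" if "b \<in> Basis" for b
          using bspec[OF c, of "(x, b)"] x that by (simp add: inner_sum_left)
        then have "U x = (\<Sum>k<n. c k *\<^sub>R e k x)" by (rule euclidean_eqI)
        then show "(-1) *\<^sub>R (\<Sum>k<n. c k *\<^sub>R e k x) + U x = 0" by simp
      qed
      ultimately have "\<forall>x\<in>closure \<Omega>. (-1) *\<^sub>R (\<Sum>k<n. c k *\<^sub>R e k x) + U x = 0" by (rule P(3))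
      then show ?thesis by (intro exI[of _ c]) simp
    qed
    show "c k = 0" if c: "\<forall>x\<in>closure \<Omega>. (\<Sum>k<n. c k *\<^sub>R e k x) = 0" and k: "k < n" for c k
    proof -
      have "(\<Sum>k<n. c k * ?ev i (e k)) = 0" if i: "i \<in> P \<times> Basis" for i
      proof -
        obtain x b where xb: "i = (x, b)" "x \<in> P" using i by auto
        have "(\<Sum>k<n. c k *\<^sub>R e k x) \<bullet> b = 0" using c xb(2) P(2) by auto
        then show ?thesis by (simp add: xb(1) inner_sum_left)
      qed
      then show ?thesis using e(3) k by blast
    qed
  qed
qed

lemma mesh_interior_domain: "x \<in> mesh_interior \<Longrightarrow> x \<in> \<Omega>"
  using triangle(5) by (auto simp: mesh_interior_def)

lemma jet_agree:
  assumes V: "V \<in> FE" and eq: "\<And>x. x \<in> closure \<Omega> \<Longrightarrow> U x = V x" and x: "x \<in> mesh_interior"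
  shows "jet U x = jet V x"
proof -
  obtain D where D: "(V has_derivative D) (at x)"
    using PL_differentiable[OF FE_PL[OF V] x] by (auto simp: differentiable_def)
  have "(U has_derivative D) (at x)"
    by (rule has_derivative_transform_within_open[OF D open_domain mesh_interior_domain[OF x]])
      (use eq closure_subset[of \<Omega>] in \<open>auto simp: subset_iff\<close>)
  then show ?thesis
    using eq[of x] mesh_interior_domain[OF x] closure_subset[of \<Omega>]
    by (auto simp: jet_def axis_deriv_eqI[OF D] axis_deriv_eqI)
qed

lemma jet_sum:
  fixes n :: nat
  assumes "\<And>k. k < n \<Longrightarrow> e k \<in> FE" and x: "x \<in> mesh_interior"
  shows "jet (\<lambda>y. \<Sum>k<n. c k *\<^sub>R e k y) x = (\<Sum>k<n. c k *\<^sub>R jet (e k) x)"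
proof -
  have "axis_deriv j (\<lambda>y. \<Sum>k<n. c k *\<^sub>R e k y) x = (\<Sum>k<n. c k *\<^sub>R axis_deriv j (e k) x)" for j
    by (rule axis_deriv_sum) (use PL_differentiable[OF FE_PL x] assms(1) in blast)
  then show ?thesis by (simp add: jet_def prod_eq_iff fst_sum snd_sum)
qed

lemma jet_energy_test:
  assumes "V \<in> FE" "x \<in> mesh_interior"
  shows "jet (\<lambda>y. energy_test (V y)) x = energy_test_jet (jet V x)"
  using axis_deriv_linear[OF linear_energy_test(1) PL_differentiable[OF FE_PL[OF assms(1)] assms(2)]]
  by (simp add: jet_def energy_test_jet_def)

lemma FE_jet_ess_bounded: "U \<in> FE \<Longrightarrow> ess_bounded (jet U)"
  by (rule jet_ess_bounded[OF FE_PL])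

lemma FE_parts_ess_bounded:
  assumes "U \<in> FE" shows "ess_bounded (\<lambda>x. fst (U x))" "ess_bounded (\<lambda>x. snd (snd (U x)))"
proof -
  note compose = ess_bounded_compose[OF PL_ess_bounded(1)[OF FE_PL[OF assms]]]
  show "ess_bounded (\<lambda>x. fst (U x))" "ess_bounded (\<lambda>x. snd (snd (U x)))"
    by (rule compose[of fst], intro continuous_intros, rule compose[of "\<lambda>z. snd (snd z)"], intro continuous_intros)
qed

lemma pressure_zero:
  assumes U: "U \<in> FE" and g0: "AE x in lebesgue_on \<Omega>. gp (jet U x) = 0" and x: "x \<in> closure \<Omega>"
  shows "fst (snd (U x)) = 0"
proof -
  define p where "p x = fst (snd (U x))" for x
  have pQ: "p \<in> Q_h \<Omega> \<T>" using U by (simp add: FE_def p_def[abs_def])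
  then have pM: "p \<in> M_h \<Omega> \<T>" and mean: "(LINT x|lebesgue_on \<Omega>. p x) = 0" by (auto simp: Q_h_def L2_0_def)
  have pcont: "continuous_on (closure \<Omega>) p" using pM by (simp add: M_h_def)
  have part: "partial j p x = gp (jet U x) $ j" if "x \<in> mesh_interior" for x j
    using axis_deriv_inner[OF PL_differentiable[OF FE_PL[OF U] that], of j "(0, 1, 0)"]
    by (simp add: gp_def dj_jet p_def[abs_def] inner_prod_def)
  have "\<exists>c. \<forall>y\<in>K. p y = c" if K: "K \<in> \<T>" for K
  proof -
    obtain a c where ac: "\<forall>y\<in>K. p y = a \<bullet> y + c" using pM K unfolding M_h_def by blast
    have "\<exists>y\<in>interior K. gp (jet U y) = 0"
    proof (rule ccontr)
      assume no: "\<not> ?thesis"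
      have "AE x in lebesgue. x \<in> \<Omega> \<longrightarrow> gp (jet U x) = 0"
        using g0 domain_lebesgue by (simp add: AE_lebesgue_on_iff)
      then have "AE x in lebesgue. x \<notin> interior K"
        by eventually_elim (use no triangle(5)[OF K] in blast)
      then have "interior K \<in> null_sets lebesgue" by (subst AE_iff_null_sets) auto
      then show False
        using open_not_negligible[of "interior K"] triangle(4)[OF K] by (simp add: negligible_iff_null_sets)
    qed
    then obtain y where y: "y \<in> interior K" "gp (jet U y) = 0" by blast
    have "a $ j = 0" for j
    proof -
      have "partial j p y = a \<bullet> axis j 1" by (rule partial_eqI[OF affine_has_derivative[OF ac y(1)]])
      moreover have "y \<in> mesh_interior" using y(1) K by (auto simp: mesh_interior_def)
      ultimately show ?thesis using part[of y j] y(2) by (simp add: inner_axis)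
    qed
    then have "a = 0" by (simp add: vec_eq_iff)
    then show ?thesis using ac by auto
  qed
  then obtain C where C: "\<And>K y. K \<in> \<T> \<Longrightarrow> y \<in> K \<Longrightarrow> p y = C K" by metis
  have "p ` \<Omega> \<subseteq> C ` \<T>"
  proof
    fix r assume "r \<in> p ` \<Omega>"
    then obtain y where y: "y \<in> \<Omega>" "r = p y" by blast
    then have "y \<in> \<Union>\<T>" using closure_subset[of \<Omega>] mesh_covers by auto
    then show "r \<in> C ` \<T>" using C y(2) by blast
  qed
  then have "finite (p ` \<Omega>)" using finite_mesh finite_surj by blast
  then have "p constant_on \<Omega>"
    by (rule continuous_finite_range_constant[OF connected_domain M_h_continuous_on_domain[OF pM]])
  then obtain c where c: "\<And>y. y \<in> \<Omega> \<Longrightarrow> p y = c" by (auto simp: constant_on_def)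
  have "c = 0"
  proof (cases "\<Omega> = {}")
    case True
    then show ?thesis using x by simp
  next
    case False
    have "(LINT x|lebesgue_on \<Omega>. p x) = (LINT x|lebesgue_on \<Omega>. c)"
      by (intro Bochner_Integration.integral_cong refl) (simp add: c)
    also have "\<dots> = measure lebesgue \<Omega> * c"
      using domain_lebesgue by (simp add: measure_restrict_space)
    finally have *: "measure lebesgue \<Omega> * c = 0" using mean by simp
    have "\<Omega> \<in> lmeasurable" by (rule lmeasurable_open[OF bounded_domain open_domain])
    moreover have "\<not> negligible \<Omega>" using open_not_negligible[OF open_domain False] .
    ultimately have "measure lebesgue \<Omega> \<noteq> 0" by (simp add: negligible_iff_measure0)
    then show ?thesis using * by simp
  qed
  then have "\<And>y. y \<in> \<Omega> \<Longrightarrow> p y = 0" using c by simp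
  from continuous_constant_on_closure[OF pcont this x] show ?thesis by (simp add: p_def)
qed

lemma energy_form_nonneg:
  "a > 2 \<Longrightarrow> \<delta> > 0 \<Longrightarrow> k \<ge> 0 \<Longrightarrow> energy_form a \<delta> k y \<ge> 0"
  unfolding energy_form_def by simp

lemma energy_form_continuous:
  "continuous_on UNIV (\<lambda>w :: real \<times> jet \<times> jet. energy_form a \<delta> (fst w) (fst (snd w)))"
  unfolding energy_form_def by (intro continuous_intros continuous_on_jet)

lemma forms_continuous:
  "continuous_on UNIV (\<lambda>w. momentum_form a \<nu> \<delta> (fst w) (fst (snd w)) (snd (snd w)))"
  "continuous_on UNIV (\<lambda>w :: real \<times> jet \<times> jet. conformation_form a \<epsilon> (fst (snd w)) (snd (snd w)))"
  unfolding momentum_form_def conformation_form_def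
  by (intro continuous_intros continuous_on_jet)+

lemma form_ess_bounded:
  assumes "continuous_on UNIV (\<lambda>w. \<Phi> (fst w) (fst (snd w)) (snd (snd w)) :: real)" and "ess_bounded y" "ess_bounded z"
  shows "ess_bounded (\<lambda>x. \<Phi> (mesh_weight x) (y x) (z x))"
  using ess_bounded_compose[OF ess_bounded_Pair[OF mesh_weight_ess_bounded ess_bounded_Pair[OF assms(2,3)]] assms(1)] by simp

text \<open>The energy controls the whole state: the pressure gradient vanishes with it, and a pressure with
  zero gradient is constant on the connected domain, hence zero because its mean is zero.\<close>

lemma energy_definite:
  assumes U: "U \<in> FE" and a: "a > 2" and \<delta>: "\<delta> > 0"
    and e0: "(LINT x|lebesgue_on \<Omega>. energy_form a \<delta> (mesh_weight x) (jet U x)) = 0"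
    and x: "x \<in> closure \<Omega>"
  shows "U x = 0"
proof -
  have "ess_bounded (\<lambda>x. energy_form a \<delta> (mesh_weight x) (jet U x))"
    by (rule form_ess_bounded[of "\<lambda>k y z. energy_form a \<delta> k y", OF energy_form_continuous FE_jet_ess_bounded[OF U] FE_jet_ess_bounded[OF U]])
  then have int: "integrable (lebesgue_on \<Omega>) (\<lambda>x. energy_form a \<delta> (mesh_weight x) (jet U x))"
    by (rule ess_bounded_integrable)
  have "AE x in lebesgue_on \<Omega>. energy_form a \<delta> (mesh_weight x) (jet U x) = 0"
    using integral_nonneg_eq_0_iff_AE[OF int] e0 energy_form_nonneg[OF a \<delta> mesh_weight_nonneg] by simp
  then have ae: "AE x in lebesgue_on \<Omega>. vel (jet U x) = 0 \<and> con (jet U x) = 0 \<and> gp (jet U x) = 0"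
    using AE_mesh_interior
  proof eventually_elim
    case (elim x)
    let ?k = "mesh_weight x" and ?y = "jet U x"
    have "0 \<le> a * (vel ?y \<bullet> vel ?y)" "0 \<le> (a/2 - 1) * (con ?y \<bullet> con ?y)" "0 \<le> \<delta> * (?k * (gp ?y \<bullet> gp ?y))"
      using a \<delta> mesh_weight_nonneg[of x] by simp_all
    then have "a * (vel ?y \<bullet> vel ?y) = 0" "(a/2 - 1) * (con ?y \<bullet> con ?y) = 0" "\<delta> * (?k * (gp ?y \<bullet> gp ?y)) = 0"
      using elim(1) unfolding energy_form_def by linarith+
    then show ?case using a \<delta> mesh_weight_pos[OF elim(2)] by simp
  qed
  have "AE x in lebesgue_on \<Omega>. (fst (U x), snd (snd (U x))) = 0"
    using ae by eventually_elim (simp add: jet_parts zero_prod_def)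
  moreover have "continuous_on (closure \<Omega>) (\<lambda>x. (fst (U x), snd (snd (U x))))"
    by (intro continuous_intros PL_continuous[OF FE_PL[OF U]])
  ultimately have "(fst (U x), snd (snd (U x))) = 0" using AE_zero_imp_zero x by blast
  moreover have "fst (snd (U x)) = 0"
    by (rule pressure_zero[OF U _ x]) (use ae in \<open>auto elim: eventually_mono\<close>)
  ultimately show ?thesis by (simp add: prod_eq_iff)
qed


section \<open>The scheme as an equation between integrals of pointwise forms\<close>

lemma FE_derivatives:
  assumes U: "U \<in> FE"
  shows "AE x in lebesgue_on \<Omega>. jac \<Omega> (\<lambda>y. fst (U y)) x = Gu (jet U x)"
    "AE x in lebesgue_on \<Omega>. grad \<Omega> (\<lambda>y. fst (snd (U y))) x = gp (jet U x)"
    "AE x in lebesgue_on \<Omega>. grad \<Omega> (\<lambda>y. snd (snd (U y)) $ i $ k) x = gC i k (jet U x)"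
proof -
  note W = PL_axis_deriv(3)[OF FE_PL[OF U]]
  have "AE x in lebesgue_on \<Omega>. weak_partial \<Omega> j (\<lambda>y. fst (U y) $ i) x = fst (axis_deriv j U x) $ i" for i j
    using W[of "(axis i 1, 0)" j] by (simp add: Basis_prod_def inner_prod_def inner_axis)
  then have "AE x in lebesgue_on \<Omega>. \<forall>i j. weak_partial \<Omega> j (\<lambda>y. fst (U y) $ i) x = fst (axis_deriv j U x) $ i"
    by (intro AE_all_countable[THEN iffD2] allI)
  then show "AE x in lebesgue_on \<Omega>. jac \<Omega> (\<lambda>y. fst (U y)) x = Gu (jet U x)"
    by eventually_elim (simp add: jac_def Gu_def dj_jet vec_eq_iff)
  have "AE x in lebesgue_on \<Omega>. weak_partial \<Omega> j (\<lambda>y. fst (snd (U y))) x = fst (snd (axis_deriv j U x))" for j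
    using W[of "(0, 1, 0)" j] by (simp add: Basis_prod_def inner_prod_def)
  then have "AE x in lebesgue_on \<Omega>. \<forall>j. weak_partial \<Omega> j (\<lambda>y. fst (snd (U y))) x = fst (snd (axis_deriv j U x))"
    by (intro AE_all_countable[THEN iffD2] allI)
  then show "AE x in lebesgue_on \<Omega>. grad \<Omega> (\<lambda>y. fst (snd (U y))) x = gp (jet U x)"
    by eventually_elim (simp add: grad_def gp_def dj_jet vec_eq_iff)
  have "AE x in lebesgue_on \<Omega>. weak_partial \<Omega> j (\<lambda>y. snd (snd (U y)) $ i $ k) x = snd (snd (axis_deriv j U x)) $ i $ k" for j
    using W[of "(0, 0, axis i (axis k 1))" j]
    by (simp add: Basis_prod_def inner_prod_def inner_axis axis_in_Basis_iff)
  then have "AE x in lebesgue_on \<Omega>. \<forall>j. weak_partial \<Omega> j (\<lambda>y. snd (snd (U y)) $ i $ k) x = snd (snd (axis_deriv j U x)) $ i $ k"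
    by (intro AE_all_countable[THEN iffD2] allI)
  then show "AE x in lebesgue_on \<Omega>. grad \<Omega> (\<lambda>y. snd (snd (U y)) $ i $ k) x = gC i k (jet U x)"
    by eventually_elim (simp add: grad_def gC_def dj_jet vec_eq_iff)
qed

lemma dvg_eq_trace_jac: "dvg \<Omega> u x = trace (jac \<Omega> u x)"
  by (simp add: dvg_def trace_def jac_def)

lemma symgrad_eq_sym_part: "symgrad \<Omega> u x = sym_part (jac \<Omega> u x)"
  by (simp add: symgrad_def sym_part_def)

lemma stabilization_integral:
  assumes U: "U \<in> FE" and V: "V \<in> FE"
  shows "S_h \<Omega> \<T> \<delta> (\<lambda>x. fst (snd (U x))) (\<lambda>x. fst (snd (V x)))
    = \<delta> * (LINT x|lebesgue_on \<Omega>. mesh_weight x * (gp (jet U x) \<bullet> gp (jet V x)))"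
proof -
  let ?g = "\<lambda>U. grad \<Omega> (\<lambda>x. fst (snd (U x)))" and ?h = "\<lambda>x. gp (jet U x) \<bullet> gp (jet V x)"
  have ae: "AE x in lebesgue_on \<Omega>. ?h x = ?g U x \<bullet> ?g V x"
    using FE_derivatives(2)[OF U] FE_derivatives(2)[OF V] by eventually_elim simp
  have hb: "ess_bounded ?h"
    by (rule form_ess_bounded[of "\<lambda>k y z. gp y \<bullet> gp z", OF _ FE_jet_ess_bounded[OF U] FE_jet_ess_bounded[OF V]])
      (intro continuous_intros continuous_on_jet)
  then have "?h \<in> borel_measurable (lebesgue_on \<Omega>)" by (simp add: ess_bounded_def)
  from measurable_lebesgue_on_AE_eq[OF this ae domain_lebesgue]
  have gm: "(\<lambda>x. ?g U x \<bullet> ?g V x) \<in> borel_measurable (lebesgue_on \<Omega>)" .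
  have K: "ip K (?g U) (?g V) = (LINT x|lebesgue_on \<Omega>. indicator K x * ?h x)" if K: "K \<in> \<T>" for K
  proof -
    have "(LINT x|lebesgue_on \<Omega>. indicator K x * (?g U x \<bullet> ?g V x)) = (LINT x|lebesgue_on \<Omega>. indicator K x * ?h x)"
    proof (rule integral_cong_AE)
      have "(indicator K :: R2 \<Rightarrow> real) \<in> borel_measurable (lebesgue_on \<Omega>)"
        using indicator_ess_bounded[OF K] by (simp add: ess_bounded_def)
      then show "(\<lambda>x. indicator K x * (?g U x \<bullet> ?g V x)) \<in> borel_measurable (lebesgue_on \<Omega>)"
        by (rule borel_measurable_times[OF _ gm])
      show "(\<lambda>x. indicator K x * ?h x) \<in> borel_measurable (lebesgue_on \<Omega>)"
        using ess_bounded_mult[OF indicator_ess_bounded[OF K] hb] by (simp add: ess_bounded_def)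
      show "AE x in lebesgue_on \<Omega>. indicator K x * (?g U x \<bullet> ?g V x) = indicator K x * ?h x"
        using ae by eventually_elim simp
    qed
    then show ?thesis using ip_triangle[OF K gm] by simp
  qed
  have "(\<Sum>K\<in>\<T>. (diameter K)\<^sup>2 * ip K (?g U) (?g V)) = (\<Sum>K\<in>\<T>. (LINT x|lebesgue_on \<Omega>. (diameter K)\<^sup>2 * (indicator K x * ?h x)))"
    using K by (intro sum.cong) simp_all
  also have "\<dots> = (LINT x|lebesgue_on \<Omega>. (\<Sum>K\<in>\<T>. (diameter K)\<^sup>2 * (indicator K x * ?h x)))"
  proof (rule Bochner_Integration.integral_sum[symmetric])
    fix K assume "K \<in> \<T>"
    then show "integrable (lebesgue_on \<Omega>) (\<lambda>x. (diameter K)\<^sup>2 * (indicator K x * ?h x))"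
      by (intro integrable_mult_right ess_bounded_integrable ess_bounded_mult indicator_ess_bounded hb)
  qed
  also have "\<dots> = (LINT x|lebesgue_on \<Omega>. mesh_weight x * ?h x)"
    by (intro Bochner_Integration.integral_cong refl) (simp add: mesh_weight_def sum_distrib_right mult.assoc)
  finally show ?thesis by (simp add: S_h_def)
qed

text \<open>The \<open>L\<^sup>2\<close> products of the scheme contain chosen weak derivatives; replacing these by the classical
  ones gives integrals of essentially bounded functions, which can be added.\<close>

lemma momentum_identity:
  assumes U: "U \<in> FE" and V: "V \<in> FE" and uo: "uo \<in> L2 \<Omega>" and f: "f \<in> L2 \<Omega>"
  shows "ip \<Omega> (\<lambda>x. a *\<^sub>R (fst (U x) - uo x)) (\<lambda>x. fst (V x))
      + A_h \<Omega> \<T> \<nu> \<delta> (\<lambda>x. fst (U x), \<lambda>x. fst (snd (U x))) (\<lambda>x. fst (V x), \<lambda>x. fst (snd (V x)))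
      + ip \<Omega> (\<lambda>x. trace (snd (snd (U x))) *\<^sub>R snd (snd (U x))) (jac \<Omega> (\<lambda>x. fst (V x))) - ip \<Omega> f (\<lambda>x. fst (V x))
    = (LINT x|lebesgue_on \<Omega>. momentum_form a \<nu> \<delta> (mesh_weight x) (jet U x) (jet V x))
      - (LINT x|lebesgue_on \<Omega>. (a *\<^sub>R uo x + f x) \<bullet> fst (V x))"
proof -
  let ?y = "jet U" and ?z = "jet V" and ?I = "\<lambda>h. LINT x|lebesgue_on \<Omega>. h x :: real"
  note FB = form_ess_bounded[OF _ FE_jet_ess_bounded[OF U] FE_jet_ess_bounded[OF V]]
  have e1: "ess_bounded (\<lambda>x. vel (?y x) \<bullet> vel (?z x))"
    by (rule FB[of "\<lambda>k y z. vel y \<bullet> vel z"]) (intro continuous_intros continuous_on_jet)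
  have e2: "ess_bounded (\<lambda>x. sym_part (Gu (?y x)) \<bullet> sym_part (Gu (?z x)))"
    by (rule FB[of "\<lambda>k y z. sym_part (Gu y) \<bullet> sym_part (Gu z)"]) (intro continuous_intros continuous_on_jet)
  have e3: "ess_bounded (\<lambda>x. trace (Gu (?y x)) * pre (?z x))"
    by (rule FB[of "\<lambda>k y z. trace (Gu y) * pre z"]) (intro continuous_intros continuous_on_jet)
  have e4: "ess_bounded (\<lambda>x. trace (Gu (?z x)) * pre (?y x))"
    by (rule FB[of "\<lambda>k y z. trace (Gu z) * pre y"]) (intro continuous_intros continuous_on_jet)
  have e5: "ess_bounded (\<lambda>x. mesh_weight x * (gp (?y x) \<bullet> gp (?z x)))"
    by (rule FB[of "\<lambda>k y z. k * (gp y \<bullet> gp z)"]) (intro continuous_intros continuous_on_jet)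
  have e6: "ess_bounded (\<lambda>x. trace (con (?y x)) * (con (?y x) \<bullet> Gu (?z x)))"
    by (rule FB[of "\<lambda>k y z. trace (con y) * (con y \<bullet> Gu z)"]) (intro continuous_intros continuous_on_jet)
  note E = e1[THEN ess_bounded_integrable] e2[THEN ess_bounded_integrable] e3[THEN ess_bounded_integrable]
    e4[THEN ess_bounded_integrable] e5[THEN ess_bounded_integrable] e6[THEN ess_bounded_integrable]
  note D = L2_times_ess_bounded_integrable[OF uo FE_parts_ess_bounded(1)[OF V]]
    L2_times_ess_bounded_integrable[OF f FE_parts_ess_bounded(1)[OF V]]
  note JU = FE_derivatives(1)[OF U] and JV = FE_derivatives(1)[OF V]
  have t1: "ip \<Omega> (\<lambda>x. a *\<^sub>R (fst (U x) - uo x)) (\<lambda>x. fst (V x))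
      = a * ?I (\<lambda>x. vel (?y x) \<bullet> vel (?z x)) - a * ?I (\<lambda>x. uo x \<bullet> fst (V x))"
  proof -
    have "ip \<Omega> (\<lambda>x. a *\<^sub>R (fst (U x) - uo x)) (\<lambda>x. fst (V x))
        = ?I (\<lambda>x. a * (vel (?y x) \<bullet> vel (?z x)) - a * (uo x \<bullet> fst (V x)))"
      unfolding ip_def by (simp add: jet_parts inner_diff_left right_diff_distrib)
    then show ?thesis using E(1) D(1) by simp
  qed
  have t2: "a_u \<Omega> (\<lambda>x. fst (U x)) (\<lambda>x. fst (V x)) = 2 * ?I (\<lambda>x. sym_part (Gu (?y x)) \<bullet> sym_part (Gu (?z x)))"
    unfolding a_u_def
  proof (subst ip_eqI[OF _ e2])
    show "AE x in lebesgue_on \<Omega>. symgrad \<Omega> (\<lambda>x. fst (U x)) x \<bullet> symgrad \<Omega> (\<lambda>x. fst (V x)) x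
        = sym_part (Gu (?y x)) \<bullet> sym_part (Gu (?z x))"
      using JU JV by eventually_elim (simp add: symgrad_eq_sym_part)
  qed simp
  have t3: "b_form \<Omega> (\<lambda>x. fst (U x)) (\<lambda>x. fst (snd (V x))) = - ?I (\<lambda>x. trace (Gu (?y x)) * pre (?z x))"
    unfolding b_form_def
  proof (subst ip_eqI[OF _ e3])
    show "AE x in lebesgue_on \<Omega>. dvg \<Omega> (\<lambda>x. fst (U x)) x \<bullet> fst (snd (V x)) = trace (Gu (?y x)) * pre (?z x)"
      using JU by eventually_elim (simp add: dvg_eq_trace_jac jet_parts)
  qed simp
  have t4: "b_form \<Omega> (\<lambda>x. fst (V x)) (\<lambda>x. fst (snd (U x))) = - ?I (\<lambda>x. trace (Gu (?z x)) * pre (?y x))"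
    unfolding b_form_def
  proof (subst ip_eqI[OF _ e4])
    show "AE x in lebesgue_on \<Omega>. dvg \<Omega> (\<lambda>x. fst (V x)) x \<bullet> fst (snd (U x)) = trace (Gu (?z x)) * pre (?y x)"
      using JV by eventually_elim (simp add: dvg_eq_trace_jac jet_parts)
  qed simp
  have t6: "ip \<Omega> (\<lambda>x. trace (snd (snd (U x))) *\<^sub>R snd (snd (U x))) (jac \<Omega> (\<lambda>x. fst (V x)))
      = ?I (\<lambda>x. trace (con (?y x)) * (con (?y x) \<bullet> Gu (?z x)))"
  proof (rule ip_eqI[OF _ e6])
    show "AE x in lebesgue_on \<Omega>. trace (snd (snd (U x))) *\<^sub>R snd (snd (U x)) \<bullet> jac \<Omega> (\<lambda>x. fst (V x)) x
        = trace (con (?y x)) * (con (?y x) \<bullet> Gu (?z x))"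
      using JV by eventually_elim (simp add: jet_parts)
  qed
  have rhs: "?I (\<lambda>x. momentum_form a \<nu> \<delta> (mesh_weight x) (?y x) (?z x))
      = a * ?I (\<lambda>x. vel (?y x) \<bullet> vel (?z x)) + \<nu> * (2 * ?I (\<lambda>x. sym_part (Gu (?y x)) \<bullet> sym_part (Gu (?z x))))
        - ?I (\<lambda>x. trace (Gu (?y x)) * pre (?z x)) - ?I (\<lambda>x. trace (Gu (?z x)) * pre (?y x))
        - \<delta> * ?I (\<lambda>x. mesh_weight x * (gp (?y x) \<bullet> gp (?z x)))
        + ?I (\<lambda>x. trace (con (?y x)) * (con (?y x) \<bullet> Gu (?z x)))"
    unfolding momentum_form_def using E by simp
  have data: "?I (\<lambda>x. (a *\<^sub>R uo x + f x) \<bullet> fst (V x)) = a * ?I (\<lambda>x. uo x \<bullet> fst (V x)) + ?I (\<lambda>x. f x \<bullet> fst (V x))"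
    using D by (simp add: inner_add_left)
  show ?thesis
    unfolding A_h_def split t1 t2 t3 t4 t6 rhs data stabilization_integral[OF U V]
    by (simp add: ip_def)
qed

lemma conformation_identity:
  assumes U: "U \<in> FE" and V: "V \<in> FE" and Co: "Co \<in> L2 \<Omega>" and F: "F \<in> L2 \<Omega>"
  defines "u \<equiv> \<lambda>x. fst (U x)" and "C \<equiv> \<lambda>x. snd (snd (U x))" and "D \<equiv> \<lambda>x. snd (snd (V x))"
  shows "ip \<Omega> (\<lambda>x. a *\<^sub>R (C x - Co x)) D + \<epsilon> * a_c \<Omega> C D
      - (2 * ip \<Omega> (\<lambda>x. jac \<Omega> u x ** C x) D + ip \<Omega> (\<lambda>x. dvg \<Omega> u x *\<^sub>R sharp (C x)) D
          - ip \<Omega> (\<lambda>x. (trace (C x))\<^sup>2 *\<^sub>R C x) D + ip \<Omega> (\<lambda>x. trace (C x) *\<^sub>R mat 1) D + ip \<Omega> F D)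
    = (LINT x|lebesgue_on \<Omega>. conformation_form a \<epsilon> (jet U x) (jet V x))
      - (LINT x|lebesgue_on \<Omega>. (a *\<^sub>R Co x + F x) \<bullet> D x)"
proof -
  let ?y = "jet U" and ?z = "jet V" and ?I = "\<lambda>h. LINT x|lebesgue_on \<Omega>. h x :: real"
  note FB = form_ess_bounded[OF _ FE_jet_ess_bounded[OF U] FE_jet_ess_bounded[OF V]]
  have e1: "ess_bounded (\<lambda>x. con (?y x) \<bullet> con (?z x))"
    by (rule FB[of "\<lambda>k y z. con y \<bullet> con z"]) (intro continuous_intros continuous_on_jet)
  have e2: "ess_bounded (\<lambda>x. gC i k (?y x) \<bullet> gC i k (?z x))" for i k
    by (rule FB[of "\<lambda>w y z. gC i k y \<bullet> gC i k z"]) (intro continuous_intros continuous_on_jet)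
  have e3: "ess_bounded (\<lambda>x. (Gu (?y x) ** con (?y x)) \<bullet> con (?z x))"
    by (rule FB[of "\<lambda>k y z. (Gu y ** con y) \<bullet> con z"]) (intro continuous_intros continuous_on_jet)
  have e4: "ess_bounded (\<lambda>x. trace (Gu (?y x)) * (sharp (con (?y x)) \<bullet> con (?z x)))"
    by (rule FB[of "\<lambda>k y z. trace (Gu y) * (sharp (con y) \<bullet> con z)"]) (intro continuous_intros continuous_on_jet)
  have e5: "ess_bounded (\<lambda>x. (trace (con (?y x)))\<^sup>2 * (con (?y x) \<bullet> con (?z x)))"
    by (rule FB[of "\<lambda>k y z. (trace (con y))\<^sup>2 * (con y \<bullet> con z)"]) (intro continuous_intros continuous_on_jet)
  have e6: "ess_bounded (\<lambda>x. trace (con (?y x)) * (mat 1 \<bullet> con (?z x)))"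
    by (rule FB[of "\<lambda>k y z. trace (con y) * (mat 1 \<bullet> con z)"]) (intro continuous_intros continuous_on_jet)
  note E = e1[THEN ess_bounded_integrable] e2[THEN ess_bounded_integrable] e3[THEN ess_bounded_integrable]
    e4[THEN ess_bounded_integrable] e5[THEN ess_bounded_integrable] e6[THEN ess_bounded_integrable]
  have Db: "ess_bounded D" using FE_parts_ess_bounded(2)[OF V] by (simp add: D_def)
  note L = L2_times_ess_bounded_integrable[OF Co Db] L2_times_ess_bounded_integrable[OF F Db]
  note J = FE_derivatives(1)[OF U, folded u_def]
  have CD: "con (?y x) = C x" "con (?z x) = D x" for x by (simp_all add: jet_parts C_def D_def)
  have t1: "ip \<Omega> (\<lambda>x. a *\<^sub>R (C x - Co x)) D = a * ?I (\<lambda>x. con (?y x) \<bullet> con (?z x)) - a * ?I (\<lambda>x. Co x \<bullet> D x)"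
  proof -
    have "ip \<Omega> (\<lambda>x. a *\<^sub>R (C x - Co x)) D = ?I (\<lambda>x. a * (con (?y x) \<bullet> con (?z x)) - a * (Co x \<bullet> D x))"
      unfolding ip_def by (simp add: CD inner_diff_left right_diff_distrib)
    then show ?thesis using E(1) L(1) by simp
  qed
  have t2: "a_c \<Omega> C D = (\<Sum>i\<in>UNIV. \<Sum>k\<in>UNIV. ?I (\<lambda>x. gC i k (?y x) \<bullet> gC i k (?z x)))"
    unfolding a_c_def
  proof (intro sum.cong refl ip_eqI e2)
    fix i k :: 2
    show "AE x in lebesgue_on \<Omega>. grad \<Omega> (\<lambda>x. C x $ i $ k) x \<bullet> grad \<Omega> (\<lambda>x. D x $ i $ k) x = gC i k (?y x) \<bullet> gC i k (?z x)"
      using FE_derivatives(3)[OF U, of i k] FE_derivatives(3)[OF V, of i k]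
      unfolding C_def D_def by eventually_elim simp
  qed
  have t3: "ip \<Omega> (\<lambda>x. jac \<Omega> u x ** C x) D = ?I (\<lambda>x. (Gu (?y x) ** con (?y x)) \<bullet> con (?z x))"
  proof (rule ip_eqI[OF _ e3])
    show "AE x in lebesgue_on \<Omega>. (jac \<Omega> u x ** C x) \<bullet> D x = (Gu (?y x) ** con (?y x)) \<bullet> con (?z x)"
      using J by eventually_elim (simp add: CD)
  qed
  have t4: "ip \<Omega> (\<lambda>x. dvg \<Omega> u x *\<^sub>R sharp (C x)) D = ?I (\<lambda>x. trace (Gu (?y x)) * (sharp (con (?y x)) \<bullet> con (?z x)))"
  proof (rule ip_eqI[OF _ e4])
    show "AE x in lebesgue_on \<Omega>. dvg \<Omega> u x *\<^sub>R sharp (C x) \<bullet> D x = trace (Gu (?y x)) * (sharp (con (?y x)) \<bullet> con (?z x))"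
      using J by eventually_elim (simp add: CD dvg_eq_trace_jac)
  qed
  have t5: "ip \<Omega> (\<lambda>x. (trace (C x))\<^sup>2 *\<^sub>R C x) D = ?I (\<lambda>x. (trace (con (?y x)))\<^sup>2 * (con (?y x) \<bullet> con (?z x)))"
    by (simp add: ip_def CD)
  have t6: "ip \<Omega> (\<lambda>x. trace (C x) *\<^sub>R mat 1) D = ?I (\<lambda>x. trace (con (?y x)) * (mat 1 \<bullet> con (?z x)))"
    by (simp add: ip_def CD)
  have rhs: "?I (\<lambda>x. conformation_form a \<epsilon> (?y x) (?z x))
      = a * ?I (\<lambda>x. con (?y x) \<bullet> con (?z x)) + \<epsilon> * (\<Sum>i\<in>UNIV. \<Sum>k\<in>UNIV. ?I (\<lambda>x. gC i k (?y x) \<bullet> gC i k (?z x)))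
        - 2 * ?I (\<lambda>x. (Gu (?y x) ** con (?y x)) \<bullet> con (?z x)) - ?I (\<lambda>x. trace (Gu (?y x)) * (sharp (con (?y x)) \<bullet> con (?z x)))
        + ?I (\<lambda>x. (trace (con (?y x)))\<^sup>2 * (con (?y x) \<bullet> con (?z x))) - ?I (\<lambda>x. trace (con (?y x)) * (mat 1 \<bullet> con (?z x)))"
    unfolding conformation_form_def using E by simp
  have data: "?I (\<lambda>x. (a *\<^sub>R Co x + F x) \<bullet> D x) = a * ?I (\<lambda>x. Co x \<bullet> D x) + ?I (\<lambda>x. F x \<bullet> D x)"
    using L by (simp add: inner_add_left)
  show ?thesis
    unfolding t1 t2 t3 t4 t5 t6 rhs data by (simp add: ip_def)
qed


section \<open>One time step\<close>

lemma FE_energy_test_inverse: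
  assumes V: "V \<in> FE"
  obtains V' where "V' \<in> FE" "\<And>x. V x = energy_test (V' x)"
proof -
  define V' :: "R2 \<Rightarrow> state" where "V' x = (fst (V x), - fst (snd (V x)), 2 *\<^sub>R snd (snd (V x)))" for x
  have z: "(\<lambda>x. 0) \<in> Q_h \<Omega> \<T>" "(\<lambda>x. 0) \<in> W_h \<Omega> \<T>"
    using zero_members[of "\<lambda>x. fst (V x)"] V by (auto simp: FE_def)
  have "V' \<in> FE"
    using V Q_h_lincomb[OF _ z(1), of _ "-1"] W_h_lincomb[OF _ z(2), of _ 2]
    by (simp add: FE_def V'_def)
  moreover have "V x = energy_test (V' x)" for x by (simp add: V'_def energy_test_def)
  ultimately show thesis by (rule that)
qed

text \<open>The Galerkin system in the coordinates of a basis of the discrete space is tested with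
  \<open>(u, -p, C/2)\<close>. The energy form then bounds it from below, so the system is coercive.\<close>

lemma step_exists:
  assumes v0: "v0 \<in> V_h \<Omega> \<T>" and a: "a > 2" and \<nu>: "\<nu> > 0" and \<epsilon>: "\<epsilon> \<ge> 0" and \<delta>: "\<delta> > 0"
    and g: "g1 \<in> L2 \<Omega>" "g2 \<in> L2 \<Omega>"
  shows "\<exists>U\<in>FE. \<forall>V\<in>FE. (LINT x|lebesgue_on \<Omega>. momentum_form a \<nu> \<delta> (mesh_weight x) (jet U x) (jet V x)
      + conformation_form a \<epsilon> (jet U x) (jet V x))
    = (LINT x|lebesgue_on \<Omega>. g1 x \<bullet> fst (V x) + g2 x \<bullet> snd (snd (V x)))"
proof -
  define B where "B k y z = momentum_form a \<nu> \<delta> k y z + conformation_form a \<epsilon> y z" for k y z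
  have Bcont: "continuous_on UNIV (\<lambda>w. B (fst w) (fst (snd w)) (snd (snd w)))"
    unfolding B_def by (intro continuous_on_add forms_continuous)
  have Blin: "linear (B k y)" for k y
    unfolding B_def by (intro linear_compose_add linear_forms)
  define l where "l V = (LINT x|lebesgue_on \<Omega>. g1 x \<bullet> fst (V x) + g2 x \<bullet> snd (snd (V x)))" for V :: "R2 \<Rightarrow> state"
  obtain n :: nat and e where e: "\<And>k. k < n \<Longrightarrow> e k \<in> FE"
    "\<And>U. U \<in> FE \<Longrightarrow> \<exists>c. \<forall>x\<in>closure \<Omega>. U x = (\<Sum>k<n. c k *\<^sub>R e k x)"
    "\<And>c k. \<forall>x\<in>closure \<Omega>. (\<Sum>k<n. c k *\<^sub>R e k x) = 0 \<Longrightarrow> k < n \<Longrightarrow> c k = 0"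
    by (rule FE_basis) blast
  have z0: "(\<lambda>x. 0) \<in> FE" using zero_members[OF v0] by (simp add: FE_def)
  define Y where "Y c x = (\<Sum>k<n. c k *\<^sub>R jet (e k) x)" for c x
  define Uc where "Uc c x = (\<Sum>k<n. c k *\<^sub>R e k x)" for c x
  define T where "T k x = energy_test_jet (jet (e k) x)" for k x
  have UcFE: "Uc c \<in> FE" for c unfolding Uc_def[abs_def] by (rule FE_sum[OF z0 e(1)])
  have jetUc: "jet (Uc c) x = Y c x" if "x \<in> mesh_interior" for c x
    unfolding Uc_def[abs_def] Y_def by (rule jet_sum[OF e(1) that])
  have eb: "ess_bounded (jet (e k))" if "k < n" for k by (rule FE_jet_ess_bounded[OF e(1)[OF that]])
  have Tb: "ess_bounded (T k)" if "k < n" for k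
    unfolding T_def[abs_def]
    by (rule ess_bounded_compose[OF eb[OF that]]) (intro continuous_on_linear[OF linear_energy_test(2)] continuous_on_id)
  have scal: "ess_bounded (\<lambda>x. c *\<^sub>R jet (e k) x)" if "k < n" for c k
    by (rule ess_bounded_compose[OF eb[OF that], of "\<lambda>y. c *\<^sub>R y"]) (intro continuous_intros)
  have Yb: "ess_bounded (Y c)" for c
    unfolding Y_def[abs_def] by (rule ess_bounded_sum) (auto intro: scal)
  have ETb: "ess_bounded (\<lambda>x. energy_test_jet (Y c x))" for c
    by (rule ess_bounded_compose[OF Yb]) (intro continuous_on_linear[OF linear_energy_test(2)] continuous_on_id)
  have Bint: "integrable (lebesgue_on \<Omega>) (\<lambda>x. B (mesh_weight x) (y x) (z x))" if "ess_bounded y" "ess_bounded z" for y z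
    by (rule ess_bounded_integrable[OF form_ess_bounded[OF Bcont that]])
  define F where "F c k = (LINT x|lebesgue_on \<Omega>. B (mesh_weight x) (Y c x) (T k x)) - l (\<lambda>x. energy_test (e k x))" for c k
  define q where "q c = (LINT x|lebesgue_on \<Omega>. energy_form a \<delta> (mesh_weight x) (Y c x))" for c
  have qint: "integrable (lebesgue_on \<Omega>) (\<lambda>x. energy_form a \<delta> (mesh_weight x) (Y c x))" for c
    by (rule ess_bounded_integrable[OF form_ess_bounded[of "\<lambda>k y z. energy_form a \<delta> k y", OF energy_form_continuous Yb Yb]])
  have Bsum: "(LINT x|lebesgue_on \<Omega>. B (mesh_weight x) (Y c x) (\<Sum>k<n. d k *\<^sub>R T k x))
      = (\<Sum>k<n. d k * (LINT x|lebesgue_on \<Omega>. B (mesh_weight x) (Y c x) (T k x)))" for c d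
  proof -
    have "B (mesh_weight x) (Y c x) (\<Sum>k<n. d k *\<^sub>R T k x) = (\<Sum>k<n. d k * B (mesh_weight x) (Y c x) (T k x))" for x
      by (simp add: linear_sum[OF Blin] linear_scale[OF Blin])
    then have "(LINT x|lebesgue_on \<Omega>. B (mesh_weight x) (Y c x) (\<Sum>k<n. d k *\<^sub>R T k x))
      = (LINT x|lebesgue_on \<Omega>. (\<Sum>k<n. d k * B (mesh_weight x) (Y c x) (T k x)))" by simp
    also have "\<dots> = (\<Sum>k<n. (LINT x|lebesgue_on \<Omega>. d k * B (mesh_weight x) (Y c x) (T k x)))"
      by (rule Bochner_Integration.integral_sum) (intro integrable_mult_right Bint Yb Tb, simp)
    finally show ?thesis by simp
  qed
  have "\<exists>c. \<forall>k<n. F c k = 0"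
  proof (rule zero_of_coercive_map[where q = q and l = "\<lambda>k. l (\<lambda>x. energy_test (e k x))"])
    show "(\<lambda>m. F (X m) i) \<longlonglongrightarrow> F x i" if X: "\<And>j. j < n \<Longrightarrow> (\<lambda>m::nat. X m j) \<longlonglongrightarrow> x j" and i: "i < n" for X x i
      unfolding F_def Y_def
      using integral_continuous_in_coefficients[OF Bcont eb mesh_weight_ess_bounded Tb[OF i] X]
      by (intro tendsto_diff tendsto_const) simp
    show "(\<lambda>m. q (X m)) \<longlonglongrightarrow> q x" if X: "\<And>j. j < n \<Longrightarrow> (\<lambda>m::nat. X m j) \<longlonglongrightarrow> x j" for X x
      unfolding q_def Y_def
      using integral_continuous_in_coefficients[OF energy_form_continuous eb mesh_weight_ess_bounded ess_bounded_const X]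
      by simp
    show "q (\<lambda>i. t * x i) = t\<^sup>2 * q x" for t x
    proof -
      have "Y (\<lambda>i. t * x i) y = t *\<^sub>R Y x y" for y by (simp add: Y_def scaleR_sum_right)
      moreover have "energy_form a \<delta> k (t *\<^sub>R y) = t\<^sup>2 * energy_form a \<delta> k y" for k y
        by (simp add: energy_form_def jet_scale power2_eq_square algebra_simps)
      ultimately show ?thesis by (simp add: q_def)
    qed
    show "q x > 0" if i: "i < n" "x i \<noteq> 0" for x i
    proof (rule ccontr)
      assume "\<not> q x > 0"
      moreover have "q x \<ge> 0"
        unfolding q_def by (intro integral_nonneg_AE AE_I2 energy_form_nonneg a \<delta> mesh_weight_nonneg)
      ultimately have q0: "q x = 0" by simp
      have "(LINT y|lebesgue_on \<Omega>. energy_form a \<delta> (mesh_weight y) (jet (Uc x) y)) = q x"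
        unfolding q_def
      proof (rule integral_cong_AE)
        show "(\<lambda>y. energy_form a \<delta> (mesh_weight y) (jet (Uc x) y)) \<in> borel_measurable (lebesgue_on \<Omega>)"
          using form_ess_bounded[of "\<lambda>k y z. energy_form a \<delta> k y", OF energy_form_continuous FE_jet_ess_bounded[OF UcFE] FE_jet_ess_bounded[OF UcFE]]
          by (simp add: ess_bounded_def)
        show "(\<lambda>y. energy_form a \<delta> (mesh_weight y) (Y x y)) \<in> borel_measurable (lebesgue_on \<Omega>)"
          by (rule borel_measurable_integrable[OF qint])
        show "AE y in lebesgue_on \<Omega>. energy_form a \<delta> (mesh_weight y) (jet (Uc x) y) = energy_form a \<delta> (mesh_weight y) (Y x y)"
          using AE_mesh_interior by eventually_elim (simp add: jetUc)
      qed
      then have "\<forall>y\<in>closure \<Omega>. (\<Sum>k<n. x k *\<^sub>R e k y) = 0"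
        using energy_definite[OF UcFE a \<delta>, of x] q0 by (simp add: Uc_def)
      then show False using e(3) i by blast
    qed
    show "(\<Sum>k<n. c k * F c k) \<ge> q c - (\<Sum>k<n. c k * l (\<lambda>x. energy_test (e k x)))" for c
    proof -
      have "energy_test_jet (Y c x) = (\<Sum>k<n. c k *\<^sub>R T k x)" for x
        by (simp add: Y_def T_def linear_sum[OF linear_energy_test(2)] linear_scale[OF linear_energy_test(2)])
      then have eq: "(\<Sum>k<n. c k * (LINT x|lebesgue_on \<Omega>. B (mesh_weight x) (Y c x) (T k x)))
          = (LINT x|lebesgue_on \<Omega>. B (mesh_weight x) (Y c x) (energy_test_jet (Y c x)))"
        using Bsum[of c c] by simp
      have "q c \<le> (LINT x|lebesgue_on \<Omega>. B (mesh_weight x) (Y c x) (energy_test_jet (Y c x)))"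
        unfolding q_def
      proof (rule integral_mono_AE[OF qint Bint[OF Yb ETb]])
        show "AE x in lebesgue_on \<Omega>. energy_form a \<delta> (mesh_weight x) (Y c x)
            \<le> B (mesh_weight x) (Y c x) (energy_test_jet (Y c x))"
          using AE_mesh_interior
        proof eventually_elim
          case (elim x)
          have "x \<in> closure \<Omega>" using mesh_interior_domain[OF elim] closure_subset by auto
          moreover have "(\<lambda>x. snd (snd (Uc c x))) \<in> W_h \<Omega> \<T>" using UcFE[of c] by (simp add: FE_def)
          ultimately have "transpose (con (jet (Uc c) x)) = con (jet (Uc c) x)"
            unfolding jet_parts by (simp add: W_h_def)
          then show ?case
            unfolding B_def using \<nu> \<epsilon> by (intro energy_estimate) (simp_all add: jetUc[OF elim])
        qed
      qed
      then show ?thesis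
        unfolding F_def right_diff_distrib sum_subtractf eq by simp
    qed
  qed
  then obtain c where c: "\<And>k. k < n \<Longrightarrow> F c k = 0" by blast
  have "(LINT x|lebesgue_on \<Omega>. momentum_form a \<nu> \<delta> (mesh_weight x) (jet (Uc c) x) (jet V x)
      + conformation_form a \<epsilon> (jet (Uc c) x) (jet V x)) = l V" if V: "V \<in> FE" for V
  proof -
    obtain V' where V': "V' \<in> FE" "\<And>x. V x = energy_test (V' x)" using FE_energy_test_inverse[OF V] by metis
    obtain d where d: "\<forall>x\<in>closure \<Omega>. V' x = Uc d x" using e(2)[OF V'(1)] by (auto simp: Uc_def)
    have jV: "jet V x = (\<Sum>k<n. d k *\<^sub>R T k x)" if x: "x \<in> mesh_interior" for x
    proof -
      have "V = (\<lambda>x. energy_test (V' x))" using V'(2) by blast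
      then have "jet V x = energy_test_jet (jet V' x)" using jet_energy_test[OF V'(1) x] by simp
      also have "jet V' x = Y d x" using jet_agree[OF UcFE[of d] _ x] d jetUc[OF x] by simp
      finally show ?thesis
        by (simp add: Y_def T_def linear_sum[OF linear_energy_test(2)] linear_scale[OF linear_energy_test(2)])
    qed
    have "(LINT x|lebesgue_on \<Omega>. B (mesh_weight x) (jet (Uc c) x) (jet V x))
        = (LINT x|lebesgue_on \<Omega>. B (mesh_weight x) (Y c x) (\<Sum>k<n. d k *\<^sub>R T k x))"
    proof (rule integral_cong_AE)
      show "(\<lambda>x. B (mesh_weight x) (jet (Uc c) x) (jet V x)) \<in> borel_measurable (lebesgue_on \<Omega>)"
        by (rule borel_measurable_integrable[OF Bint[OF FE_jet_ess_bounded[OF UcFE] FE_jet_ess_bounded[OF V]]])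
      have "ess_bounded (\<lambda>x. \<Sum>k<n. d k *\<^sub>R T k x)"
      proof (rule ess_bounded_sum)
        fix k assume "k \<in> {..<n}"
        then show "ess_bounded (\<lambda>x. d k *\<^sub>R T k x)"
          by (intro ess_bounded_compose[OF Tb, of k "\<lambda>y. d k *\<^sub>R y"] continuous_intros) simp
      qed simp
      then show "(\<lambda>x. B (mesh_weight x) (Y c x) (\<Sum>k<n. d k *\<^sub>R T k x)) \<in> borel_measurable (lebesgue_on \<Omega>)"
        by (rule borel_measurable_integrable[OF Bint[OF Yb]])
      show "AE x in lebesgue_on \<Omega>. B (mesh_weight x) (jet (Uc c) x) (jet V x)
          = B (mesh_weight x) (Y c x) (\<Sum>k<n. d k *\<^sub>R T k x)"
        using AE_mesh_interior by eventually_elim (simp add: jetUc jV)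
    qed
    also have "\<dots> = (\<Sum>k<n. d k * l (\<lambda>x. energy_test (e k x)))"
      unfolding Bsum using c by (intro sum.cong) (simp_all add: F_def)
    also have "\<dots> = l V"
    proof -
      have int: "integrable (lebesgue_on \<Omega>) (\<lambda>x. g1 x \<bullet> fst (energy_test (e k x)) + g2 x \<bullet> snd (snd (energy_test (e k x))))"
        if "k < n" for k
      proof -
        have "ess_bounded (\<lambda>x. (1/2) *\<^sub>R snd (snd (e k x)))"
          by (rule ess_bounded_compose[OF FE_parts_ess_bounded(2)[OF e(1)[OF that]], of "\<lambda>y. (1/2) *\<^sub>R y"]) (intro continuous_intros)
        from L2_times_ess_bounded_integrable[OF g(2) this] L2_times_ess_bounded_integrable[OF g(1) FE_parts_ess_bounded(1)[OF e(1)[OF that]]]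
        show ?thesis by (simp add: energy_test_def)
      qed
      have "(\<Sum>k<n. d k * l (\<lambda>x. energy_test (e k x)))
          = (\<Sum>k<n. (LINT x|lebesgue_on \<Omega>. d k * (g1 x \<bullet> fst (energy_test (e k x)) + g2 x \<bullet> snd (snd (energy_test (e k x))))))"
        by (simp add: l_def)
      also have "\<dots> = (LINT x|lebesgue_on \<Omega>. (\<Sum>k<n. d k * (g1 x \<bullet> fst (energy_test (e k x)) + g2 x \<bullet> snd (snd (energy_test (e k x))))))"
        by (rule Bochner_Integration.integral_sum[symmetric]) (intro integrable_mult_right int, simp)
      also have "\<dots> = l V"
        unfolding l_def
      proof (intro Bochner_Integration.integral_cong refl)
        fix x assume "x \<in> space (lebesgue_on \<Omega>)"
        then have "x \<in> closure \<Omega>" using closure_subset by auto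
        then have "V x = energy_test (Uc d x)" using V'(2) d by simp
        then have Vx: "V x = (\<Sum>k<n. d k *\<^sub>R energy_test (e k x))"
          by (simp add: Uc_def linear_sum[OF linear_energy_test(1)] linear_scale[OF linear_energy_test(1)])
        show "(\<Sum>k<n. d k * (g1 x \<bullet> fst (energy_test (e k x)) + g2 x \<bullet> snd (snd (energy_test (e k x)))))
            = g1 x \<bullet> fst (V x) + g2 x \<bullet> snd (snd (V x))"
          unfolding Vx by (simp add: fst_sum snd_sum inner_sum_right distrib_left sum.distrib)
      qed
      finally show ?thesis .
    qed
    finally show ?thesis by (simp add: B_def)
  qed
  then show ?thesis using UcFE[of c] unfolding l_def by blast
qed


lemma V_h_PL: "v \<in> V_h \<Omega> \<T> \<Longrightarrow> v \<in> PL"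
  by (auto simp: PL_def V_h_def Basis_vec_def inner_axis)

lemma W_h_PL: "C \<in> W_h \<Omega> \<T> \<Longrightarrow> C \<in> PL"
  by (auto simp: PL_def W_h_def Basis_vec_def inner_axis)

text \<open>Values of \<open>v\<close> outside the closed domain are arbitrary, so measurability of the composition rests on
  \<open>X\<^sub>1\<close> staying in the closed domain.\<close>

lemma upwind_L2:
  fixes v :: "R2 \<Rightarrow> 'e::euclidean_space"
  assumes v: "v \<in> PL" and w: "w \<in> C_W1inf_0 Tf \<Omega>"
    and dt: "\<Delta>t > 0" and cfl: "ereal \<Delta>t * C_W1inf_seminorm Tf \<Omega> w \<le> ereal (1/4)"
    and t: "real n * \<Delta>t \<in> {0..Tf}"
  shows "v \<circ> X1 w \<Delta>t n \<in> L2 \<Omega>"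
proof -
  define v' where "v' y = indicator (closure \<Omega>) y *\<^sub>R v y" for y
  have v'm: "v' \<in> borel_measurable borel"
    unfolding v'_def[abs_def] by (rule borel_measurable_continuous_on_indicator[OF _ PL_continuous[OF v]]) simp
  have "(\<lambda>x. w (real n * \<Delta>t) x $ i) \<in> borel_measurable (lebesgue_on \<Omega>)" for i
    using w t by (auto simp: C_W1inf_0_def W1inf_0_def W1inf_def Linf_def)
  then have "w (real n * \<Delta>t) \<in> borel_measurable (lebesgue_on \<Omega>)"
    by (subst borel_measurable_euclidean_space) (auto simp: Basis_vec_def inner_axis)
  then have "(\<lambda>x. \<Delta>t *\<^sub>R w (real n * \<Delta>t) x) \<in> borel_measurable (lebesgue_on \<Omega>)"
    by (intro borel_measurable_scaleR borel_measurable_const)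
  then have "(\<lambda>x. x - \<Delta>t *\<^sub>R w (real n * \<Delta>t) x) \<in> borel_measurable (lebesgue_on \<Omega>)"
    using id_borel_measurable_lebesgue_on[of \<Omega>] by (intro borel_measurable_diff) (simp_all add: id_def)
  then have "X1 w \<Delta>t n \<in> borel_measurable (lebesgue_on \<Omega>)" unfolding X1_def[abs_def] .
  then have m: "(\<lambda>x. v' (X1 w \<Delta>t n x)) \<in> borel_measurable (lebesgue_on \<Omega>)"
    by (rule measurable_compose[OF _ v'm])
  note inside = X1_in_closure[OF open_domain bounded_domain w dt cfl t]
  have "AE x in lebesgue_on \<Omega>. v' (X1 w \<Delta>t n x) = (v \<circ> X1 w \<Delta>t n) x"
    using inside by eventually_elim (simp add: v'_def)
  from measurable_lebesgue_on_AE_eq[OF m this domain_lebesgue]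
  have "v \<circ> X1 w \<Delta>t n \<in> borel_measurable (lebesgue_on \<Omega>)" .
  moreover obtain B where B: "\<And>x. x \<in> closure \<Omega> \<Longrightarrow> norm (v x) \<le> B" using PL_bounded[OF v] by metis
  have "AE x in lebesgue_on \<Omega>. norm ((v \<circ> X1 w \<Delta>t n) x) \<le> B"
    using inside by eventually_elim (simp add: B)
  ultimately show ?thesis by (intro bounded_measurable_L2[OF open_domain bounded_domain])
qed

lemma jet_zero_parts:
  assumes V: "V \<in> FE" and x: "x \<in> mesh_interior"
  shows "(\<And>y. snd (snd (V y)) = 0) \<Longrightarrow> con (jet V x) = 0 \<and> gC i k (jet V x) = 0"
    and "(\<And>y. fst (V y) = 0) \<Longrightarrow> vel (jet V x) = 0 \<and> Gu (jet V x) = 0"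
    and "(\<And>y. fst (snd (V y)) = 0) \<Longrightarrow> pre (jet V x) = 0 \<and> gp (jet V x) = 0"
proof -
  note dV = PL_differentiable[OF FE_PL[OF V] x]
  have const: "axis_deriv j (\<lambda>y. 0) x = 0" for j
    by (simp add: axis_deriv_eqI[OF has_derivative_const])
  have l: "linear (\<lambda>z::state. snd (snd z))" "linear (\<lambda>z::state. fst z)" "linear (\<lambda>z::state. fst (snd z))"
    by (auto intro!: linearI)
  note D = l[THEN axis_deriv_linear, OF dV, symmetric]
  show "con (jet V x) = 0 \<and> gC i k (jet V x) = 0" if "\<And>y. snd (snd (V y)) = 0"
    unfolding jet_parts gC_def dj_jet D that const by (simp add: vec_eq_iff)
  show "vel (jet V x) = 0 \<and> Gu (jet V x) = 0" if "\<And>y. fst (V y) = 0"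
    unfolding jet_parts Gu_def dj_jet D that const by (simp add: vec_eq_iff)
  show "pre (jet V x) = 0 \<and> gp (jet V x) = 0" if "\<And>y. fst (snd (V y)) = 0"
    unfolding jet_parts gp_def dj_jet D that const by (simp add: vec_eq_iff)
qed

text \<open>The combined equation of \<open>step_exists\<close> splits into the two equations of the scheme by the choice of
  test triples \<open>(v, q, 0)\<close> and \<open>(0, 0, D)\<close>.\<close>

lemma scheme_step_exists:
  assumes u_old: "u_old \<in> V_h \<Omega> \<T>" and C_old: "C_old \<in> W_h \<Omega> \<T>"
    and f: "f \<in> L2 \<Omega>" and F: "F \<in> L2 \<Omega>" and w: "w \<in> C_W1inf_0 Tf \<Omega>"
    and dt: "0 < \<Delta>t" "\<Delta>t < 1/2" and cfl: "ereal \<Delta>t * C_W1inf_seminorm Tf \<Omega> w \<le> ereal (1/4)"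
    and t: "real n * \<Delta>t \<in> {0..Tf}" and \<nu>: "\<nu> > 0" and \<epsilon>: "\<epsilon> \<ge> 0" and \<delta>: "\<delta> > 0"
  shows "\<exists>u p C. u \<in> V_h \<Omega> \<T> \<and> p \<in> Q_h \<Omega> \<T> \<and> C \<in> W_h \<Omega> \<T> \<and>
    momentum_eq \<Omega> \<T> \<nu> \<delta> \<Delta>t w f n u u_old p C \<and> conformation_eq \<Omega> \<T> \<epsilon> \<Delta>t w F n u C C_old"
proof -
  define a where "a = 1 / \<Delta>t"
  have a: "a > 2" using dt by (simp add: a_def field_simps)
  define uo where "uo = u_old \<circ> X1 w \<Delta>t n"
  define Co where "Co = C_old \<circ> X1 w \<Delta>t n"
  have uo: "uo \<in> L2 \<Omega>" and Co: "Co \<in> L2 \<Omega>"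
    unfolding uo_def Co_def
    by (rule upwind_L2[OF V_h_PL[OF u_old] w dt(1) cfl t], rule upwind_L2[OF W_h_PL[OF C_old] w dt(1) cfl t])
  let ?g1 = "\<lambda>x. a *\<^sub>R uo x + f x" and ?g2 = "\<lambda>x. a *\<^sub>R Co x + F x"
  have g: "?g1 \<in> L2 \<Omega>" "?g2 \<in> L2 \<Omega>" by (rule L2_lincomb[OF uo f], rule L2_lincomb[OF Co F])
  obtain U where U: "U \<in> FE" and eq: "\<And>V. V \<in> FE \<Longrightarrow>
      (LINT x|lebesgue_on \<Omega>. momentum_form a \<nu> \<delta> (mesh_weight x) (jet U x) (jet V x)
        + conformation_form a \<epsilon> (jet U x) (jet V x))
      = (LINT x|lebesgue_on \<Omega>. ?g1 x \<bullet> fst (V x) + ?g2 x \<bullet> snd (snd (V x)))"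
    using step_exists[OF u_old a \<nu> \<epsilon> \<delta> g] by blast
  define u where "u x = fst (U x)" for x
  define p where "p x = fst (snd (U x))" for x
  define C where "C x = snd (snd (U x))" for x
  have mem: "u \<in> V_h \<Omega> \<T>" "p \<in> Q_h \<Omega> \<T>" "C \<in> W_h \<Omega> \<T>"
    using U by (simp_all add: FE_def u_def[abs_def] p_def[abs_def] C_def[abs_def])
  note Z = zero_members[OF u_old]
  have mm: "(\<lambda>x. momentum_form a \<nu> \<delta> (mesh_weight x) (jet U x) (jet V x)) \<in> borel_measurable (lebesgue_on \<Omega>)"
    and cm: "(\<lambda>x. conformation_form a \<epsilon> (jet U x) (jet V x)) \<in> borel_measurable (lebesgue_on \<Omega>)" if "V \<in> FE" for V
    using form_ess_bounded[OF forms_continuous(1) FE_jet_ess_bounded[OF U] FE_jet_ess_bounded[OF that]]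
      form_ess_bounded[of "\<lambda>k. conformation_form a \<epsilon>", OF forms_continuous(2) FE_jet_ess_bounded[OF U] FE_jet_ess_bounded[OF that]]
    by (simp_all add: ess_bounded_def)
  have "momentum_eq \<Omega> \<T> \<nu> \<delta> \<Delta>t w f n u u_old p C"
    unfolding momentum_eq_def
  proof (intro ballI)
    fix v q assume vq: "v \<in> V_h \<Omega> \<T>" "q \<in> Q_h \<Omega> \<T>"
    define V :: "R2 \<Rightarrow> state" where "V x = (v x, q x, 0)" for x
    have V: "V \<in> FE" using vq Z by (simp add: FE_def V_def)
    have "(LINT x|lebesgue_on \<Omega>. momentum_form a \<nu> \<delta> (mesh_weight x) (jet U x) (jet V x))
        = (LINT x|lebesgue_on \<Omega>. momentum_form a \<nu> \<delta> (mesh_weight x) (jet U x) (jet V x)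
            + conformation_form a \<epsilon> (jet U x) (jet V x))"
    proof (rule integral_cong_AE[OF mm[OF V] borel_measurable_add[OF mm[OF V] cm[OF V]]])
      show "AE x in lebesgue_on \<Omega>. momentum_form a \<nu> \<delta> (mesh_weight x) (jet U x) (jet V x)
          = momentum_form a \<nu> \<delta> (mesh_weight x) (jet U x) (jet V x) + conformation_form a \<epsilon> (jet U x) (jet V x)"
        using AE_mesh_interior
        by eventually_elim (use jet_zero_parts(1)[OF V] in \<open>simp add: conformation_form_def V_def\<close>)
    qed
    also have "\<dots> = (LINT x|lebesgue_on \<Omega>. ?g1 x \<bullet> fst (V x))"
      unfolding eq[OF V] by (simp add: V_def)
    finally show "ip \<Omega> (\<lambda>x. (1/\<Delta>t) *\<^sub>R (u x - (u_old \<circ> X1 w \<Delta>t n) x)) v + A_h \<Omega> \<T> \<nu> \<delta> (u, p) (v, q)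
        = - ip \<Omega> (\<lambda>x. trace (C x) *\<^sub>R C x) (jac \<Omega> v) + ip \<Omega> f v"
      using momentum_identity[OF U V uo f, of a \<nu> \<delta>]
      by (simp add: V_def u_def[abs_def] p_def[abs_def] C_def[abs_def] a_def uo_def)
  qed
  moreover have "conformation_eq \<Omega> \<T> \<epsilon> \<Delta>t w F n u C C_old"
    unfolding conformation_eq_def
  proof (intro ballI)
    fix D assume D: "D \<in> W_h \<Omega> \<T>"
    define V :: "R2 \<Rightarrow> state" where "V x = (0, 0, D x)" for x
    have V: "V \<in> FE" using D Z by (simp add: FE_def V_def)
    have "(LINT x|lebesgue_on \<Omega>. conformation_form a \<epsilon> (jet U x) (jet V x))
        = (LINT x|lebesgue_on \<Omega>. momentum_form a \<nu> \<delta> (mesh_weight x) (jet U x) (jet V x)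
            + conformation_form a \<epsilon> (jet U x) (jet V x))"
    proof (rule integral_cong_AE[OF cm[OF V] borel_measurable_add[OF mm[OF V] cm[OF V]]])
      show "AE x in lebesgue_on \<Omega>. conformation_form a \<epsilon> (jet U x) (jet V x)
          = momentum_form a \<nu> \<delta> (mesh_weight x) (jet U x) (jet V x) + conformation_form a \<epsilon> (jet U x) (jet V x)"
        using AE_mesh_interior
        by eventually_elim
          (use jet_zero_parts(2,3)[OF V] in \<open>simp add: momentum_form_def V_def linear_matrix_parts[THEN linear_0]\<close>)
    qed
    also have "\<dots> = (LINT x|lebesgue_on \<Omega>. ?g2 x \<bullet> snd (snd (V x)))"
      unfolding eq[OF V] by (simp add: V_def)
    finally show "ip \<Omega> (\<lambda>x. (1/\<Delta>t) *\<^sub>R (C x - (C_old \<circ> X1 w \<Delta>t n) x)) D + \<epsilon> * a_c \<Omega> C D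
        = 2 * ip \<Omega> (\<lambda>x. jac \<Omega> u x ** C x) D + ip \<Omega> (\<lambda>x. dvg \<Omega> u x *\<^sub>R sharp (C x)) D
          - ip \<Omega> (\<lambda>x. (trace (C x))\<^sup>2 *\<^sub>R C x) D + ip \<Omega> (\<lambda>x. trace (C x) *\<^sub>R mat 1) D + ip \<Omega> F D"
      using conformation_identity[OF U V Co F, of a \<epsilon>]
      by (simp add: V_def u_def[abs_def] C_def[abs_def] a_def Co_def)
  qed
  ultimately show ?thesis using mem by blast
qed

end

section \<open>Existence for all time steps\<close>

theorem proposition2:
  fixes \<Omega> :: "R2 set" and Tf \<nu> \<epsilon> \<delta>\<^sub>0 \<alpha>\<^sub>0 h \<Delta>t :: real
    and H :: "real set" and \<T> :: "real \<Rightarrow> R2 set set"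
    and w :: "real \<Rightarrow> R2 \<Rightarrow> R2"
    and u0 :: "R2 \<Rightarrow> R2" and C0 :: "R2 \<Rightarrow> M2"
    and f :: "nat \<Rightarrow> R2 \<Rightarrow> R2" and F :: "nat \<Rightarrow> R2 \<Rightarrow> M2"
  assumes "polygonal_domain \<Omega>" and "bounded \<Omega>"
    and "Tf > 0" and "\<nu> > 0" and "\<delta>\<^sub>0 > 0" and "\<epsilon> \<in> {0..1}"
    and "regular_family \<Omega> H \<T>"
    and "\<alpha>\<^sub>0 > 0" and "\<forall>h\<in>H. \<forall>K\<in>\<T> h. h / diameter K \<le> \<alpha>\<^sub>0"
    and "w \<in> C_W1inf_0 Tf \<Omega>"
    and "h \<in> H"
    and "\<Delta>t \<in> {0<..<1/2}" and "ereal \<Delta>t * C_W1inf_seminorm Tf \<Omega> w \<le> ereal (1/4)"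
    and "u0 \<in> V_h \<Omega> (\<T> h)" and "C0 \<in> W_h \<Omega> (\<T> h)"
    and "\<forall>n\<in>{1..N_T Tf \<Delta>t}. f n \<in> L2 \<Omega> \<and> F n \<in> L2 \<Omega>"
  shows "\<exists>u p C. scheme_solution \<Omega> (\<T> h) Tf \<nu> \<epsilon> \<delta>\<^sub>0 \<Delta>t w u0 C0 f F u p C"
proof -
  interpret mesh \<Omega> "\<T> h"
    using assms(1,2,7,11) by unfold_locales (auto simp: polygonal_domain_def regular_family_def)
  have dt: "0 < \<Delta>t" "\<Delta>t < 1/2" using assms(12) by auto
  have time: "real n * \<Delta>t \<in> {0..Tf}" if "n \<le> N_T Tf \<Delta>t" for n
  proof -
    have "real n \<le> Tf / \<Delta>t"
      using that assms(3) dt(1) unfolding N_T_def by (simp add: le_nat_floor le_nat_iff le_floor_iff)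
    then show ?thesis using dt(1) by (simp add: le_divide_eq)
  qed
  \<comment> \<open>Dependent choice runs over all natural numbers; past the final time the state is kept unchanged.\<close>
  define P where "P n s \<longleftrightarrow> fst s \<in> V_h \<Omega> (\<T> h) \<and> snd (snd s) \<in> W_h \<Omega> (\<T> h) \<and> (n = 0 \<longrightarrow> fst s = u0 \<and> snd (snd s) = C0)"
    for n :: nat and s :: "(R2 \<Rightarrow> R2) \<times> (R2 \<Rightarrow> real) \<times> (R2 \<Rightarrow> M2)"
  define R where "R n s s' \<longleftrightarrow> (Suc n \<le> N_T Tf \<Delta>t \<longrightarrow> fst (snd s') \<in> Q_h \<Omega> (\<T> h) \<and>
      momentum_eq \<Omega> (\<T> h) \<nu> \<delta>\<^sub>0 \<Delta>t w (f (Suc n)) (Suc n) (fst s') (fst s) (fst (snd s')) (snd (snd s')) \<and>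
      conformation_eq \<Omega> (\<T> h) \<epsilon> \<Delta>t w (F (Suc n)) (Suc n) (fst s') (snd (snd s')) (snd (snd s)))"
    for n :: nat and s s' :: "(R2 \<Rightarrow> R2) \<times> (R2 \<Rightarrow> real) \<times> (R2 \<Rightarrow> M2)"
  have "\<exists>S. \<forall>n. P n (S n) \<and> R n (S n) (S (Suc n))"
  proof (rule dependent_nat_choice)
    show "\<exists>s. P 0 s"
      by (rule exI[of _ "(u0, (\<lambda>x. 0), C0)"]) (use assms(14,15) in \<open>simp add: P_def\<close>)
    fix s n assume s: "P n s"
    show "\<exists>s'. P (Suc n) s' \<and> R n s s'"
    proof (cases "Suc n \<le> N_T Tf \<Delta>t")
      case False
      then show ?thesis using s by (intro exI[of _ s]) (simp add: P_def R_def)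
    next
      case True
      have "\<exists>u p C. u \<in> V_h \<Omega> (\<T> h) \<and> p \<in> Q_h \<Omega> (\<T> h) \<and> C \<in> W_h \<Omega> (\<T> h) \<and>
          momentum_eq \<Omega> (\<T> h) \<nu> \<delta>\<^sub>0 \<Delta>t w (f (Suc n)) (Suc n) u (fst s) p C \<and>
          conformation_eq \<Omega> (\<T> h) \<epsilon> \<Delta>t w (F (Suc n)) (Suc n) u C (snd (snd s))"
        by (rule scheme_step_exists[OF _ _ _ _ assms(10) dt assms(13) time[OF True] assms(4) _ assms(5)])
          (use s True assms(6,16) in \<open>auto simp: P_def\<close>)
      then obtain u p C where "u \<in> V_h \<Omega> (\<T> h)" "p \<in> Q_h \<Omega> (\<T> h)" "C \<in> W_h \<Omega> (\<T> h)"
          "momentum_eq \<Omega> (\<T> h) \<nu> \<delta>\<^sub>0 \<Delta>t w (f (Suc n)) (Suc n) u (fst s) p C"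
          "conformation_eq \<Omega> (\<T> h) \<epsilon> \<Delta>t w (F (Suc n)) (Suc n) u C (snd (snd s))"
        by blast
      then show ?thesis by (intro exI[of _ "(u, p, C)"]) (simp add: P_def R_def)
    qed
  qed
  then obtain S where S: "\<And>n. P n (S n)" "\<And>n. R n (S n) (S (Suc n))" by blast
  have "scheme_solution \<Omega> (\<T> h) Tf \<nu> \<epsilon> \<delta>\<^sub>0 \<Delta>t w u0 C0 f F
      (\<lambda>n. fst (S n)) (\<lambda>n. fst (snd (S n))) (\<lambda>n. snd (snd (S n)))"
    unfolding scheme_solution_def
  proof (intro conjI ballI)
    show "fst (S 0) = u0" "snd (snd (S 0)) = C0" using S(1)[of 0] by (simp_all add: P_def)
    fix n assume n: "n \<in> {1..N_T Tf \<Delta>t}"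
    then obtain m where m: "n = Suc m" by (cases n) auto
    note step = S(1)[of n, unfolded P_def] S(2)[of m, unfolded R_def]
    show "fst (S n) \<in> V_h \<Omega> (\<T> h)" "fst (snd (S n)) \<in> Q_h \<Omega> (\<T> h)" "snd (snd (S n)) \<in> W_h \<Omega> (\<T> h)"
      "momentum_eq \<Omega> (\<T> h) \<nu> \<delta>\<^sub>0 \<Delta>t w (f n) n (fst (S n)) (fst (S (n - 1))) (fst (snd (S n))) (snd (snd (S n)))"
      "conformation_eq \<Omega> (\<T> h) \<epsilon> \<Delta>t w (F n) n (fst (S n)) (snd (snd (S n))) (snd (snd (S (n - 1))))"
      using step n m by simp_all
  qed
  then show ?thesis by blast
qed

end
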